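(* Any tester for determining whether a bipartite pure state has exactly $r$ nonzero Schmidt coefficients all equal to $1/\sqrt r$, or exactly $r+\Delta$ nonzero Schmidt coefficients all equal to $1/\sqrt{r+\Delta}$, requires sample complexity $\mathsf{S}(\textsc{UniformSchmidtCoefficients}^{r,\Delta})=\Omega^*(r^2/\Delta)$.
   Context: Here $\textsc{UniformSchmidtCoefficients}^{r,\Delta}=(\mathcal{Q}^r,\mathcal{Q}^{r+\Delta})$ where $\mathcal{Q}^s$ is the set of pure states in $\mathbb{C}^d\otimes\mathbb{C}^d$ with exactly $s$ nonzero Schmidt coefficients, each equal to $1/\sqrt s$. $\Omega^*(\cdot)$ suppresses quasi-polylogarithmic factors such as $r^{o(1)}$. $\mathsf{S}(\cdot)$ is the minimum $N$ such that some $0\preceq\mathcal{T}\preceq I$ on $N$ copies accepts yes-instances w.p. $\ge2/3$ and no-instances w.p. $\le1/3$. *)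

theory Defs
  imports Complex_Main "HOL-Library.Extended_Nat"
begin

text \<open>Local dimension d. A vector in C^d \<otimes> C^d is a function on index pairs (i,j), i,j<d
  (taken to be 0 outside). A vector in C^d is a function nat \<Rightarrow> complex on {..<d}.\<close>

definition orthonormal_family :: "nat \<Rightarrow> nat \<Rightarrow> (nat \<Rightarrow> nat \<Rightarrow> complex) \<Rightarrow> bool" where
  "orthonormal_family d s a \<longleftrightarrow>
     (\<forall>k<s. \<forall>l<s. (\<Sum>i<d. cnj (a k i) * a l i) = (if k = l then 1 else 0))"

definition uniform_schmidt_states :: "nat \<Rightarrow> nat \<Rightarrow> (nat \<times> nat \<Rightarrow> complex) set" where
  "uniform_schmidt_states d s =
     {\<psi>. \<exists>a b. orthonormal_family d s a \<and> orthonormal_family d s b \<and>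
        (\<forall>i j. \<psi> (i, j) = (if i < d \<and> j < d
                 then (\<Sum>k<s. complex_of_real (1 / sqrt (real s)) * a k i * b k j) else 0))}"

text \<open>Basis index set of (C^d \<otimes> C^d)^{\<otimes> N}: lists of N index pairs.\<close>
definition copy_indices :: "nat \<Rightarrow> nat \<Rightarrow> (nat \<times> nat) list set" where
  "copy_indices d N = {xs. length xs = N \<and> set xs \<subseteq> {..<d} \<times> {..<d}}"

definition tensor_power :: "nat \<Rightarrow> (nat \<times> nat \<Rightarrow> complex) \<Rightarrow> (nat \<times> nat) list \<Rightarrow> complex" where
  "tensor_power N \<psi> xs = (\<Prod>t<N. \<psi> (xs ! t))"

definition qform :: "(nat \<times> nat) list set \<Rightarrow> ((nat \<times> nat) list \<Rightarrow> (nat \<times> nat) list \<Rightarrow> complex)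
     \<Rightarrow> ((nat \<times> nat) list \<Rightarrow> complex) \<Rightarrow> complex" where
  "qform I T v = (\<Sum>x\<in>I. \<Sum>y\<in>I. cnj (v x) * T x y * v y)"

definition between_zero_id :: "(nat \<times> nat) list set \<Rightarrow> ((nat \<times> nat) list \<Rightarrow> (nat \<times> nat) list \<Rightarrow> complex) \<Rightarrow> bool" where
  "between_zero_id I T \<longleftrightarrow>
     (\<forall>x\<in>I. \<forall>y\<in>I. T y x = cnj (T x y)) \<and>
     (\<forall>v. 0 \<le> Re (qform I T v) \<and> Re (qform I T v) \<le> (\<Sum>x\<in>I. (cmod (v x))\<^sup>2))"

definition accept_prob :: "nat \<Rightarrow> nat \<Rightarrow> ((nat \<times> nat) list \<Rightarrow> (nat \<times> nat) list \<Rightarrow> complex)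
     \<Rightarrow> (nat \<times> nat \<Rightarrow> complex) \<Rightarrow> real" where
  "accept_prob d N T \<psi> = Re (qform (copy_indices d N) T (tensor_power N \<psi>))"

definition is_tester :: "nat \<Rightarrow> nat \<Rightarrow> (nat \<times> nat \<Rightarrow> complex) set \<Rightarrow> (nat \<times> nat \<Rightarrow> complex) set
     \<Rightarrow> ((nat \<times> nat) list \<Rightarrow> (nat \<times> nat) list \<Rightarrow> complex) \<Rightarrow> bool" where
  "is_tester d N Yes No T \<longleftrightarrow>
     between_zero_id (copy_indices d N) T \<and>
     (\<forall>\<psi>\<in>Yes. accept_prob d N T \<psi> \<ge> 2/3) \<and>
     (\<forall>\<psi>\<in>No. accept_prob d N T \<psi> \<le> 1/3)"

text \<open>Sample complexity S: minimal N admitting a tester (\<infinity> if none).\<close>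
definition sample_complexity :: "nat \<Rightarrow> (nat \<times> nat \<Rightarrow> complex) set \<Rightarrow> (nat \<times> nat \<Rightarrow> complex) set \<Rightarrow> enat" where
  "sample_complexity d Yes No = (INF N \<in> {N. \<exists>T. is_tester d N Yes No T}. enat N)"

definition uniform_schmidt_sc :: "nat \<Rightarrow> nat \<Rightarrow> nat \<Rightarrow> enat" where
  "uniform_schmidt_sc d r \<Delta> =
     sample_complexity d (uniform_schmidt_states d r) (uniform_schmidt_states d (r + \<Delta>))"

end

theory Submission
  imports Defs "HOL-Library.FuncSet" "HOL-Combinatorics.Permutations"
    "HOL-Computational_Algebra.Polynomial" "HOL-Real_Asymp.Real_Asymp"
begin

text \<open>
  Twirling a tester over local unitaries leaves only its action on the symmetric group algebra.
  Writing \<open>J\<^sub>0, J\<^sub>1, \<dots>\<close> for the commuting Jucys-Murphy elements and \<open>\<mu>\<close> for their joint spectral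
  measure in the canonical trace (the Plancherel measure), a tester with \<open>n\<close> copies cannot do better
  than distinguish the Schur-Weyl densities \<open>h\<^sub>k = \<Prod>\<^sub>j (1 + J\<^sub>j / k)\<close>, \<open>k = r\<close> and \<open>k = s = r + \<Delta>\<close>,
  with respect to \<open>\<mu>\<close>. Concretely, the two averaged states are purified by unit vectors whose overlap
  is the affinity \<open>\<integral> \<surd>(h\<^sub>r h\<^sub>s) d\<mu>\<close>.

  The affinity is bounded below one Jucys-Murphy element at a time. With \<open>x\<close> and \<open>\<delta>\<close> the half sum and
  half difference of \<open>1/r\<close> and \<open>1/s\<close>, one has
  \<open>\<surd>((1 + c/r)(1 + c/s)) \<ge> 1 + x c - 2 \<delta>\<^sup>2 c\<^sup>2 - 2 (2 x c)\<^bsup>2p\<^esup>\<close>; conditionally on \<open>J\<^sub>i\<close>, \<open>i < j\<close>, the element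
  \<open>J\<^sub>j\<close> has mean \<open>0\<close> and variance \<open>j\<close>, while a count of products of star transpositions bounds its
  \<open>2p\<close>-th moment by \<open>(2p)! n\<^bsup>p\<^esup>\<close>. Hence the affinity is at least
  \<open>1 - \<delta>\<^sup>2 n\<^sup>2 - 2 n (2p)! (4 x\<^sup>2 n)\<^bsup>p\<^esup>\<close>, and \<open>p \<approx> log r\<close> gives the claim with a loss of \<open>64 p\<^sup>2\<close>.
\<close>

section \<open>Linear operators on functions\<close>

text \<open>Why high moments: expanding the square root needs the eigenvalue c to be at most of
  order r. Paying for larger c with the variance alone would cost about j / r^2 in step j, n^2 / r^2
  in total, and stop at n of order r; the 2p-th moment makes this cost negligible as long as n p^2
  is small against r^2. The obstacle in the step: a partial product of affinities is not the density
  of a trace over words. Its first two moments against \<open>jm j\<close> need only the canonical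
  trace, because the product involves positions below j. For the 2p-th moment the geometric mean is
  first dominated by the arithmetic mean of the two Schur-Weyl densities, and under each of these
  the moment counts fixed words. No Young diagrams are used. What is needed of Schur-Weyl duality is
  shown directly: one-particle operators generate all permutation-invariant matrices, and a matrix
  commuting with these lies in the group algebra. The latter is applied to one matrix only, the
  image of the maximally entangled vector under the tester. Operators are real because the purifying
  vectors are real, so only the real part of a tester matters.\<close>

typedef 'w lop = "{f :: ('w \<Rightarrow> real) \<Rightarrow> ('w \<Rightarrow> real).
    (\<forall>u v. f (\<lambda>w. u w + v w) = (\<lambda>w. f u w + f v w)) \<and> (\<forall>c u. f (\<lambda>w. c * u w) = (\<lambda>w. c * f u w))}"
  morphisms app Lop
  by (rule exI[of _ "\<lambda>u. u"]) auto

setup_lifting type_definition_lop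

lemma app_add: "app X (\<lambda>w. u w + v w) = (\<lambda>w. app X u w + app X v w)"
  and app_scale: "app X (\<lambda>w. c * u w) = (\<lambda>w. c * app X u w)"
  using app[of X] by auto

lemma app_zero: "app X (\<lambda>w. 0) = (\<lambda>w. 0)"
  using app_scale[of X 0 "\<lambda>w. 0"] by simp

lemma app_sum: "app X (\<lambda>w. \<Sum>i\<in>I. f i w) = (\<lambda>w. \<Sum>i\<in>I. app X (f i) w)"
  by (induction I rule: infinite_finite_induct) (auto simp: app_zero app_add)

instantiation lop :: (type) real_algebra_1
begin

lift_definition zero_lop :: "'a lop" is "\<lambda>u w. 0" by simp
lift_definition one_lop :: "'a lop" is "\<lambda>u. u" by simp
lift_definition plus_lop :: "'a lop \<Rightarrow> 'a lop \<Rightarrow> 'a lop" is "\<lambda>f g u w. f u w + g u w"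
  by (auto simp: algebra_simps)
lift_definition minus_lop :: "'a lop \<Rightarrow> 'a lop \<Rightarrow> 'a lop" is "\<lambda>f g u w. f u w - g u w"
  by (auto simp: algebra_simps)
lift_definition uminus_lop :: "'a lop \<Rightarrow> 'a lop" is "\<lambda>f u w. - f u w"
  by (auto simp: algebra_simps)
lift_definition times_lop :: "'a lop \<Rightarrow> 'a lop \<Rightarrow> 'a lop" is "\<lambda>f g u. f (g u)"
  by (auto simp: algebra_simps)
lift_definition scaleR_lop :: "real \<Rightarrow> 'a lop \<Rightarrow> 'a lop" is "\<lambda>c f u w. c * f u w"
  by (auto simp: algebra_simps)

instance
proof
  show "(0::'a lop) \<noteq> 1"
  proof transfer
    show "(\<lambda>u w. 0) \<noteq> (\<lambda>u. u :: 'a \<Rightarrow> real)"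
      by (metis zero_neq_one)
  qed
qed (transfer; auto simp: fun_eq_iff algebra_simps)+

end

lemma app_simps [simp]:
  "app 0 u w = 0" "app 1 u = u" "app (X + Y) u w = app X u w + app Y u w"
  "app (X - Y) u w = app X u w - app Y u w" "app (- X) u w = - app X u w"
  "app (X * Y) u = app X (app Y u)" "app (c *\<^sub>R X) u w = c * app X u w"
  by (transfer; simp)+

lemma app_sum_left: "app (\<Sum>i\<in>I. X i) u w = (\<Sum>i\<in>I. app (X i) u w)"
  by (induction I rule: infinite_finite_induct) auto

lemma lop_eqI: "(\<And>u w. app X u w = app Y u w) \<Longrightarrow> X = Y"
  by (metis app_inject ext)

section \<open>Polynomials in an element of a real algebra\<close>

definition peval :: "real poly \<Rightarrow> 'a::real_algebra_1 \<Rightarrow> 'a" where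
  "peval p x = fold_coeffs (\<lambda>a r. of_real a + x * r) p 0"

lemma peval_0 [simp]: "peval 0 x = 0"
  by (simp add: peval_def)

lemma peval_pCons [simp]: "peval (pCons a p) x = of_real a + x * peval p x"
  by (cases "p = 0 \<and> a = 0") (auto simp: peval_def)

lemma peval_add: "peval (p + q) x = peval p x + peval q x"
  by (induction p q rule: poly_induct2) (auto simp: algebra_simps)

lemma peval_smult: "peval (smult a p) x = a *\<^sub>R peval p x"
  by (induction p) (auto simp: algebra_simps of_real_def)

lemma peval_mult: "peval (p * q) x = peval p x * peval q x"
  by (induction p) (auto simp: algebra_simps peval_add peval_smult mult_pCons_left of_real_def)

lemma peval_1 [simp]: "peval 1 x = 1"
  by (simp add: one_pCons)

lemma peval_sum: "peval (\<Sum>i\<in>I. p i) x = (\<Sum>i\<in>I. peval (p i) x)"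
  by (induction I rule: infinite_finite_induct) (auto simp: peval_add)

lemma peval_dvd_zero: "p dvd q \<Longrightarrow> peval p x = 0 \<Longrightarrow> peval q x = 0"
  by (auto simp: dvd_def peval_mult)

lemma peval_commute: "x * z = z * x \<Longrightarrow> peval p x * z = z * peval p x"
proof (induction p)
  case (pCons a p)
  have "x * peval p x * z = x * (z * peval p x)" using pCons by (simp add: mult.assoc)
  also have "\<dots> = z * (x * peval p x)" using pCons.prems by (simp add: mult.assoc[symmetric])
  finally show ?case by (simp add: algebra_simps of_real_def)
qed auto

lemma peval_intertwine: "z * x = y * z \<Longrightarrow> z * peval p x = peval p y * z"
proof (induction p)
  case (pCons a p)
  have "z * (x * peval p x) = y * (z * peval p x)" using pCons.prems by (simp add: mult.assoc[symmetric])
  also have "\<dots> = y * (peval p y * z)" using pCons by simp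
  finally show ?case by (simp add: algebra_simps of_real_def)
qed auto

lemma peval_subspace:
  assumes "subspace A" "1 \<in> A" "\<And>a b. a \<in> A \<Longrightarrow> b \<in> A \<Longrightarrow> a * b \<in> A" "x \<in> A"
  shows "peval p x \<in> A"
  by (induction p) (use assms in \<open>auto simp: subspace_def of_real_def\<close>)

section \<open>Spectral projections by Lagrange interpolation\<close>

definition root_poly :: "real set \<Rightarrow> real poly" where
  "root_poly S = (\<Prod>c\<in>S. [:- c, 1:])"

lemma root_poly_subset: "finite T \<Longrightarrow> S \<subseteq> T \<Longrightarrow> root_poly S dvd root_poly T"
  unfolding root_poly_def by (rule prod_dvd_prod_subset)

definition lagrange :: "real set \<Rightarrow> real \<Rightarrow> real poly" where
  "lagrange S c = smult (1 / (\<Prod>b\<in>S - {c}. c - b)) (root_poly (S - {c}))"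

lemma poly_lagrange:
  assumes "finite S" "c \<in> S" "b \<in> S"
  shows "poly (lagrange S c) b = (if b = c then 1 else 0)"
  using assms by (auto simp: lagrange_def root_poly_def poly_prod)

lemma degree_lagrange:
  assumes "finite S" "c \<in> S"
  shows "degree (lagrange S c) < card S"
proof -
  have "degree (root_poly (S - {c})) = card (S - {c})"
    unfolding root_poly_def by (subst degree_prod_eq_sum_degree) auto
  then have "degree (lagrange S c) \<le> card (S - {c})"
    unfolding lagrange_def by (metis degree_smult_le)
  also have "\<dots> < card S" using assms by (metis card_Diff1_less)
  finally show ?thesis .
qed

lemma sum_lagrange:
  assumes "finite S" "S \<noteq> {}"
  shows "(\<Sum>c\<in>S. lagrange S c) = 1"
proof (rule poly_eqI_degree[where A = S])
  fix b assume "b \<in> S"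
  then show "poly (\<Sum>c\<in>S. lagrange S c) b = poly 1 b"
    using assms by (simp add: poly_sum poly_lagrange cong: sum.cong)
next
  show "degree (\<Sum>c\<in>S. lagrange S c) < card S"
    using assms degree_lagrange by (intro degree_sum_less) (auto simp: card_gt_0_iff)
  show "degree (1 :: real poly) < card S" using assms by (auto simp: card_gt_0_iff)
qed

text \<open>The spectral projection of x at c as soon as \<open>root_poly S\<close> annihilates x.
  Being a polynomial in x, it inherits symmetry, commutation and membership in subalgebras from
  x.\<close>

definition idem :: "real set \<Rightarrow> 'a::real_algebra_1 \<Rightarrow> real \<Rightarrow> 'a" where
  "idem S x c = peval (lagrange S c) x"

lemma idem_eigen:
  assumes "finite S" "c \<in> S" "peval (root_poly S) x = 0"
  shows "x * idem S x c = c *\<^sub>R idem S x c"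
proof -
  have "root_poly S = [:- c, 1:] * root_poly (S - {c})"
    unfolding root_poly_def using assms by (simp add: prod.remove)
  then have "[:- c, 1:] * lagrange S c = smult (1 / (\<Prod>b\<in>S - {c}. c - b)) (root_poly S)"
    by (simp add: lagrange_def)
  then have "peval ([:- c, 1:] * lagrange S c) x = 0"
    using assms by (simp only: peval_smult) simp
  then show ?thesis
    by (simp only: peval_mult) (simp add: idem_def algebra_simps of_real_def)
qed

lemma idem_sum:
  assumes "finite S" "peval (root_poly S) x = 0"
  shows "(\<Sum>c\<in>S. idem S x c) = 1"
proof -
  have "S \<noteq> {}" using assms by (auto simp: root_poly_def)
  then show ?thesis
    unfolding idem_def using assms by (simp add: peval_sum[symmetric] sum_lagrange)
qed

lemma idem_commute: "x * z = z * x \<Longrightarrow> idem S x c * z = z * idem S x c"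
  unfolding idem_def by (rule peval_commute)

section \<open>The group algebra of the symmetric group and its Jucys-Murphy elements\<close>

type_synonym word = "nat \<Rightarrow> nat"

text \<open>Acting on all infinite words at once puts the group algebras of every degree into a
  single type, nested by \<open>perm_alg_mono\<close>, and words with pairwise distinct letters keep
  the action faithful.\<close>

lift_definition perm_op :: "(nat \<Rightarrow> nat) \<Rightarrow> word lop" is "\<lambda>p v w. v (w \<circ> p)"
  by simp

lemma app_perm_op [simp]: "app (perm_op p) v w = v (w \<circ> p)"
  by transfer simp

lemma perm_op_mult: "perm_op p * perm_op q = perm_op (p \<circ> q)"
  by (rule lop_eqI) (simp add: comp_assoc)

lemma perm_op_id [simp]: "perm_op id = 1"
  by (rule lop_eqI) simp

definition perm_alg :: "nat \<Rightarrow> word lop set" where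
  "perm_alg n = span (perm_op ` {p. p permutes {..<n}})"

lemma subspace_perm_alg: "subspace (perm_alg n)"
  by (simp add: perm_alg_def)

lemmas perm_alg_closed = subspace_add[OF subspace_perm_alg] subspace_scale[OF subspace_perm_alg]
  subspace_sum[OF subspace_perm_alg] subspace_diff[OF subspace_perm_alg]

lemma perm_op_in: "p permutes {..<n} \<Longrightarrow> perm_op p \<in> perm_alg n"
  unfolding perm_alg_def by (rule span_base) auto

lemma one_in: "1 \<in> perm_alg n"
  using perm_op_in[OF permutes_id] by simp

lemma perm_alg_mono: "m \<le> n \<Longrightarrow> perm_alg m \<subseteq> perm_alg n"
  unfolding perm_alg_def by (intro span_mono image_mono) (auto intro: permutes_subset)

lemma perm_alg_induct [consumes 1, case_names subspace perm]:
  assumes "X \<in> perm_alg n" "subspace {X. P X}" "\<And>p. p permutes {..<n} \<Longrightarrow> P (perm_op p)"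
  shows "P X"
  using assms(1) unfolding perm_alg_def
  by (rule span_induct) (use assms(2,3) in auto)

lemma mult_in: "X \<in> perm_alg n \<Longrightarrow> Y \<in> perm_alg n \<Longrightarrow> X * Y \<in> perm_alg n"
proof (induction X rule: perm_alg_induct)
  case subspace
  then show ?case
    using subspace_perm_alg[of n] by (auto simp: subspace_def algebra_simps)
next
  case (perm p)
  from perm(2) show ?case
  proof (induction Y rule: perm_alg_induct)
    case subspace
    then show ?case
      using subspace_perm_alg[of n] by (auto simp: subspace_def algebra_simps)
  next
    case (perm q)
    then show ?case using \<open>p permutes _\<close> by (simp add: perm_op_mult perm_op_in permutes_compose)
  qed
qed

lemma peval_in: "X \<in> perm_alg n \<Longrightarrow> peval p X \<in> perm_alg n"
  by (rule peval_subspace[OF subspace_perm_alg one_in mult_in])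

text \<open>Positions start at 0: \<open>jm 0\<close> is 0, and \<open>jm n\<close> lies in
  \<open>perm_alg (Suc n)\<close> while commuting with \<open>perm_alg n\<close>.\<close>

definition jm :: "nat \<Rightarrow> word lop" where
  "jm n = (\<Sum>i<n. perm_op (transpose i n))"

lemma jm_in: "n < m \<Longrightarrow> jm n \<in> perm_alg m"
  unfolding jm_def by (intro perm_alg_closed perm_op_in permutes_swap_id) auto

lemma transpose_conj: "bij p \<Longrightarrow> p \<circ> transpose a b = transpose (p a) (p b) \<circ> p"
  by (metis bij_is_inj transpose_comp_eq bij_is_surj surj_f_inv_f inv_f_f)

text \<open>Conjugation by a permutation of the positions below n fixes n and only permutes the
  transpositions summed in \<open>jm n\<close>.\<close>

lemma jm_commute_perm:
  assumes "p permutes {..<n}"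
  shows "jm n * perm_op p = perm_op p * jm n"
proof -
  have "perm_op p * jm n = (\<Sum>i<n. perm_op (transpose (p i) n \<circ> p))"
    unfolding jm_def sum_distrib_left perm_op_mult
    using transpose_conj[OF permutes_bij[OF assms]] permutes_not_in[OF assms, of n] by simp
  also have "\<dots> = (\<Sum>i<n. perm_op (transpose i n \<circ> p))"
    by (rule sum.permute[OF assms, of "\<lambda>i. perm_op (transpose i n \<circ> p)", symmetric, unfolded comp_def[of "\<lambda>i. perm_op (transpose i n \<circ> p)"]])
  also have "\<dots> = jm n * perm_op p"
    by (simp add: jm_def sum_distrib_right perm_op_mult)
  finally show ?thesis by simp
qed

lemma jm_commute_alg:
  assumes "X \<in> perm_alg n"
  shows "jm n * X = X * jm n"
  using assms
proof (induction X rule: perm_alg_induct)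
  case subspace
  then show ?case by (auto simp: subspace_def algebra_simps)
qed (rule jm_commute_perm)

lemma jm_commute: "jm m * jm n = jm n * jm m"
proof (induction m n rule: linorder_less_wlog)
  case (less m n)
  show ?case using jm_commute_alg[OF jm_in[OF less]] by simp
qed auto

text \<open>Conjugation by s turns (i n) into (i n+1) for i < n; the transposition (n n+1) itself is
  the extra summand. This relation alone drives the recursion for the spectrum.\<close>

lemma jm_Suc:
  defines "s \<equiv> \<lambda>n. perm_op (transpose n (Suc n))"
  shows "jm (Suc n) = s n * jm n * s n + s n"
proof -
  have *: "transpose n (Suc n) \<circ> transpose i n \<circ> transpose n (Suc n) = transpose i (Suc n)" if "i < n" for i
    using that by (auto simp: fun_eq_iff transpose_def)
  have "s n * jm n * s n = (\<Sum>i<n. perm_op (transpose i (Suc n)))"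
    unfolding jm_def s_def sum_distrib_left sum_distrib_right perm_op_mult
    by (intro sum.cong refl arg_cong[of _ _ perm_op] *) simp
  then show ?thesis by (simp add: jm_def s_def)
qed

subsection \<open>Symmetry\<close>

definition closed_words :: "nat \<Rightarrow> word set \<Rightarrow> bool" where
  "closed_words n W \<longleftrightarrow> finite W \<and> (\<forall>w\<in>W. \<forall>p. p permutes {..<n} \<longrightarrow> w \<circ> p \<in> W)"

text \<open>Self-adjointness for the inner products over finite permutation-stable sets of words,
  since functions on all words carry no inner product. Testing on orbits recovers finite-dimensional
  arguments.\<close>

definition symop :: "nat \<Rightarrow> word lop \<Rightarrow> bool" where
  "symop n X \<longleftrightarrow> (\<forall>W u v. closed_words n W \<longrightarrow>
     (\<Sum>w\<in>W. app X u w * v w) = (\<Sum>w\<in>W. u w * app X v w))"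

lemma symopD: "symop n X \<Longrightarrow> closed_words n W \<Longrightarrow>
     (\<Sum>w\<in>W. app X u w * v w) = (\<Sum>w\<in>W. u w * app X v w)"
  unfolding symop_def by blast

lemma closed_words_orbit: "closed_words n ((\<lambda>p. w \<circ> p) ` {p. p permutes {..<n}})"
  unfolding closed_words_def
  by (auto simp: finite_permutations comp_assoc intro!: imageI permutes_compose)

lemma closed_words_bij:
  assumes "closed_words n W" "p permutes {..<n}"
  shows "bij_betw (\<lambda>w. w \<circ> p) W W"
proof (rule bij_betw_byWitness[where f' = "\<lambda>w. w \<circ> inv p"])
  show "\<forall>w\<in>W. w \<circ> p \<circ> inv p = w" "\<forall>w\<in>W. w \<circ> inv p \<circ> p = w"
    using assms(2) by (simp_all add: comp_assoc permutes_inv_o)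
  show "(\<lambda>w. w \<circ> p) ` W \<subseteq> W" "(\<lambda>w. w \<circ> inv p) ` W \<subseteq> W"
    using assms permutes_inv[OF assms(2)] by (auto simp: closed_words_def)
qed

lemma symop_add: "symop n X \<Longrightarrow> symop n Y \<Longrightarrow> symop n (X + Y)"
  by (simp add: symop_def distrib_left distrib_right sum.distrib)

lemma symop_scale: "symop n X \<Longrightarrow> symop n (c *\<^sub>R X)"
  by (simp add: symop_def mult.assoc mult.left_commute[of _ c] sum_distrib_left[symmetric])

lemma symop_0 [simp]: "symop n 0" and symop_1 [simp]: "symop n 1"
  by (simp_all add: symop_def)

lemma symop_sum: "(\<And>i. i \<in> I \<Longrightarrow> symop n (X i)) \<Longrightarrow> symop n (\<Sum>i\<in>I. X i)"
  by (induction I rule: infinite_finite_induct) (auto simp: symop_add)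

lemma symop_mult: "symop n X \<Longrightarrow> symop n Y \<Longrightarrow> X * Y = Y * X \<Longrightarrow> symop n (X * Y)"
proof -
  assume X: "symop n X" and Y: "symop n Y" and XY: "X * Y = Y * X"
  have "(\<Sum>w\<in>W. app (X * Y) u w * v w) = (\<Sum>w\<in>W. u w * app (Y * X) v w)" if W: "closed_words n W" for W u v
    using symopD[OF X W, of "app Y u" v] symopD[OF Y W, of u "app X v"] by simp
  then show ?thesis unfolding symop_def XY by blast
qed

lemma symop_peval: "symop n X \<Longrightarrow> symop n (peval p X)"
proof (induction p)
  case (pCons a p)
  have "symop n (X * peval p X)"
    using pCons by (intro symop_mult) (simp_all add: peval_commute)
  then show ?case
    unfolding peval_pCons of_real_def by (intro symop_add symop_scale symop_1)
qed auto

lemma symop_transpose: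
  assumes "i < n" "j < n"
  shows "symop n (perm_op (transpose i j))"
  unfolding symop_def
proof (intro allI impI)
  fix W and u v :: "word \<Rightarrow> real" assume "closed_words n W"
  then have b: "bij_betw (\<lambda>w. w \<circ> transpose i j) W W"
    using assms by (intro closed_words_bij permutes_swap_id) auto
  have "(\<Sum>w\<in>W. u (w \<circ> transpose i j) * v w)
      = (\<Sum>w\<in>W. u (w \<circ> transpose i j \<circ> transpose i j) * v (w \<circ> transpose i j))"
    by (rule sum.reindex_bij_betw[OF b, symmetric])
  then show "(\<Sum>w\<in>W. app (perm_op (transpose i j)) u w * v w)
      = (\<Sum>w\<in>W. u w * app (perm_op (transpose i j)) v w)"
    by (simp add: comp_assoc)
qed

lemma symop_jm: "n < m \<Longrightarrow> symop m (jm n)"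
  unfolding jm_def by (intro symop_sum symop_transpose) auto

text \<open>Over the orbit of w, <Xu, Xu> = <u, XXu> = 0. This takes the place of diagonalising
  symmetric operators.\<close>

lemma symop_square_zero:
  assumes "symop n X" "X * X = 0"
  shows "X = 0"
proof (rule lop_eqI)
  fix u :: "word \<Rightarrow> real" and w :: word
  define W where "W = (\<lambda>p. w \<circ> p) ` {p. p permutes {..<n}}"
  have W: "closed_words n W" unfolding W_def by (rule closed_words_orbit)
  have "(\<Sum>w\<in>W. app X u w * app X u w) = (\<Sum>w\<in>W. u w * app (X * X) u w)"
    using symopD[OF assms(1) W, of u "app X u"] by simp
  then have "(\<Sum>w\<in>W. app X u w * app X u w) = 0" by (simp add: assms(2))
  moreover have "finite W" using W by (simp add: closed_words_def)
  moreover have "w \<in> W"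
    unfolding W_def using permutes_id by (auto simp: image_iff intro!: exI[of _ id])
  ultimately show "app X u w = app 0 u w"
    by (simp add: sum_nonneg_eq_0_iff)
qed

subsection \<open>The spectrum of the Jucys-Murphy elements is real and finite\<close>

text \<open>With \<open>x = jm n\<close>, \<open>y = jm (n + 1)\<close> and \<open>s = (n n+1)\<close> the intertwiner \<open>z = s (x - y) + 1\<close>
  satisfies \<open>z x = y z\<close> and \<open>z\<^sup>2 = 1 - (x - y)\<^sup>2\<close>, so if \<open>p\<close> annihilates \<open>x\<close> then
  \<open>p(y) (1 - (x - y)\<^sup>2) = 0\<close>.\<close>

lemma jm_annihilated: "\<exists>S. finite S \<and> peval (root_poly S) (jm n) = 0"
proof (induction n)
  case 0
  have "peval (root_poly {0}) (jm 0) = 0" by (simp add: root_poly_def jm_def)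
  then show ?case by blast
next
  case (Suc n)
  then obtain S where S: "finite S" "peval (root_poly S) (jm n) = 0" by blast
  define x y s where "x = jm n" and "y = jm (Suc n)" and "s = perm_op (transpose n (Suc n))"
  have xy: "x * y = y * x" unfolding x_def y_def by (rule jm_commute)
  have ss: "s * s = 1" by (simp add: s_def perm_op_mult)
  have y: "y = s * x * s + s" unfolding x_def y_def s_def by (rule jm_Suc)
  have sx: "s * x = y * s - 1"
  proof -
    have "y * s = s * x * (s * s) + s * s" unfolding y by (simp only: distrib_right mult.assoc)
    then show ?thesis by (simp add: ss)
  qed
  have sy: "s * y = x * s + 1"
  proof -
    have "s * y = (s * s) * x * s + s * s" unfolding y by (simp only: distrib_left mult.assoc)
    then show ?thesis by (simp add: ss)
  qed
  define z where "z = s * (x - y) + 1"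
  have z2: "z = (y - x) * s - 1"
    unfolding z_def by (simp only: right_diff_distrib left_diff_distrib sx sy) simp
  have zx: "z * x = y * z"
  proof -
    have "z * x = s * x * (x - y) + x"
      unfolding z_def by (simp only: distrib_right mult.assoc left_diff_distrib right_diff_distrib xy) simp
    also have "\<dots> = y * (s * (x - y)) - (x - y) + x" by (simp only: sx left_diff_distrib mult.assoc) simp
    also have "\<dots> = y * z" by (simp only: z_def distrib_left) simp
    finally show ?thesis .
  qed
  have zz: "z * z = 1 - (x - y) * (x - y)"
  proof -
    have 1: "s * (x - y) = (y - x) * s - 2"
      using z_def z2 by (metis add_diff_cancel_right' diff_diff_eq one_add_one)
    have "z * z = ((y - x) * s - 1) * (s * (x - y) + 1)" using z_def z2 by simp
    also have "\<dots> = (y - x) * (s * s) * (x - y) + (y - x) * s - s * (x - y) - 1"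
      by (simp only: distrib_left distrib_right left_diff_distrib right_diff_distrib mult.assoc) simp
    also have "\<dots> = (y - x) * (x - y) + 1"
      unfolding 1 by (simp add: ss)
    also have "\<dots> = 1 - (x - y) * (x - y)"
      by (metis minus_diff_eq minus_mult_left add.commute uminus_add_conv_diff)
    finally show ?thesis .
  qed
  have py: "peval (root_poly S) y * (1 - (x - y) * (x - y)) = 0"
  proof -
    have "peval (root_poly S) y * (z * z) = z * peval (root_poly S) x * z"
      using peval_intertwine[OF zx] by (simp add: mult.assoc[symmetric])
    then show ?thesis using S zz by (simp add: x_def)
  qed
  \<comment> \<open>On the part where x has eigenvalue c, the relation \<open>py\<close> reads p(y)
    (1 - (y - c)^2) = 0, so y can only have a root of p or one of c + 1, c - 1 as
    eigenvalue.\<close>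
  define S' where "S' = S \<union> (\<lambda>c. c + 1) ` S \<union> (\<lambda>c. c - 1) ` S"
  define q where "q = root_poly S'"
  have S': "finite S'" using S by (simp add: S'_def)
  have "peval q y * peval q y * idem S x c = 0" if c: "c \<in> S" for c
  proof -
    let ?e = "idem S x c"
    have xe: "x * ?e = c *\<^sub>R ?e" using idem_eigen[OF S(1) c] S(2) by (simp add: x_def)
    have ye: "y * ?e = ?e * y" using idem_commute[of x y S c] xy by simp
    define \<delta> where "\<delta> = y - of_real c"
    have d: "(x - y) * ?e = - (\<delta> * ?e)"
      using xe by (simp add: \<delta>_def algebra_simps of_real_def)
    have dx: "(x - y) * \<delta> = \<delta> * (x - y)"
      unfolding \<delta>_def using xy by (simp add: algebra_simps of_real_def)
    have "(x - y) * (x - y) * ?e = \<delta> * \<delta> * ?e"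
      using d dx by (metis (no_types, lifting) minus_minus mult.assoc mult_minus_right)
    moreover define r where "r = [:- (c + 1), 1:] * [:- (c - 1), 1:]"
    have "peval r y = (\<delta> - 1) * (\<delta> + 1)"
      unfolding r_def by (simp only: peval_mult) (simp add: \<delta>_def algebra_simps of_real_def)
    ultimately have "(1 - (x - y) * (x - y)) * ?e = - (peval r y * ?e)"
      by (simp add: left_diff_distrib distrib_left right_diff_distrib)
    then have "peval (root_poly S) y * (peval r y * ?e) = 0"
      using py by (metis (no_types, lifting) mult.assoc mult_minus_right mult_zero_left neg_equal_0_iff_equal)
    then have *: "peval (root_poly S * r) y * ?e = 0" by (simp add: peval_mult mult.assoc)
    have "r = root_poly {c + 1, c - 1}" by (simp add: root_poly_def r_def)
    then have "r dvd q" unfolding q_def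
      using c root_poly_subset[OF S', of "{c + 1, c - 1}"] by (simp add: S'_def)
    moreover have "root_poly S dvd q"
      unfolding q_def by (rule root_poly_subset[OF S']) (unfold S'_def, blast)
    \<comment> \<open>The two factors may share roots, so their product divides only the square of
      q; symmetry of y removes the square at the end.\<close>
    ultimately have "root_poly S * r dvd q * q" by (rule mult_dvd_mono[rotated])
    then obtain k where k: "q * q = k * (root_poly S * r)" by (metis dvd_def mult.commute)
    have "peval (q * q) y * ?e = peval k y * (peval (root_poly S * r) y * ?e)"
      unfolding k by (simp add: peval_mult mult.assoc)
    then show ?thesis using * by (simp add: peval_mult)
  qed
  then have "(\<Sum>c\<in>S. peval q y * peval q y * idem S x c) = 0" by simp
  then have "peval q y * peval q y = 0"
    using idem_sum[OF S(1), of x] S(2) by (simp add: sum_distrib_left[symmetric] x_def)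
  moreover have "symop (Suc (Suc n)) (peval q y)"
    unfolding y_def by (intro symop_peval symop_jm) simp
  ultimately have "peval q y = 0" by (rule symop_square_zero[rotated])
  then show ?case using S' unfolding q_def y_def by blast
qed

lemma jm_annihilated_common: "\<exists>S. finite S \<and> (\<forall>j<n. peval (root_poly S) (jm j) = 0)"
proof -
  obtain S where S: "\<And>j. finite (S j)" "\<And>j. peval (root_poly (S j)) (jm j) = 0"
    using jm_annihilated by metis
  have "peval (root_poly (\<Union>j<n. S j)) (jm j) = 0" if "j < n" for j
    using that S by (intro peval_dvd_zero[OF root_poly_subset S(2)]) auto
  then show ?thesis using S(1) by (intro exI[of _ "\<Union>j<n. S j"]) auto
qed

section \<open>Joint spectral calculus\<close>

definition ind :: "'a \<Rightarrow> 'a \<Rightarrow> real" where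
  "ind u w = (if w = u then 1 else 0)"

text \<open>A diagonal entry of a projection is the squared norm of its column. Hence it is
  nonnegative, and if it vanishes then so does the column on the orbit.\<close>

lemma symop_idem_diag:
  assumes "symop n X" "X * X = X" "closed_words n W" "w \<in> W"
  shows "app X (ind w) w = (\<Sum>u\<in>W. (app X (ind w) u)\<^sup>2)"
proof -
  have "(\<Sum>u\<in>W. app X (ind w) u * app X (ind w) u) = (\<Sum>u\<in>W. ind w u * app (X * X) (ind w) u)"
    using symopD[OF assms(1,3), of "ind w" "app X (ind w)"] by simp
  also have "\<dots> = (\<Sum>u\<in>W. if u = w then app X (ind w) u else 0)"
    by (rule sum.cong) (simp_all add: ind_def assms(2))
  also have "\<dots> = app X (ind w) w"
    using assms(3,4) by (simp add: closed_words_def)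
  finally show ?thesis by (simp add: power2_eq_square)
qed

lemma orbit_self: "w \<in> (\<lambda>p. w \<circ> p) ` {p. p permutes {..<n::nat}}"
  using permutes_id by (auto simp: image_iff intro!: exI[of _ id])

lemma symop_idem_nonneg:
  assumes "symop n X" "X * X = X"
  shows "0 \<le> app X (ind w) w"
  by (subst symop_idem_diag[OF assms closed_words_orbit orbit_self]) (simp add: sum_nonneg)

lemma symop_idem_zero:
  assumes "symop n X" "X * X = X" "app X (ind w) w = 0" "closed_words n W" "w \<in> W" "u \<in> W"
  shows "app X (ind w) u = 0"
proof -
  have "finite W" using assms by (simp add: closed_words_def)
  then show ?thesis
    using symop_idem_diag[OF assms(1,2,4,5)] assms(3,6) by (simp add: sum_nonneg_eq_0_iff)
qed

text \<open>S is any common finite set of roots, as supplied by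
  \<open>jm_annihilated_common\<close>. It may exceed the true spectra; surplus values merely give
  zero projections.\<close>

locale jm_spectrum =
  fixes n :: nat and S :: "real set"
  assumes finite_S: "finite S" and annih: "\<And>j. j < n \<Longrightarrow> peval (root_poly S) (jm j) = 0"
begin

abbreviation \<Gamma> :: "nat \<Rightarrow> (nat \<Rightarrow> real) set" where
  "\<Gamma> j \<equiv> PiE {..<j} (\<lambda>_. S)"

text \<open>Joint spectral projection for the candidate eigenvalue sequence g. The nonzero ones
  belong to content sequences of standard tableaux, but which g these are is never
  determined.\<close>

fun E :: "nat \<Rightarrow> (nat \<Rightarrow> real) \<Rightarrow> word lop" where
  "E 0 g = 1"
| "E (Suc j) g = E j g * idem S (jm j) (g j)"

lemma finite_\<Gamma>: "finite (\<Gamma> j)"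
  by (intro finite_PiE finite_S) auto

lemma E_cong: "(\<And>i. i < j \<Longrightarrow> g i = h i) \<Longrightarrow> E j g = E j h"
  by (induction j) auto

lemma idem_in: "i < j \<Longrightarrow> idem S (jm i) c \<in> perm_alg j"
  unfolding idem_def by (intro peval_in jm_in)

lemma E_in: "E j g \<in> perm_alg j"
proof (induction j)
  case (Suc j)
  then show ?case
    using perm_alg_mono[of j "Suc j"] by (auto intro!: mult_in idem_in)
qed (auto intro: one_in)

lemma commute_E: "(\<And>i. i < j \<Longrightarrow> jm i * X = X * jm i) \<Longrightarrow> E j g * X = X * E j g"
proof (induction j)
  case (Suc j)
  have "E j g * (idem S (jm j) (g j) * X) = X * (E j g * idem S (jm j) (g j))"
  proof -
    have 1: "idem S (jm j) (g j) * X = X * idem S (jm j) (g j)"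
      using Suc.prems by (intro idem_commute) simp
    have 2: "E j g * X = X * E j g" using Suc by simp
    show ?thesis unfolding 1 using 2 by (simp only: mult.assoc[symmetric])
  qed
  then show ?case by (simp add: mult.assoc)
qed auto

lemma jm_E:
  assumes "g \<in> \<Gamma> j" "i < j" "j \<le> n"
  shows "jm i * E j g = g i *\<^sub>R E j g"
proof -
  have "j' \<le> j \<Longrightarrow> i < j' \<Longrightarrow> jm i * E j' g = g i *\<^sub>R E j' g" for j'
  proof (induction j')
    case (Suc j')
    show ?case
    proof (cases "i = j'")
      case True
      have "j' < j" using Suc.prems by simp
      then have "g j' \<in> S" "j' < n" using assms(1,3) by auto
      then have "jm j' * idem S (jm j') (g j') = g j' *\<^sub>R idem S (jm j') (g j')"
        by (intro idem_eigen finite_S annih)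
      moreover have "jm j' * E (Suc j') g = E j' g * (jm j' * idem S (jm j') (g j'))"
        unfolding E.simps mult.assoc[symmetric] commute_E[of j' "jm j'" g, OF jm_commute] ..
      ultimately show ?thesis unfolding True by simp
    next
      case False
      then show ?thesis using Suc by (simp add: mult.assoc[symmetric])
    qed
  qed simp
  then show ?thesis using assms by blast
qed

lemma sum_E: "j \<le> n \<Longrightarrow> (\<Sum>g\<in>\<Gamma> j. E j g) = 1"
proof (induction j)
  case (Suc j)
  have "(\<Sum>g\<in>\<Gamma> (Suc j). E (Suc j) g) = (\<Sum>(c, g)\<in>S \<times> \<Gamma> j. E j g * idem S (jm j) c)"
  proof (rule sum.reindex_bij_witness[of _ "\<lambda>(c, g). g(j := c)" "\<lambda>g. (g j, g(j := undefined))"], goal_cases)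
    case (1 g) then show ?case by auto
  next
    case (2 g) then show ?case by (auto simp: PiE_def extensional_def Pi_def)
  next
    case (3 b) then show ?case by (auto simp: PiE_def extensional_def fun_eq_iff)
  next
    case (4 b) then show ?case by (auto simp: PiE_def extensional_def Pi_def less_Suc_eq split: if_splits)
  next
    case (5 g)
    have "E j (g(j := undefined)) = E j g" by (rule E_cong) simp
    then show ?case by simp
  qed
  also have "\<dots> = (\<Sum>g\<in>\<Gamma> j. E j g) * (\<Sum>c\<in>S. idem S (jm j) c)"
    unfolding sum_product sum.cartesian_product[symmetric] by (rule sum.swap)
  also have "\<dots> = 1" using Suc idem_sum[OF finite_S annih] by simp
  finally show ?case .
qed simp

lemma E_orth:
  assumes "g \<in> \<Gamma> n" "h \<in> \<Gamma> n" "g \<noteq> h"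
  shows "E n g * E n h = 0"
proof -
  obtain i where i: "g i \<noteq> h i" using assms(3) by blast
  then have "i < n" using assms by (metis PiE_arb lessThan_iff)
  then have "g i *\<^sub>R (E n g * E n h) = h i *\<^sub>R (E n g * E n h)"
  proof -
    have "g i *\<^sub>R (E n g * E n h) = jm i * E n g * E n h" using jm_E[OF assms(1)] \<open>i < n\<close> by simp
    also have "\<dots> = E n g * (jm i * E n h)"
      unfolding mult.assoc[symmetric] commute_E[of n "jm i" g, OF jm_commute] ..
    also have "\<dots> = h i *\<^sub>R (E n g * E n h)" using jm_E[OF assms(2)] \<open>i < n\<close> by simp
    finally show ?thesis .
  qed
  then show ?thesis using i by (metis scaleR_right_imp_eq)
qed

lemma E_idem: "g \<in> \<Gamma> n \<Longrightarrow> E n g * E n g = E n g"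
proof -
  assume g: "g \<in> \<Gamma> n"
  have "E n g = E n g * (\<Sum>h\<in>\<Gamma> n. E n h)" by (simp add: sum_E)
  also have "\<dots> = (\<Sum>h\<in>\<Gamma> n. if h = g then E n g * E n g else 0)"
    unfolding sum_distrib_left by (rule sum.cong) (use E_orth g in auto)
  also have "\<dots> = E n g * E n g" using g finite_\<Gamma> by simp
  finally show ?thesis by simp
qed

lemma symop_E: "symop n (E n g)"
proof -
  have "j \<le> n \<Longrightarrow> symop n (E j g)" for j
  proof (induction j)
    case (Suc j)
    have "E j g * idem S (jm j) (g j) = idem S (jm j) (g j) * E j g"
      by (rule commute_E) (metis idem_commute jm_commute)
    then show ?case
      using Suc unfolding E.simps idem_def by (intro symop_mult symop_peval symop_jm) auto
  qed simp
  then show ?thesis by simp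
qed

definition fop :: "((nat \<Rightarrow> real) \<Rightarrow> real) \<Rightarrow> word lop" where
  "fop F = (\<Sum>g\<in>\<Gamma> n. F g *\<^sub>R E n g)"

lemma fop_E: "g \<in> \<Gamma> n \<Longrightarrow> fop F * E n g = F g *\<^sub>R E n g"
proof -
  assume g: "g \<in> \<Gamma> n"
  have "fop F * E n g = (\<Sum>h\<in>\<Gamma> n. if h = g then F g *\<^sub>R E n g else 0)"
    unfolding fop_def sum_distrib_right by (rule sum.cong) (use E_orth E_idem g in auto)
  also have "\<dots> = F g *\<^sub>R E n g" using g finite_\<Gamma> by simp
  finally show ?thesis .
qed

lemma E_fop: "g \<in> \<Gamma> n \<Longrightarrow> E n g * fop F = F g *\<^sub>R E n g"
proof -
  assume g: "g \<in> \<Gamma> n"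
  have "E n g * fop F = (\<Sum>h\<in>\<Gamma> n. if h = g then F g *\<^sub>R E n g else 0)"
    unfolding fop_def sum_distrib_left by (rule sum.cong) (use E_orth E_idem g in auto)
  also have "\<dots> = F g *\<^sub>R E n g" using g finite_\<Gamma> by simp
  finally show ?thesis .
qed

lemma eq_fop:
  assumes "\<And>g. g \<in> \<Gamma> n \<Longrightarrow> X * E n g = F g *\<^sub>R E n g"
  shows "X = fop F"
proof -
  have "X = X * (\<Sum>g\<in>\<Gamma> n. E n g)" by (simp add: sum_E)
  also have "\<dots> = fop F" unfolding sum_distrib_left fop_def using assms by simp
  finally show ?thesis .
qed

lemma fop_mult: "fop F * fop G = fop (\<lambda>g. F g * G g)"
  by (rule eq_fop) (simp add: fop_E mult.assoc)

lemma fop_in: "fop F \<in> perm_alg n"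
  unfolding fop_def by (intro perm_alg_closed E_in)

lemma symop_fop: "symop n (fop F)"
  unfolding fop_def by (intro symop_sum symop_scale symop_E)

text \<open>If X commutes with \<open>fop F\<close>, then E g X E h vanishes unless F g = F h;
  likewise for F'. So X only links joint eigenspaces on which G takes one value. This makes
  functions of central elements central without a description of the centre.\<close>

lemma fop_commute_fun:
  assumes "\<And>g. g \<in> \<Gamma> n \<Longrightarrow> G g = f (F g) (F' g)"
    and "X * fop F = fop F * X" "X * fop F' = fop F' * X"
  shows "X * fop G = fop G * X"
proof -
  have E: "E n g * X * E n h = 0" if gh: "g \<in> \<Gamma> n" "h \<in> \<Gamma> n" "H g \<noteq> H h" and H: "X * fop H = fop H * X" for g h H
  proof -
    have "H g *\<^sub>R (E n g * X * E n h) = E n g * fop H * X * E n h" using gh by (simp add: E_fop)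
    also have "\<dots> = E n g * X * (fop H * E n h)" unfolding mult.assoc H[unfolded mult.assoc, symmetric]
      by (simp only: mult.assoc[symmetric] H)
    also have "\<dots> = H h *\<^sub>R (E n g * X * E n h)" using gh by (simp add: fop_E)
    finally show ?thesis using gh(3) by (metis scaleR_right_imp_eq)
  qed
  have EX: "G h *\<^sub>R (E n g * X * E n h) = G g *\<^sub>R (E n g * X * E n h)" if gh: "g \<in> \<Gamma> n" "h \<in> \<Gamma> n" for g h
  proof (cases "F g = F h \<and> F' g = F' h")
    case True then show ?thesis using assms(1) gh by simp
  next
    case False then show ?thesis using E[OF gh _ assms(2)] E[OF gh _ assms(3)] by auto
  qed
  have "X * fop G = (\<Sum>g\<in>\<Gamma> n. E n g) * X * fop G" by (simp add: sum_E)
  also have "\<dots> = (\<Sum>g\<in>\<Gamma> n. \<Sum>h\<in>\<Gamma> n. G h *\<^sub>R (E n g * X * E n h))"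
    unfolding fop_def sum_product sum_distrib_right by (simp add: mult.assoc sum_distrib_left)
  also have "\<dots> = (\<Sum>g\<in>\<Gamma> n. \<Sum>h\<in>\<Gamma> n. G g *\<^sub>R (E n g * X * E n h))"
    by (intro sum.cong refl EX)
  also have "\<dots> = fop G * X * (\<Sum>g\<in>\<Gamma> n. E n g)"
    unfolding fop_def sum_distrib_left sum_distrib_right by (subst sum.swap) (simp add: mult.assoc)
  finally show ?thesis by (simp add: sum_E)
qed

end

section \<open>Trace states\<close>

text \<open>Letters at positions \<open>\<ge> j\<close> are frozen to pairwise distinct values \<open>d + i\<close>, so that \<open>j = 0\<close> gives
  the canonical trace of the group algebra and \<open>j = n\<close> the normalised trace on \<open>(C\<^sup>s)\<^sup>\<otimes>\<^sup>n\<close>.\<close>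

definition words :: "nat \<Rightarrow> nat \<Rightarrow> nat \<Rightarrow> word set" where
  "words d s j = {w. (\<forall>i<j. w i < s) \<and> (\<forall>i\<ge>j. w i = d + i)}"

definition om :: "nat \<Rightarrow> nat \<Rightarrow> nat \<Rightarrow> word lop \<Rightarrow> real" where
  "om d s j X = (\<Sum>w\<in>words d s j. app X (ind w) w) / real s ^ j"

definition tau :: "nat \<Rightarrow> word lop \<Rightarrow> real" where
  "tau d X = app X (ind (\<lambda>i. d + i)) (\<lambda>i. d + i)"

lemma tau_linear [simp]:
  "tau d (X + Y) = tau d X + tau d Y" "tau d (X - Y) = tau d X - tau d Y"
  "tau d (c *\<^sub>R X) = c * tau d X" "tau d 0 = 0"
  by (simp_all add: tau_def)

lemma tau_sum: "tau d (\<Sum>i\<in>I. X i) = (\<Sum>i\<in>I. tau d (X i))"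
  by (induction I rule: infinite_finite_induct) auto

lemma tau_perm_op: "tau d (perm_op p) = (if p = id then 1 else 0)"
  by (auto simp: tau_def ind_def fun_eq_iff)

lemma om_linear [simp]:
  "om d s j (X + Y) = om d s j X + om d s j Y" "om d s j (c *\<^sub>R X) = c * om d s j X"
  "om d s j 0 = 0"
  by (simp_all add: om_def sum.distrib add_divide_distrib sum_distrib_left)

lemma om_sum: "om d s j (\<Sum>i\<in>I. X i) = (\<Sum>i\<in>I. om d s j (X i))"
  by (induction I rule: infinite_finite_induct) auto

lemma words_0: "words d s 0 = {\<lambda>i. d + i}"
  by (auto simp: words_def)

lemma words_Suc_bij:
  "bij_betw (\<lambda>(w, c). w(j := c)) (words d s j \<times> {..<s}) (words d s (Suc j))"
  by (rule bij_betw_byWitness[where f' = "\<lambda>w. (w(j := d + j), w j)"])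
     (auto simp: words_def fun_eq_iff less_Suc_eq)

lemma finite_words: "finite (words d s j)" and card_words: "card (words d s j) = s ^ j"
proof (induction j)
  case (Suc j)
  show "finite (words d s (Suc j))"
    using bij_betw_finite[OF words_Suc_bij[of j d s]] Suc by simp
  show "card (words d s (Suc j)) = s ^ Suc j"
    using bij_betw_same_card[OF words_Suc_bij[of j d s], symmetric] Suc by (simp add: card_cartesian_product mult.commute)
qed (simp_all add: words_0)

lemma words_mono: "k \<le> s \<Longrightarrow> words d k j \<subseteq> words d s j"
  by (auto simp: words_def)

lemma words_comp:
  assumes "w \<in> words d s n" "p permutes {..<n}"
  shows "w \<circ> p \<in> words d s n"
  using assms permutes_in_image[OF assms(2)] permutes_not_in[OF assms(2)] by (auto simp: words_def)

lemma closed_words_words: "closed_words n (words d s n)"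
  by (simp add: closed_words_def finite_words words_comp)

text \<open>For p permuting the positions below j this is s to the number of cycles of p, the
  character of the j-fold tensor power of C^s. Cycles are never formalised; the recursions below
  stand in for them.\<close>

definition fixc :: "nat \<Rightarrow> nat \<Rightarrow> nat \<Rightarrow> (nat \<Rightarrow> nat) \<Rightarrow> nat" where
  "fixc d s j p = card {w \<in> words d s j. w \<circ> p = w}"

lemma fun_upd_comp_perm:
  assumes "q permutes {..<j::nat}"
  shows "w(j := c) \<circ> q = (w \<circ> q)(j := c)"
proof
  fix i show "(w(j := c) \<circ> q) i = ((w \<circ> q)(j := c)) i"
    using permutes_not_in[OF assms, of j] permutes_inj[OF assms] by (auto simp: inj_def)
qed

lemma fixc_Suc:
  assumes q: "q permutes {..<j}"
  shows "fixc d s (Suc j) q = s * fixc d s j q"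
proof -
  have "bij_betw (\<lambda>(w, c). w(j := c)) ({w \<in> words d s j. w \<circ> q = w} \<times> {..<s})
      {w \<in> words d s (Suc j). w \<circ> q = w}"
  proof (rule bij_betw_byWitness[where f' = "\<lambda>w. (w(j := d + j), w j)"])
    have *: "w \<circ> q = w \<Longrightarrow> w(j := c) \<circ> q = w(j := c)" for w c
      by (simp add: fun_upd_comp_perm[OF q])
    then show "(\<lambda>(w, c). w(j := c)) ` ({w \<in> words d s j. w \<circ> q = w} \<times> {..<s})
        \<subseteq> {w \<in> words d s (Suc j). w \<circ> q = w}"
      using words_Suc_bij[of j d s] by (auto simp: words_def less_Suc_eq)
    show "(\<lambda>w. (w(j := d + j), w j)) ` {w \<in> words d s (Suc j). w \<circ> q = w}
        \<subseteq> {w \<in> words d s j. w \<circ> q = w} \<times> {..<s}"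
      using * by (auto simp: words_def less_Suc_eq)
  qed (auto simp: words_def fun_eq_iff)
  from bij_betw_same_card[OF this] show ?thesis
    by (simp add: fixc_def card_cartesian_product mult.commute)
qed

text \<open>Since q fixes j, the transposition inserts j into the cycle of b: the letter at j is
  forced and the count is unchanged. In \<open>fixc_Suc\<close>, by contrast, j is a cycle of its
  own and its letter is free.\<close>

lemma fixc_Suc_transpose:
  assumes q: "q permutes {..<j}" and b: "b < j"
  shows "fixc d s (Suc j) (transpose j b \<circ> q) = fixc d s j q"
proof -
  have fix_iff: "w \<circ> (transpose j b \<circ> q) = w \<longleftrightarrow> w b = w j \<and> w \<circ> q = w" for w :: word
  proof
    assume w: "w \<circ> (transpose j b \<circ> q) = w"
    have "q j = j" using permutes_not_in[OF q, of j] by simp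
    then have bj: "w b = w j" using fun_cong[OF w, of j] by simp
    then have "w \<circ> transpose j b = w" by (auto simp: fun_eq_iff transpose_def)
    then show "w b = w j \<and> w \<circ> q = w" using w bj by (metis comp_assoc)
  next
    assume w: "w b = w j \<and> w \<circ> q = w"
    then have "w \<circ> transpose j b = w" by (auto simp: fun_eq_iff transpose_def)
    then show "w \<circ> (transpose j b \<circ> q) = w" using w by (metis comp_assoc)
  qed
  have upd: "w \<circ> q = w \<Longrightarrow> w(j := c) \<circ> q = w(j := c)" for w c
    by (simp add: fun_upd_comp_perm[OF q])
  have "bij_betw (\<lambda>w. w(j := w b)) {w \<in> words d s j. w \<circ> q = w}
      {w \<in> words d s (Suc j). w \<circ> (transpose j b \<circ> q) = w}"
  proof (rule bij_betw_byWitness[where f' = "\<lambda>w. w(j := d + j)"])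
    show "(\<lambda>w. w(j := w b)) ` {w \<in> words d s j. w \<circ> q = w}
      \<subseteq> {w \<in> words d s (Suc j). w \<circ> (transpose j b \<circ> q) = w}"
      unfolding fix_iff using b upd by (auto simp: words_def less_Suc_eq)
    show "(\<lambda>w. w(j := d + j)) ` {w \<in> words d s (Suc j). w \<circ> (transpose j b \<circ> q) = w}
      \<subseteq> {w \<in> words d s j. w \<circ> q = w}"
      unfolding fix_iff using b upd by (auto simp: words_def less_Suc_eq)
  qed (use b in \<open>auto simp: fix_iff words_def fun_upd_idem\<close>)
  from bij_betw_same_card[OF this] show ?thesis by (simp add: fixc_def)
qed

lemma fixc_inv: "p permutes {..<n} \<Longrightarrow> fixc d s j (inv p) = fixc d s j p"
proof -
  assume p: "p permutes {..<n}"
  have "w \<circ> inv p = w \<longleftrightarrow> w \<circ> p = w" for w :: word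
    using permutes_inv_o[OF p] by (metis comp_assoc comp_id)
  then show ?thesis by (simp add: fixc_def)
qed

lemma fixc_conj:
  assumes r: "r permutes {..<n}"
  shows "fixc d s n (r \<circ> p \<circ> inv r) = fixc d s n p"
proof -
  have i: "r \<circ> inv r = id" "inv r \<circ> r = id" using permutes_inv_o[OF r] by auto
  have "bij_betw (\<lambda>w. w \<circ> r) {w \<in> words d s n. w \<circ> (r \<circ> p \<circ> inv r) = w} {w \<in> words d s n. w \<circ> p = w}"
  proof (rule bij_betw_byWitness[where f' = "\<lambda>w. w \<circ> inv r"])
    show "(\<lambda>w. w \<circ> r) ` {w \<in> words d s n. w \<circ> (r \<circ> p \<circ> inv r) = w} \<subseteq> {w \<in> words d s n. w \<circ> p = w}"
    proof safe
      fix w assume w: "w \<in> words d s n" "w \<circ> (r \<circ> p \<circ> inv r) = w"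
      show "w \<circ> r \<in> words d s n" by (rule words_comp[OF w(1) r])
      have "w \<circ> r \<circ> p = w \<circ> (r \<circ> p \<circ> inv r) \<circ> r" by (simp add: comp_assoc i)
      then show "w \<circ> r \<circ> p = w \<circ> r" by (simp only: w(2))
    qed
    show "(\<lambda>w. w \<circ> inv r) ` {w \<in> words d s n. w \<circ> p = w} \<subseteq> {w \<in> words d s n. w \<circ> (r \<circ> p \<circ> inv r) = w}"
    proof safe
      fix w assume w: "w \<in> words d s n" "w \<circ> p = w"
      show "w \<circ> inv r \<in> words d s n" by (rule words_comp[OF w(1) permutes_inv[OF r]])
      show "w \<circ> inv r \<circ> (r \<circ> p \<circ> inv r) = w \<circ> inv r"
        using w(2) by (simp only: comp_assoc[symmetric]) (simp only: comp_assoc i comp_id)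
    qed
  qed (simp_all add: comp_assoc i)
  from bij_betw_same_card[OF this] show ?thesis by (simp add: fixc_def)
qed

lemma om_perm_op:
  assumes p: "p permutes {..<n}" and sd: "s \<le> d"
  shows "om d s j (perm_op p) = (if p permutes {..<j} then fixc d s j p / real s ^ j else 0)"
proof -
  have *: "om d s j (perm_op p) = fixc d s j p / real s ^ j"
    by (simp add: om_def fixc_def ind_def sum.inter_filter[symmetric] finite_words)
  have "fixc d s j p = 0" if "\<not> p permutes {..<j}"
  proof -
    have "\<not> (\<forall>i\<ge>j. p i = i)"
      using permutes_superset[OF p, of "{..<j}"] that by auto
    then obtain i where i: "i \<ge> j" "p i \<noteq> i" by blast
    have "w \<circ> p \<noteq> w" if w: "w \<in> words d s j" for w
    proof
      assume "w \<circ> p = w"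
      then have "w (p i) = d + i" using i w by (metis (mono_tags, lifting) comp_apply mem_Collect_eq words_def)
      then show False using i w sd by (cases "p i < j") (auto simp: words_def not_less)
    qed
    then have "{w \<in> words d s j. w \<circ> p = w} = {}" by blast
    then show ?thesis by (simp only: fixc_def card.empty)
  qed
  then show ?thesis using * by auto
qed

section \<open>The density of the word traces with respect to the canonical trace\<close>

primrec hprod :: "nat \<Rightarrow> nat \<Rightarrow> word lop" where
  "hprod s 0 = 1"
| "hprod s (Suc j) = (1 + (1 / real s) *\<^sub>R jm j) * hprod s j"

lemma hprod_in: "j \<le> n \<Longrightarrow> hprod s j \<in> perm_alg n"
  by (induction j) (auto intro!: mult_in one_in perm_alg_closed jm_in)

text \<open>Jucys' formula: the product of the factors s + \<open>jm i\<close> is the sum of all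
  permutations weighted by s to the number of cycles. It follows from the unique factorisation of a
  permutation of the positions up to j as (j b) q with q fixing j.\<close>

lemma hprod_eq:
  assumes "0 < s"
  shows "real s ^ j *\<^sub>R hprod s j = (\<Sum>p | p permutes {..<j}. real (fixc d s j p) *\<^sub>R perm_op p)"
proof (induction j)
  case 0
  have "{w \<in> words d s 0. w \<circ> id = w} = words d s 0" by auto
  then have "fixc d s 0 id = 1" by (simp only: fixc_def card_words) simp
  then show ?case by (simp add: id_def[symmetric])
next
  case (Suc j)
  let ?P = "{p. p permutes {..<j}}"
  have "(\<Sum>p | p permutes {..<Suc j}. real (fixc d s (Suc j) p) *\<^sub>R perm_op p)
      = (\<Sum>b\<in>insert j {..<j}. \<Sum>q\<in>?P. real (fixc d s (Suc j) (transpose j b \<circ> q)) *\<^sub>R perm_op (transpose j b \<circ> q))"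
    unfolding lessThan_Suc by (rule sum_over_permutations_insert) auto
  also have "\<dots> = (\<Sum>q\<in>?P. real (s * fixc d s j q) *\<^sub>R perm_op q)
      + (\<Sum>b<j. \<Sum>q\<in>?P. real (fixc d s j q) *\<^sub>R (perm_op (transpose j b) * perm_op q))"
    by (simp add: fixc_Suc fixc_Suc_transpose perm_op_mult)
  also have "\<dots> = (real s *\<^sub>R 1 + (\<Sum>b<j. perm_op (transpose j b))) * (\<Sum>q\<in>?P. real (fixc d s j q) *\<^sub>R perm_op q)"
    by (simp add: distrib_right sum_product scaleR_sum_right)
  also have "(\<Sum>b<j. perm_op (transpose j b)) = jm j"
    unfolding jm_def by (simp add: transpose_commute)
  also have "(real s *\<^sub>R 1 + jm j) * (\<Sum>q\<in>?P. real (fixc d s j q) *\<^sub>R perm_op q)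
      = real s ^ Suc j *\<^sub>R hprod s (Suc j)"
    unfolding Suc[symmetric] using assms by (simp add: algebra_simps)
  finally show ?case ..
qed

lemma hprod_central:
  assumes "0 < s" and r: "r permutes {..<n}"
  shows "perm_op r * hprod s n = hprod s n * perm_op r"
proof -
  let ?P = "{p. p permutes {..<n}}"
  have i: "r \<circ> inv r = id" "inv r \<circ> r = id" using permutes_inv_o[OF r] by auto
  have "real s ^ n *\<^sub>R (perm_op r * hprod s n) = (\<Sum>p\<in>?P. real (fixc 0 s n p) *\<^sub>R perm_op (r \<circ> p))"
    unfolding mult_scaleR_right[symmetric] hprod_eq[OF assms(1), of n 0]
    by (simp add: sum_distrib_left perm_op_mult)
  also have "\<dots> = (\<Sum>p\<in>?P. real (fixc 0 s n p) *\<^sub>R perm_op (p \<circ> r))"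
  proof (rule sum.reindex_bij_witness[of _ "\<lambda>p. inv r \<circ> p \<circ> r" "\<lambda>p. r \<circ> p \<circ> inv r"])
    fix p assume p: "p \<in> ?P"
    show "inv r \<circ> (r \<circ> p \<circ> inv r) \<circ> r = p" "r \<circ> (inv r \<circ> p \<circ> r) \<circ> inv r = p"
      by (simp_all add: comp_assoc i) (simp_all add: comp_assoc[symmetric] i)
    show "r \<circ> p \<circ> inv r \<in> ?P" "inv r \<circ> p \<circ> r \<in> ?P"
      using p r permutes_inv[OF r] by (auto intro!: permutes_compose)
    have "r \<circ> p \<circ> inv r \<circ> r = r \<circ> p" by (simp add: comp_assoc i)
    then show "real (fixc 0 s n (r \<circ> p \<circ> inv r)) *\<^sub>R perm_op (r \<circ> p \<circ> inv r \<circ> r)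
        = real (fixc 0 s n p) *\<^sub>R perm_op (r \<circ> p)"
      by (simp add: fixc_conj[OF r])
  qed
  also have "\<dots> = real s ^ n *\<^sub>R (hprod s n * perm_op r)"
    unfolding mult_scaleR_left[symmetric] hprod_eq[OF assms(1), of n 0]
    by (simp add: sum_distrib_right perm_op_mult)
  finally show ?thesis using assms(1) by simp
qed

text \<open>The canonical trace picks from \<open>hprod s j\<close> the coefficient at the inverse
  of r, and a permutation and its inverse fix the same words.\<close>

lemma om_eq_tau:
  assumes "0 < s" "s \<le> d" "j \<le> n" "X \<in> perm_alg n"
  shows "om d s j X = tau d (hprod s j * X)"
  using assms(4)
proof (induction X rule: perm_alg_induct)
  case subspace
  then show ?case by (auto simp: subspace_def algebra_simps)
next
  case (perm r)
  have "real s ^ j * tau d (hprod s j * perm_op r)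
      = (\<Sum>p | p permutes {..<j}. if p \<circ> r = id then real (fixc d s j p) else 0)"
    unfolding tau_linear(3)[symmetric] mult_scaleR_left[symmetric] hprod_eq[OF assms(1), of j d]
    by (simp add: sum_distrib_right perm_op_mult tau_sum tau_perm_op if_distrib cong: if_cong)
  also have "\<dots> = (\<Sum>p | p permutes {..<j}. if p = inv r then real (fixc d s j p) else 0)"
    using permutes_inv_o[OF perm] by (intro sum.cong refl if_cong) (metis comp_assoc comp_id id_comp)
  also have "\<dots> = (if inv r permutes {..<j} then real (fixc d s j r) else 0)"
    by (simp add: finite_permutations fixc_inv[OF perm])
  also have "inv r permutes {..<j} \<longleftrightarrow> r permutes {..<j}"
    using permutes_inv permutes_inv_inv[OF perm] by metis
  finally show ?case
    using assms(1) by (auto simp: om_perm_op[OF perm assms(2)] field_simps)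
qed

definition hval :: "nat \<Rightarrow> nat \<Rightarrow> (nat \<Rightarrow> real) \<Rightarrow> real" where
  "hval s j g = (\<Prod>i<j. 1 + g i / real s)"

section \<open>Plancherel and Schur-Weyl measures on the joint spectrum\<close>

context jm_spectrum
begin

definition mu :: "nat \<Rightarrow> (nat \<Rightarrow> real) \<Rightarrow> real" where
  "mu d g = tau d (E n g)"

lemma mu_nonneg: "g \<in> \<Gamma> n \<Longrightarrow> 0 \<le> mu d g"
  unfolding mu_def tau_def by (rule symop_idem_nonneg[OF symop_E E_idem])

lemma tau_eq_sum:
  assumes "\<And>g. g \<in> \<Gamma> n \<Longrightarrow> X * E n g = F g *\<^sub>R E n g"
  shows "tau d X = (\<Sum>g\<in>\<Gamma> n. F g * mu d g)"
  by (subst eq_fop[OF assms]) (simp_all add: fop_def tau_sum mu_def)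

lemma sum_mu: "(\<Sum>g\<in>\<Gamma> n. mu d g) = 1"
  using tau_eq_sum[of 1 "\<lambda>_. 1" d] tau_perm_op[of d id] by simp

lemma hprod_E:
  assumes "g \<in> \<Gamma> n" "j \<le> n"
  shows "hprod s j * E n g = hval s j g *\<^sub>R E n g"
  using assms(2)
proof (induction j)
  case (Suc j)
  then have "hprod s (Suc j) * E n g = (1 + (1 / real s) *\<^sub>R jm j) * (hval s j g *\<^sub>R E n g)"
    by (simp add: mult.assoc)
  also have "\<dots> = hval s (Suc j) g *\<^sub>R E n g"
    using jm_E[OF assms(1), of j] Suc.prems by (simp add: hval_def algebra_simps)
  finally show ?case .
qed (simp add: hval_def)

lemma hprod_fop: "hprod s n = fop (hval s n)"
  by (rule eq_fop) (simp add: hprod_E)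

lemma om_E:
  assumes "0 < s" "s \<le> d" "j \<le> n" "g \<in> \<Gamma> n"
  shows "om d s j (E n g) = hval s j g * mu d g"
  using om_eq_tau[OF assms(1-3) E_in] hprod_E[OF assms(4,3)] by (simp add: mu_def)

text \<open>Single factors 1 + g i / s can be negative. The sign comes from \<open>om_E\<close>: the
  quantity is a normalised sum of diagonal entries of a projection.\<close>

lemma hval_mu_nonneg:
  assumes "0 < s" "s \<le> d" "j \<le> n" "g \<in> \<Gamma> n"
  shows "0 \<le> hval s j g * mu d g"
  using symop_idem_nonneg[OF symop_E E_idem[OF assms(4)]]
  unfolding om_E[OF assms, symmetric] om_def by (simp add: sum_nonneg)

lemma hval_nonneg:
  assumes "0 < s" "s \<le> d" "j \<le> n" "g \<in> \<Gamma> n" "mu d g \<noteq> 0"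
  shows "0 \<le> hval s j g"
  using hval_mu_nonneg[OF assms(1-4)] mu_nonneg[OF assms(4), of d] assms(5)
  by (simp add: zero_le_mult_iff)

lemma sum_hval_mu:
  assumes "0 < s" "s \<le> d" "j \<le> n"
  shows "(\<Sum>g\<in>\<Gamma> n. hval s j g * mu d g) = 1"
proof -
  have "(\<Sum>g\<in>\<Gamma> n. hval s j g * mu d g) = om d s j (\<Sum>g\<in>\<Gamma> n. E n g)"
    using om_E[OF assms] by (simp add: om_sum)
  also have "\<dots> = 1" using assms by (simp add: sum_E om_def ind_def card_words)
  finally show ?thesis .
qed

text \<open>A projection of trace zero on the words over d letters vanishes on them.\<close>

lemma E_zero_words:
  assumes "0 < d" "g \<in> \<Gamma> n" "hval d n g * mu d g = 0" "w \<in> words d d n" "u \<in> words d d n"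
  shows "app (E n g) (ind w) u = 0"
proof -
  have "om d d n (E n g) = 0" using om_E[of d d n g] assms by simp
  then have "(\<Sum>w\<in>words d d n. app (E n g) (ind w) w) = 0" using assms(1) by (simp add: om_def)
  then have "app (E n g) (ind w) w = 0"
    using symop_idem_nonneg[OF symop_E E_idem[OF assms(2)]] assms(4)
    by (simp add: sum_nonneg_eq_0_iff finite_words)
  then show ?thesis
    by (rule symop_idem_zero[OF symop_E E_idem[OF assms(2)] _ closed_words_words assms(4,5)])
qed

text \<open>Absolute continuity of the k-letter measure with respect to the d-letter measure: words
  over k letters are among the words over d letters. It legitimates every division by
  \<open>hval d n g\<close> later on.\<close>

lemma hval_mu_zero:
  assumes "0 < k" "k \<le> d" "g \<in> \<Gamma> n" "hval d n g * mu d g = 0"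
  shows "hval k n g * mu d g = 0"
proof -
  have "om d k n (E n g) = 0"
    unfolding om_def using assms words_mono[OF assms(2)]
    by (intro divide_eq_0_iff[THEN iffD2] disjI1 sum.neutral ballI E_zero_words) auto
  then show ?thesis using om_E[of k d n g] assms by simp
qed

lemma tau_perm_E_zero:
  assumes "mu d g = 0" "g \<in> \<Gamma> n" "p permutes {..<n}"
  shows "tau d (perm_op p * E n g) = 0"
proof -
  let ?w = "\<lambda>i. d + i"
  have "app (E n g) (ind ?w) (?w \<circ> p) = 0"
    by (rule symop_idem_zero[OF symop_E E_idem[OF assms(2)] _ closed_words_orbit orbit_self])
       (use assms in \<open>auto simp: mu_def tau_def\<close>)
  then show ?thesis by (simp add: tau_def)
qed

end

section \<open>Moments of the Jucys-Murphy elements\<close>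

lemma fixc_le: "fixc d s n p \<le> s ^ n"
  unfolding fixc_def card_words[of d s n, symmetric]
  by (intro card_mono finite_words) auto

lemma fixc_id: "fixc d s n id = s ^ n"
  by (simp add: fixc_def card_words)

lemma fixc_shift: "p permutes {..<j} \<Longrightarrow> fixc d s (j + m) p = s ^ m * fixc d s j p"
proof (induction m)
  case (Suc m)
  have "p permutes {..<j + m}" by (rule permutes_subset[OF Suc.prems]) auto
  then show ?case using Suc by (simp add: fixc_Suc)
qed simp

lemma comp_transpose_fixed: "w i = w j \<Longrightarrow> w \<circ> transpose i j = w"
  by (auto simp: fun_eq_iff transpose_def)

text \<open>Composing with (i j) joins the fixed point i to the cycle of j, so there is exactly one
  cycle less.\<close>

lemma fixc_merge:
  assumes p: "p permutes {..<n}" and i: "p i = i" "i \<noteq> j" "i < n" "j < n"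
  shows "fixc d s n p = s * fixc d s n (transpose i j \<circ> p)"
proof -
  have fix_iff: "w \<circ> (transpose i j \<circ> p) = w \<longleftrightarrow> w i = w j \<and> w \<circ> p = w" for w :: word
  proof
    assume w: "w \<circ> (transpose i j \<circ> p) = w"
    have ij: "w i = w j" using fun_cong[OF w, of i] i by simp
    then have "w \<circ> p = w \<circ> transpose i j \<circ> p" by (simp add: comp_transpose_fixed)
    then show "w i = w j \<and> w \<circ> p = w" using w ij by (simp add: comp_assoc)
  next
    assume w: "w i = w j \<and> w \<circ> p = w"
    then show "w \<circ> (transpose i j \<circ> p) = w" by (simp add: comp_assoc[symmetric] comp_transpose_fixed)
  qed
  have upd: "w(i := c) \<circ> p = w(i := c)" if "w \<circ> p = w" for w :: word and c
  proof
    fix l show "(w(i := c) \<circ> p) l = (w(i := c)) l"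
      using i permutes_inj[OF p] fun_cong[OF that, of l] by (cases "l = i") (auto simp: inj_def)
  qed
  have "bij_betw (\<lambda>(w, c). w(i := c)) ({w \<in> words d s n. w \<circ> (transpose i j \<circ> p) = w} \<times> {..<s})
      {w \<in> words d s n. w \<circ> p = w}"
  proof (rule bij_betw_byWitness[where f' = "\<lambda>w. (w(i := w j), w i)"])
    show "(\<lambda>(w, c). w(i := c)) ` ({w \<in> words d s n. w \<circ> (transpose i j \<circ> p) = w} \<times> {..<s})
        \<subseteq> {w \<in> words d s n. w \<circ> p = w}"
      unfolding fix_iff using upd i by (auto simp: words_def)
    show "(\<lambda>w. (w(i := w j), w i)) ` {w \<in> words d s n. w \<circ> p = w}
        \<subseteq> {w \<in> words d s n. w \<circ> (transpose i j \<circ> p) = w} \<times> {..<s}"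
      unfolding fix_iff using upd i by (auto simp: words_def)
  qed (use i in \<open>auto simp: fix_iff fun_upd_idem\<close>)
  from bij_betw_same_card[OF this] show ?thesis
    by (simp add: fixc_def card_cartesian_product mult.commute)
qed

text \<open>Reading letters modulo \<open>s\<close>, the words fixed by a permutation form a group and
  \<open>w \<mapsto> w\<^sub>i - w\<^sub>j\<close> is a homomorphism to \<open>Z/s\<close>, whose kernel has index at most \<open>s\<close>.\<close>

lemma fixc_split:
  assumes p: "p permutes {..<n}" and ij: "i < n" "j < n" and s: "0 < s"
  shows "fixc d s n (transpose i j \<circ> p) \<le> s * fixc d s n p"
proof -
  define q where "q = transpose i j \<circ> p"
  have q: "q permutes {..<n}"
    unfolding q_def using p ij by (intro permutes_compose permutes_swap_id) auto
  define A where "A = {w \<in> words d s n. w \<circ> q = w}"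
  define K where "K = {w \<in> A. w i = w j}"
  define f where "f w = (int (w i) - int (w j)) mod int s" for w :: word
  have fin: "finite A" "finite K" by (auto simp: A_def K_def finite_words)
  \<comment> \<open>Each nonempty fibre of the homomorphism is sent injectively into the kernel by
    subtracting one of its members, \<open>w0\<close>, letterwise modulo s.\<close>
  have fib: "card {w \<in> A. f w = t} \<le> card K" for t
  proof (cases "{w \<in> A. f w = t} = {}")
    case False
    then obtain w0 where w0: "w0 \<in> A" "f w0 = t" by blast
    define g where "g w l = (if l < n then nat ((int (w l) - int (w0 l)) mod int s) else d + l)" for w :: word and l
    have "inj_on g {w \<in> A. f w = t}"
    proof (rule inj_onI, rule ext)
      fix v w l assume vw: "v \<in> {w \<in> A. f w = t}" "w \<in> {w \<in> A. f w = t}" "g v = g w"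
      show "v l = w l"
      proof (cases "l < n")
        case True
        have "(int (v l) - int (w0 l)) mod int s = (int (w l) - int (w0 l)) mod int s"
          using fun_cong[OF vw(3), of l] True s by (simp add: g_def nat_eq_iff)
        then have "int (v l) mod int s = int (w l) mod int s"
          by (metis diff_add_cancel mod_add_left_eq)
        moreover have "v l < s" "w l < s" using vw True by (auto simp: A_def words_def)
        ultimately show ?thesis by simp
      next
        case False
        then show ?thesis using vw by (simp add: A_def words_def)
      qed
    qed
    moreover have "g ` {w \<in> A. f w = t} \<subseteq> K"
    proof safe
      fix w assume w: "w \<in> A" "t = f w"
      have qn: "q l < n \<longleftrightarrow> l < n" for l using permutes_in_image[OF q, of l] by simp
      have "w (q l) = w l" "w0 (q l) = w0 l" for l
        using w(1) w0(1) by (auto simp: A_def fun_eq_iff)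
      then have "g w \<circ> q = g w"
        using permutes_not_in[OF q] by (auto simp: g_def fun_eq_iff qn)
      moreover have "g w \<in> words d s n"
        using s by (auto simp: words_def g_def nat_less_iff)
      moreover have "g w i = g w j"
      proof -
        have "(int (w i) - int (w j)) mod int s = (int (w0 i) - int (w0 j)) mod int s"
          using w w0 by (simp add: f_def)
        then have "int s dvd (int (w i) - int (w j)) - (int (w0 i) - int (w0 j))"
          by (simp add: mod_eq_dvd_iff)
        then have "int s dvd (int (w i) - int (w0 i)) - (int (w j) - int (w0 j))"
          by (simp add: algebra_simps)
        then show ?thesis using ij by (simp add: g_def mod_eq_dvd_iff[symmetric])
      qed
      ultimately show "g w \<in> K" by (simp add: K_def A_def)
    qed
    ultimately show ?thesis using fin(2) by (rule card_inj_on_le)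
  next
    case True
    then show ?thesis by (simp only: card.empty)
  qed
  have "A = (\<Union>t\<in>{0..<int s}. {w \<in> A. f w = t})" using s by (auto simp: f_def)
  then have "card A = card (\<Union>t\<in>{0..<int s}. {w \<in> A. f w = t})" by (rule arg_cong)
  also have "\<dots> \<le> (\<Sum>t\<in>{0..<int s}. card {w \<in> A. f w = t})"
    by (rule card_UN_le) simp
  also have "\<dots> \<le> s * card K" using sum_mono[of "{0..<int s}", OF fib] by simp
  also have "card K \<le> fixc d s n p"
    unfolding fixc_def
  proof (intro card_mono)
    show "K \<subseteq> {w \<in> words d s n. w \<circ> p = w}"
    proof safe
      fix w assume w: "w \<in> K"
      then show "w \<in> words d s n" by (simp add: K_def A_def)
      have "w \<circ> p = w \<circ> transpose i j \<circ> p" using w by (simp add: K_def comp_transpose_fixed)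
      then show "w \<circ> p = w" using w by (simp add: K_def A_def q_def comp_assoc)
    qed
  qed (simp add: finite_words)
  finally show ?thesis by (simp add: A_def q_def fixc_def)
qed

section \<open>Even moments through products of star transpositions\<close>

primrec star_perm :: "nat \<Rightarrow> nat list \<Rightarrow> nat \<Rightarrow> nat" where
  "star_perm j [] = id"
| "star_perm j (i # is) = transpose i j \<circ> star_perm j is"

lemma star_perm_permutes: "set is \<subseteq> {..<j} \<Longrightarrow> j < n \<Longrightarrow> star_perm j is permutes {..<n}"
  by (induction "is") (auto intro!: permutes_compose permutes_swap_id)

lemma star_perm_fixed: "i \<notin> set is \<Longrightarrow> i \<noteq> j \<Longrightarrow> star_perm j is i = i"
  by (induction "is") (auto simp: transpose_def)

text \<open>Starting from n cycles, a transposition with a new index merges two cycles and a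
  repeated index splits at most one. With L factors and D distinct indices at most n + L - 2 D
  cycles remain.\<close>

lemma fixc_star_perm:
  assumes "set is \<subseteq> {..<j}" "j < n" "0 < s"
  shows "fixc d s n (star_perm j is) * s ^ (2 * card (set is)) \<le> s ^ (n + length is)"
  using assms(1)
proof (induction "is")
  case Nil
  then show ?case by (simp add: fixc_id flip: id_def)
next
  case (Cons i "is")
  let ?p = "star_perm j is"
  have p: "?p permutes {..<n}" by (rule star_perm_permutes) (use Cons assms in auto)
  have i: "i < j" "i < n" using Cons assms by auto
  have IH: "fixc d s n ?p * s ^ (2 * card (set is)) \<le> s ^ (n + length is)" using Cons by simp
  show ?case
  proof (cases "i \<in> set is")
    case True
    have "fixc d s n (star_perm j (i # is)) * s ^ (2 * card (set is))
        \<le> s * fixc d s n ?p * s ^ (2 * card (set is))"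
      using fixc_split[OF p i(2) assms(2,3), of d] by simp
    also have "\<dots> \<le> s * s ^ (n + length is)" using IH by (simp add: mult.assoc)
    finally show ?thesis using True by (simp add: insert_absorb del: star_perm.simps)
  next
    case False
    have "s * fixc d s n (star_perm j (i # is)) = fixc d s n ?p"
      using fixc_merge[OF p star_perm_fixed[OF False], of n d s] i assms(2) fixc_merge[OF p star_perm_fixed[OF False], of j d s] by simp
    then have "fixc d s n (star_perm j (i # is)) * s ^ (2 * card (set (i # is)))
        = s * (fixc d s n ?p * s ^ (2 * card (set is)))"
      using False by (simp add: algebra_simps)
    then show ?thesis using IH by (simp del: star_perm.simps)
  qed
qed

definition seqs :: "nat \<Rightarrow> nat \<Rightarrow> nat list set" where
  "seqs j L = {is. set is \<subseteq> {..<j} \<and> length is = L}"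

lemma sum_seqs_Suc:
  fixes f :: "nat list \<Rightarrow> 'a::comm_monoid_add"
  shows "(\<Sum>is\<in>seqs j (Suc L). f is) = (\<Sum>i<j. \<Sum>is\<in>seqs j L. f (i # is))"
proof -
  have "(\<Sum>is\<in>seqs j (Suc L). f is) = (\<Sum>(i, is)\<in>{..<j} \<times> seqs j L. f (i # is))"
    by (rule sum.reindex_bij_witness[of _ "\<lambda>(i, is). i # is" "\<lambda>is. (hd is, tl is)"])
       (auto simp: seqs_def length_Suc_conv)
  then show ?thesis by (simp add: sum.cartesian_product)
qed

lemma seqs_0: "seqs j 0 = {[]}"
  by (auto simp: seqs_def)

lemma jm_power: "jm j ^ L = (\<Sum>is\<in>seqs j L. perm_op (star_perm j is))"
proof (induction L)
  case (Suc L)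
  then show ?case
    by (simp add: sum_seqs_Suc jm_def[of j] sum_product perm_op_mult)
qed (simp add: seqs_0 flip: id_def)

text \<open>Prepend one index: at most L choices repeat an earlier index and keep the weight, and at
  most j choices are new, each costing t. As j t is at most 1, the sum grows at most by the factor L
  + 1.\<close>

lemma sum_seqs_card:
  fixes t :: real
  assumes "0 \<le> t" "real j * t \<le> 1"
  shows "(\<Sum>is\<in>seqs j L. t ^ card (set is)) \<le> fact L"
proof (induction L)
  case (Suc L)
  have "(\<Sum>i<j. t ^ card (set (i # is))) \<le> t ^ card (set is) * real (Suc L)" if "is \<in> seqs j L" for "is"
  proof -
    have sub: "set is \<subseteq> {..<j}" "card (set is) \<le> L" using that card_length[of "is"] by (auto simp: seqs_def)
    have "(\<Sum>i<j. t ^ card (set (i # is)))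
        = (\<Sum>i\<in>set is. t ^ card (set is)) + (\<Sum>i\<in>{..<j} - set is. t ^ Suc (card (set is)))"
      using sum.subset_diff[OF sub(1), of "\<lambda>i. t ^ card (set (i # is))"] by (simp add: insert_absorb)
    also have "\<dots> = real (card (set is)) * t ^ card (set is) + real (card ({..<j} - set is)) * t * t ^ card (set is)"
      by simp
    also have "\<dots> \<le> real L * t ^ card (set is) + 1 * t ^ card (set is)"
    proof (intro add_mono mult_right_mono)
      have "real (card ({..<j} - set is)) * t \<le> real j * t"
        using card_mono[of "{..<j}" "{..<j} - set is"] assms by (intro mult_right_mono) auto
      then show "real (card ({..<j} - set is)) * t \<le> 1" using assms by simp
    qed (use sub assms in auto)
    finally show ?thesis by (simp add: algebra_simps)
  qed
  then have "(\<Sum>is\<in>seqs j L. \<Sum>i<j. t ^ card (set (i # is))) \<le> (\<Sum>is\<in>seqs j L. t ^ card (set is) * real (Suc L))"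
    by (rule sum_mono)
  also have "\<dots> \<le> fact L * real (Suc L)"
    unfolding sum_distrib_right[symmetric] using Suc by (intro mult_right_mono) auto
  finally show ?case
    unfolding sum_seqs_Suc by (subst sum.swap) (simp add: mult.commute)
qed (simp add: seqs_0)

text \<open>A sequence of 2p star transpositions with D distinct indices contributes at most
  n^(p-D). For D up to p this holds because the fraction of fixed words is at most 1; for larger D
  the fraction is at most s^(2p-2D), and \<open>n \<le> s\<^sup>2\<close> applies.
  \<open>sum_seqs_card\<close> with t = 1/n then sums the contributions.\<close>

lemma om_jm_power:
  assumes s: "0 < s" "s \<le> d" and j: "j < n" and n: "n \<le> s\<^sup>2"
  shows "om d s j (jm j ^ (2 * p)) \<le> fact (2 * p) * real n ^ p"
proof -
  define \<theta> where "\<theta> = 1 / sqrt (real n)"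
  have n0: "0 < real n" using j by simp
  have \<theta>: "0 < \<theta>" "\<theta> \<le> 1" "1 / real s \<le> \<theta>" "\<theta>\<^sup>2 = 1 / real n"
  proof -
    have "sqrt (real n) \<le> real s" using n by (intro real_le_lsqrt) (simp_all flip: of_nat_power)
    then show "1 / real s \<le> \<theta>" using n0 s by (simp add: \<theta>_def frac_le)
  qed (use n0 j in \<open>auto simp: \<theta>_def power_divide\<close>)
  have bound: "om d s j (perm_op (star_perm j is)) \<le> real n ^ p * (1 / real n) ^ card (set is)"
    if "is \<in> seqs j (2 * p)" for "is"
  proof -
    have sub: "set is \<subseteq> {..<j}" "length is = 2 * p" using that by (auto simp: seqs_def)
    let ?q = "star_perm j is" and ?D = "card (set is)"
    define \<phi> where "\<phi> = real (fixc d s n ?q) / real s ^ n"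
    have q: "?q permutes {..<n}" by (rule star_perm_permutes[OF sub(1) j])
    \<comment> \<open>If the product acts only below j, the letters at positions from j to n - 1 are
      free and cancel in the ratio; otherwise the left side is 0.\<close>
    have le: "om d s j (perm_op ?q) \<le> \<phi>"
    proof (cases "?q permutes {..<j}")
      case True
      have "fixc d s n ?q = s ^ (n - j) * fixc d s j ?q"
        using fixc_shift[OF True, of d s "n - j"] j by simp
      moreover have "real s ^ n = real s ^ (n - j) * real s ^ j" using j by (simp flip: power_add)
      ultimately show ?thesis using s True by (simp add: om_perm_op[OF q s(2)] \<phi>_def)
    qed (simp add: om_perm_op[OF q s(2)] \<phi>_def)
    have \<phi>1: "\<phi> \<le> 1" "0 \<le> \<phi>"
      using fixc_le[of d s n ?q] s by (simp_all add: \<phi>_def divide_le_eq_1 flip: of_nat_power)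
    have "real (fixc d s n ?q) * real s ^ (2 * ?D) \<le> real s ^ n * real s ^ (2 * p)"
      using fixc_star_perm[OF sub(1) j s(1), of d] sub(2) by (simp flip: of_nat_power of_nat_mult power_add)
    then have \<phi>2: "\<phi> * real s ^ (2 * ?D) \<le> real s ^ (2 * p)"
      using s by (simp add: \<phi>_def field_simps)
    have "\<phi> * \<theta> ^ (2 * p) \<le> \<theta> ^ (2 * ?D)"
    proof (cases "?D \<le> p")
      case True
      then have "\<theta> ^ (2 * p) \<le> \<theta> ^ (2 * ?D)" using \<theta> by (intro power_decreasing) auto
      moreover have "\<phi> * \<theta> ^ (2 * p) \<le> 1 * \<theta> ^ (2 * p)" using \<phi>1 \<theta> by (intro mult_right_mono) auto
      ultimately show ?thesis by simp
    next
      case False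
      define m where "m = 2 * ?D - 2 * p"
      have m: "2 * ?D = 2 * p + m" using False by (simp add: m_def)
      have "\<phi> * real s ^ m \<le> 1"
      proof -
        have "(\<phi> * real s ^ m) * real s ^ (2 * p) \<le> 1 * real s ^ (2 * p)"
          using \<phi>2 unfolding m power_add by (simp add: mult_ac)
        then show ?thesis using s by (simp only: mult_le_cancel_right) simp
      qed
      then have "\<phi> \<le> (1 / real s) ^ m" using s by (simp add: power_divide field_simps)
      also have "\<dots> \<le> \<theta> ^ m" using \<theta> by (intro power_mono) auto
      finally show ?thesis using \<theta> by (simp add: m power_add)
    qed
    then have "\<phi> * (1 / real n) ^ p \<le> (1 / real n) ^ ?D" by (simp add: power_mult \<theta>(4))
    then have "\<phi> \<le> real n ^ p * (1 / real n) ^ ?D" using n0 by (simp add: power_divide field_simps)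
    then show ?thesis using le by simp
  qed
  have "om d s j (jm j ^ (2 * p)) \<le> (\<Sum>is\<in>seqs j (2 * p). real n ^ p * (1 / real n) ^ card (set is))"
    unfolding jm_power om_sum by (rule sum_mono[OF bound])
  also have "\<dots> \<le> real n ^ p * fact (2 * p)"
    unfolding sum_distrib_left[symmetric] using j by (intro mult_left_mono sum_seqs_card) auto
  finally show ?thesis by (simp add: mult.commute)
qed

section \<open>The affinity of two Schur-Weyl measures\<close>

lemma power_in: "X \<in> perm_alg n \<Longrightarrow> X ^ k \<in> perm_alg n"
  by (induction k) (auto intro: one_in mult_in)

text \<open>X leaves position j alone while every (i j) moves it, so no term of the product is the
  identity.\<close>

lemma tau_alg_jm:
  assumes "X \<in> perm_alg j"
  shows "tau d (X * jm j) = 0"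
  using assms
proof (induction X rule: perm_alg_induct)
  case subspace
  then show ?case by (auto simp: subspace_def algebra_simps)
next
  case (perm p)
  have "p \<circ> transpose i j \<noteq> id" if "i < j" for i
  proof
    assume "p \<circ> transpose i j = id"
    from fun_cong[OF this, of i] show False using that permutes_not_in[OF perm, of j] by simp
  qed
  then show ?case by (simp add: jm_def sum_distrib_left perm_op_mult tau_sum tau_perm_op)
qed

text \<open>In (i j)(i' j) the position j returns to itself only for i = i', which gives j identity
  terms for each one in X.\<close>

lemma tau_alg_jm2:
  assumes "X \<in> perm_alg j"
  shows "tau d (X * (jm j * jm j)) = real j * tau d X"
  using assms
proof (induction X rule: perm_alg_induct)
  case subspace
  then show ?case by (auto simp: subspace_def algebra_simps)
next
  case (perm p)
  have *: "p \<circ> (transpose i j \<circ> transpose i' j) = id \<longleftrightarrow> i = i' \<and> p = id" if "i < j" "i' < j" for i i'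
  proof
    assume e: "p \<circ> (transpose i j \<circ> transpose i' j) = id"
    have "i = i'"
    proof (rule ccontr)
      assume "i \<noteq> i'"
      then have "(transpose i j \<circ> transpose i' j) i = j" using that by (simp add: transpose_def)
      then show False using fun_cong[OF e, of i] that permutes_not_in[OF perm, of j] by simp
    qed
    then show "i = i' \<and> p = id" using e by simp
  qed auto
  have "tau d (perm_op p * (jm j * jm j))
      = (\<Sum>i<j. \<Sum>i'<j. if p \<circ> (transpose i j \<circ> transpose i' j) = id then 1 else 0)"
    unfolding jm_def sum_product by (simp add: sum_distrib_left perm_op_mult tau_sum tau_perm_op)
  also have "\<dots> = (\<Sum>i<j. \<Sum>i'<j. if i' = i then (if p = id then 1 else 0) else 0)"
    by (intro sum.cong refl) (auto simp: *)
  also have "\<dots> = real j * tau d (perm_op p)" by (simp add: tau_perm_op)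
  finally show ?case .
qed

text \<open>The clamp matters: a factor can be negative at a joint eigenvalue, and
  \<open>sqrt\<close> is negative at negative arguments. Clamped products stay below the geometric
  mean of the two densities on the support, see \<open>prod_aff_le\<close>.\<close>

definition aff :: "nat \<Rightarrow> nat \<Rightarrow> real \<Rightarrow> real" where
  "aff r s c = sqrt (max 0 (1 + c / real r)) * sqrt (max 0 (1 + c / real s))"

lemma aff_nonneg: "0 \<le> aff r s c"
  by (simp add: aff_def)

text \<open>Put a = 1 + x c. If |2 x c| is at most 1, then a is at least 1/2 and sqrt(a^2 -
  (\<delta> c)^2) is at least a - (\<delta> c)^2 / a, hence at least a - 2 (\<delta> c)^2. Otherwise
  the last term alone is at least 2 |2 x c|, which exceeds a, and the left side is not
  positive.\<close>

lemma aff_ge: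
  assumes "0 < r" "r < s" "0 < p"
  defines "x \<equiv> (1 / real r + 1 / real s) / 2" and "\<delta> \<equiv> (1 / real r - 1 / real s) / 2"
  shows "1 + x * c - 2 * \<delta>\<^sup>2 * c\<^sup>2 - 2 * (2 * x) ^ (2 * p) * c ^ (2 * p) \<le> aff r s c"
proof (cases "\<bar>2 * x * c\<bar> \<le> 1")
  case True
  have rs: "0 < 1 / real r" "0 < 1 / real s" "1 / real s < 1 / real r" using assms by (auto simp: frac_less2)
  have xd: "1 / real r = x + \<delta>" "1 / real s = x - \<delta>" by (simp_all add: x_def \<delta>_def field_simps)
  have x: "0 < x" "0 < \<delta>" "\<delta> < x" using rs xd by linarith+
  define a where "a = 1 + x * c"
  have xc: "\<bar>x * c\<bar> \<le> 1/2" using True by (simp add: abs_mult)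
  have a: "1 / 2 \<le> a" using xc unfolding a_def by linarith
  have dc: "\<bar>\<delta> * c\<bar> \<le> a"
  proof -
    have "\<bar>\<delta> * c\<bar> \<le> \<bar>x * c\<bar>" using x by (simp add: abs_mult mult_right_mono)
    then show ?thesis using xc a by linarith
  qed
  have f: "1 + c / real r = a + \<delta> * c" "1 + c / real s = a - \<delta> * c"
  proof -
    have "1 + c / real r = 1 + (1 / real r) * c" "1 + c / real s = 1 + (1 / real s) * c" by simp_all
    then show "1 + c / real r = a + \<delta> * c" "1 + c / real s = a - \<delta> * c"
      unfolding xd by (simp_all add: a_def algebra_simps)
  qed
  have "aff r s c = sqrt ((a + \<delta> * c) * (a - \<delta> * c))"
    unfolding aff_def f using dc by (simp add: real_sqrt_mult)
  also have "\<dots> = sqrt (a\<^sup>2 - (\<delta> * c)\<^sup>2)" by (simp add: power2_eq_square algebra_simps)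
  also have "\<dots> \<ge> a - (\<delta> * c)\<^sup>2 / a"
  proof (rule real_le_rsqrt)
    have "(\<delta> * c)\<^sup>2 \<le> a\<^sup>2" using dc by (simp add: abs_le_square_iff[symmetric])
    then have q: "(\<delta> * c)\<^sup>2 / a \<le> a" using a by (simp add: divide_le_eq power2_eq_square)
    have "(a - (\<delta> * c)\<^sup>2 / a)\<^sup>2 = a\<^sup>2 - 2 * (\<delta> * c)\<^sup>2 + ((\<delta> * c)\<^sup>2 / a) * ((\<delta> * c)\<^sup>2 / a)"
      using a by (simp add: power2_eq_square field_simps)
    also have "\<dots> \<le> a\<^sup>2 - 2 * (\<delta> * c)\<^sup>2 + ((\<delta> * c)\<^sup>2 / a) * a"
      using q a by (intro add_left_mono mult_left_mono) auto
    finally show "(a - (\<delta> * c)\<^sup>2 / a)\<^sup>2 \<le> a\<^sup>2 - (\<delta> * c)\<^sup>2" using a by simp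
  qed
  finally have "a - (\<delta> * c)\<^sup>2 / a \<le> aff r s c" .
  moreover have "(\<delta> * c)\<^sup>2 / a \<le> 2 * (\<delta> * c)\<^sup>2"
    using a mult_left_mono[of "1/2" a "(\<delta> * c)\<^sup>2"] by (simp add: divide_le_eq)
  moreover have "0 \<le> 2 * (2 * x) ^ (2 * p) * c ^ (2 * p)" by simp
  ultimately have "a - 2 * (\<delta> * c)\<^sup>2 - 2 * (2 * x) ^ (2 * p) * c ^ (2 * p) \<le> aff r s c" by linarith
  then show ?thesis by (simp only: a_def power_mult_distrib mult.assoc)
next
  case False
  have e: "2 * (2 * x) ^ (2 * p) * c ^ (2 * p) = 2 * \<bar>2 * x * c\<bar> ^ (2 * p)"
    by (simp add: power_mult_distrib power_even_abs)
  have "\<bar>2 * x * c\<bar> \<le> \<bar>2 * x * c\<bar> ^ (2 * p)"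
    using False assms(3) by (intro self_le_power) auto
  moreover have "1 + x * c \<le> 2 * \<bar>2 * x * c\<bar>" using False by linarith
  moreover have "0 \<le> 2 * \<delta>\<^sup>2 * c\<^sup>2" by simp
  ultimately show ?thesis unfolding e using aff_nonneg[of r s c] by linarith
qed

section \<open>The affinity, one Jucys-Murphy element at a time\<close>

context jm_spectrum
begin

lemma peval_E:
  assumes "g \<in> \<Gamma> n" "j < n"
  shows "peval p (jm j) * E n g = poly p (g j) *\<^sub>R E n g"
proof (induction p)
  case (pCons a p)
  have "jm j * peval p (jm j) * E n g = poly p (g j) *\<^sub>R (jm j * E n g)"
    using pCons by (simp add: mult.assoc)
  then show ?case using jm_E[OF assms] by (simp add: algebra_simps of_real_def)
qed simp

lemma jm_power_E:
  assumes "g \<in> \<Gamma> n" "j < n"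
  shows "jm j ^ k * E n g = g j ^ k *\<^sub>R E n g"
proof (induction k)
  case (Suc k)
  then show ?case using jm_E[OF assms] by (simp add: mult.assoc)
qed simp

text \<open>Assembled from functions of \<open>jm i\<close> with i < j, not as an \<open>fop\<close>
  over full sequences, so that it lies in \<open>perm_alg j\<close>; the conditional moments in
  \<open>tau_alg_jm\<close> and \<open>tau_alg_jm2\<close> require exactly that.\<close>

primrec fprod :: "(real \<Rightarrow> real) \<Rightarrow> nat \<Rightarrow> word lop" where
  "fprod f 0 = 1"
| "fprod f (Suc j) = fprod f j * (\<Sum>c\<in>S. f c *\<^sub>R idem S (jm j) c)"

lemma fprod_in: "fprod f j \<in> perm_alg j"
proof (induction j)
  case (Suc j)
  then show ?case
    using perm_alg_mono[of j "Suc j"] by (auto intro!: mult_in idem_in perm_alg_closed)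
qed (simp add: one_in)

lemma fprod_E:
  assumes "g \<in> \<Gamma> n" "j \<le> n"
  shows "fprod f j * E n g = (\<Prod>i<j. f (g i)) *\<^sub>R E n g"
  using assms(2)
proof (induction j)
  case (Suc j)
  have "j < n" using Suc.prems by simp
  then have gS: "g j \<in> S" using PiE_mem[OF assms(1), of j] by simp
  have "(\<Sum>c\<in>S. f c *\<^sub>R idem S (jm j) c) * E n g = (\<Sum>c\<in>S. if c = g j then f c *\<^sub>R E n g else 0)"
    unfolding sum_distrib_right idem_def
    using Suc.prems peval_E[OF assms(1), of j] gS
    by (intro sum.cong refl) (auto simp: poly_lagrange[OF finite_S])
  also have "\<dots> = f (g j) *\<^sub>R E n g" using gS finite_S by simp
  finally have "fprod f (Suc j) * E n g = f (g j) *\<^sub>R (fprod f j * E n g)"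
    by (simp add: mult.assoc)
  then show ?case using Suc by simp
qed simp

lemma tau_fprod_jm:
  assumes "j < n"
  shows "tau d (fprod f j * jm j ^ k) = (\<Sum>g\<in>\<Gamma> n. (\<Prod>i<j. f (g i)) * g j ^ k * mu d g)"
  using assms by (intro tau_eq_sum) (simp add: mult.assoc jm_power_E fprod_E)

text \<open>Where all factors are nonnegative the first bound is an equality; otherwise a clamped
  factor makes the left side 0. The second is the inequality of arithmetic and geometric means,
  valid on the support of \<open>mu\<close>, where the densities are nonnegative.\<close>

lemma prod_aff_le:
  assumes rs: "0 < r" "0 < s" "r \<le> d" "s \<le> d" and j: "j \<le> n" and g: "g \<in> \<Gamma> n"
  shows "(\<Prod>i<j. aff r s (g i)) * mu d g \<le> sqrt (hval r j g * hval s j g) * mu d g"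
    "sqrt (hval r j g * hval s j g) * mu d g \<le> (hval r j g + hval s j g) / 2 * mu d g"
proof -
  have "(\<Prod>i<j. aff r s (g i)) \<le> sqrt (hval r j g * hval s j g)
      \<and> sqrt (hval r j g * hval s j g) \<le> (hval r j g + hval s j g) / 2" if "mu d g \<noteq> 0"
  proof
    have h: "0 \<le> hval r j g" "0 \<le> hval s j g"
      using hval_nonneg[OF rs(1,3) j g that] hval_nonneg[OF rs(2,4) j g that] by auto
    then show "sqrt (hval r j g * hval s j g) \<le> (hval r j g + hval s j g) / 2"
      by (rule arith_geo_mean_sqrt)
    show "(\<Prod>i<j. aff r s (g i)) \<le> sqrt (hval r j g * hval s j g)"
    proof (cases "\<forall>i<j. 0 \<le> 1 + g i / real r \<and> 0 \<le> 1 + g i / real s")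
      case True
      then have "(\<Prod>i<j. aff r s (g i)) = (\<Prod>i<j. sqrt ((1 + g i / real r) * (1 + g i / real s)))"
        by (intro prod.cong) (auto simp: aff_def real_sqrt_mult)
      also have "\<dots> = sqrt (\<Prod>i<j. (1 + g i / real r) * (1 + g i / real s))"
        by (induction j) (simp_all add: real_sqrt_mult)
      finally show ?thesis by (simp add: hval_def prod.distrib)
    next
      case False
      then obtain i where "i < j" "1 + g i / real r \<le> 0 \<or> 1 + g i / real s \<le> 0" by force
      then have "aff r s (g i) = 0" by (auto simp: aff_def max_def)
      then have "(\<Prod>i<j. aff r s (g i)) = 0" using \<open>i < j\<close> by (auto intro: prod_zero)
      then show ?thesis using h by (simp only: mult_nonneg_nonneg real_sqrt_ge_zero)
    qed
  qed
  then show "(\<Prod>i<j. aff r s (g i)) * mu d g \<le> sqrt (hval r j g * hval s j g) * mu d g"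
    "sqrt (hval r j g * hval s j g) * mu d g \<le> (hval r j g + hval s j g) / 2 * mu d g"
    using mu_nonneg[OF g, of d] by (cases "mu d g = 0"; simp add: mult_right_mono)+
qed

text \<open>Here \<open>\<kappa> j\<close> integrates the first j affinity factors. Passing to j + 1
  by \<open>aff_ge\<close> costs at most 2 \<delta>^2 j from the variance, using
  \<open>\<kappa> j\<close> at most 1, and at most B from the high moment.\<close>

theorem affinity_ge:
  assumes rs: "0 < r" "r < s" "s \<le> d" and n: "n \<le> r\<^sup>2" and p: "0 < p"
  defines "x \<equiv> (1 / real r + 1 / real s) / 2" and "\<delta> \<equiv> (1 / real r - 1 / real s) / 2"
  shows "1 - \<delta>\<^sup>2 * (real n)\<^sup>2 - 2 * real n * ((2 * x) ^ (2 * p) * fact (2 * p) * real n ^ p)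
    \<le> (\<Sum>g\<in>\<Gamma> n. sqrt (hval r n g * hval s n g) * mu d g)"
proof -
  define B where "B = 2 * ((2 * x) ^ (2 * p) * fact (2 * p) * real n ^ p)"
  define f where "f = aff r s"
  define G where "G j g = (\<Prod>i<j. f (g i))" for j :: nat and g
  define \<kappa> where "\<kappa> j = (\<Sum>g\<in>\<Gamma> n. G j g * mu d g)" for j
  have rs': "0 < s" "r \<le> d" "n \<le> s\<^sup>2" using rs n le_trans[OF n power_mono[of r s 2]] by auto
  have x: "0 \<le> x" by (simp add: x_def)
  have G: "G j g * mu d g \<le> (hval r j g + hval s j g) / 2 * mu d g" if "j \<le> n" "g \<in> \<Gamma> n" for j g
    using prod_aff_le[OF rs(1) rs'(1,2) rs(3) that] by (simp add: G_def f_def)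
  have hm: "(\<Sum>g\<in>\<Gamma> n. hval t j g * g j ^ (2 * p) * mu d g) \<le> fact (2 * p) * real n ^ p"
    if t: "t = r \<or> t = s" and j: "j < n" for t j
  proof -
    have "0 < t" "t \<le> d" "n \<le> t\<^sup>2" using t rs rs' n by auto
    have "(\<Sum>g\<in>\<Gamma> n. hval t j g * g j ^ (2 * p) * mu d g) = tau d (hprod t j * jm j ^ (2 * p))"
      using j by (intro tau_eq_sum[symmetric]) (simp add: mult.assoc jm_power_E hprod_E)
    also have "\<dots> = om d t j (jm j ^ (2 * p))"
    proof (rule om_eq_tau[symmetric])
      show "jm j ^ (2 * p) \<in> perm_alg n"
        by (rule power_in[OF jm_in[OF j]])
    qed (use \<open>0 < t\<close> \<open>t \<le> d\<close> j in auto)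
    also have "\<dots> \<le> fact (2 * p) * real n ^ p" by (rule om_jm_power) fact+
    finally show ?thesis .
  qed
  have step: "\<kappa> j - 2 * \<delta>\<^sup>2 * real j - B \<le> \<kappa> (Suc j)" if j: "j < n" for j
  proof -
    have \<kappa>1: "\<kappa> j \<le> 1"
    proof -
      have "\<kappa> j \<le> (\<Sum>g\<in>\<Gamma> n. (hval r j g + hval s j g) / 2 * mu d g)"
        unfolding \<kappa>_def using j by (intro sum_mono G) auto
      also have "\<dots> = ((\<Sum>g\<in>\<Gamma> n. hval r j g * mu d g) + (\<Sum>g\<in>\<Gamma> n. hval s j g * mu d g)) / 2"
        by (simp add: sum.distrib sum_divide_distrib algebra_simps add_divide_distrib)
      also have "\<dots> = 1" using sum_hval_mu[of r d j] sum_hval_mu[of s d j] rs rs' j by simp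
      finally show ?thesis .
    qed
    have m1: "(\<Sum>g\<in>\<Gamma> n. G j g * g j * mu d g) = 0"
      using tau_fprod_jm[OF j, of d f 1] tau_alg_jm[OF fprod_in] by (simp add: G_def)
    have m2: "(\<Sum>g\<in>\<Gamma> n. G j g * (g j)\<^sup>2 * mu d g) = real j * \<kappa> j"
      using tau_fprod_jm[OF j, of d f 2] tau_fprod_jm[OF j, of d f 0] tau_alg_jm2[OF fprod_in, of d f j]
      by (simp add: G_def \<kappa>_def power2_eq_square)
    \<comment> \<open>\<open>G j\<close> is no density of a trace over words, so the even moment is
      bounded through the mean of the two Schur-Weyl densities, where \<open>hm\<close>
      applies.\<close>
    have m3: "(\<Sum>g\<in>\<Gamma> n. G j g * g j ^ (2 * p) * mu d g) \<le> fact (2 * p) * real n ^ p"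
    proof -
      have "(\<Sum>g\<in>\<Gamma> n. G j g * g j ^ (2 * p) * mu d g)
          \<le> (\<Sum>g\<in>\<Gamma> n. (hval r j g * g j ^ (2 * p) * mu d g + hval s j g * g j ^ (2 * p) * mu d g) / 2)"
      proof (rule sum_mono)
        fix g assume "g \<in> \<Gamma> n"
        then have "g j ^ (2 * p) * (G j g * mu d g) \<le> g j ^ (2 * p) * ((hval r j g + hval s j g) / 2 * mu d g)"
          using j by (intro mult_left_mono G) auto
        then show "G j g * g j ^ (2 * p) * mu d g
            \<le> (hval r j g * g j ^ (2 * p) * mu d g + hval s j g * g j ^ (2 * p) * mu d g) / 2"
          by (simp add: algebra_simps add_divide_distrib)
      qed
      also have "\<dots> \<le> fact (2 * p) * real n ^ p"
        using hm[OF _ j, of r] hm[OF _ j, of s] by (simp add: sum_divide_distrib[symmetric] sum.distrib)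
      finally show ?thesis .
    qed
    have "\<kappa> j - 2 * \<delta>\<^sup>2 * (real j * \<kappa> j) - 2 * (2 * x) ^ (2 * p) * (\<Sum>g\<in>\<Gamma> n. G j g * g j ^ (2 * p) * mu d g)
        = (\<Sum>g\<in>\<Gamma> n. G j g * (1 + x * g j - 2 * \<delta>\<^sup>2 * (g j)\<^sup>2 - 2 * (2 * x) ^ (2 * p) * g j ^ (2 * p)) * mu d g)"
    proof -
      have "(\<Sum>g\<in>\<Gamma> n. G j g * (1 + x * g j - 2 * \<delta>\<^sup>2 * (g j)\<^sup>2 - 2 * (2 * x) ^ (2 * p) * g j ^ (2 * p)) * mu d g)
        = (\<Sum>g\<in>\<Gamma> n. G j g * mu d g + x * (G j g * g j * mu d g) - 2 * \<delta>\<^sup>2 * (G j g * (g j)\<^sup>2 * mu d g)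
            - 2 * (2 * x) ^ (2 * p) * (G j g * g j ^ (2 * p) * mu d g))"
        by (rule sum.cong) (simp_all add: algebra_simps)
      then show ?thesis
        by (simp add: sum_subtractf sum.distrib sum_distrib_left[symmetric] m1 m2 \<kappa>_def[symmetric])
    qed
    also have "\<dots> \<le> (\<Sum>g\<in>\<Gamma> n. G j g * f (g j) * mu d g)"
      unfolding f_def x_def \<delta>_def
      by (intro sum_mono mult_right_mono mult_left_mono aff_ge mu_nonneg rs p)
         (auto simp: G_def f_def intro!: prod_nonneg aff_nonneg)
    also have "\<dots> = \<kappa> (Suc j)" by (simp add: \<kappa>_def G_def)
    finally have "\<kappa> j - 2 * \<delta>\<^sup>2 * (real j * \<kappa> j)
        - 2 * (2 * x) ^ (2 * p) * (\<Sum>g\<in>\<Gamma> n. G j g * g j ^ (2 * p) * mu d g) \<le> \<kappa> (Suc j)" .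
    moreover have "2 * \<delta>\<^sup>2 * (real j * \<kappa> j) \<le> 2 * \<delta>\<^sup>2 * (real j * 1)"
      using \<kappa>1 by (intro mult_left_mono) auto
    moreover have "2 * (2 * x) ^ (2 * p) * (\<Sum>g\<in>\<Gamma> n. G j g * g j ^ (2 * p) * mu d g)
        \<le> 2 * (2 * x) ^ (2 * p) * (fact (2 * p) * real n ^ p)"
      using m3 x by (intro mult_left_mono) auto
    moreover have "2 * (2 * x) ^ (2 * p) * (fact (2 * p) * real n ^ p) = B"
      unfolding B_def by (simp only: mult.assoc)
    ultimately show ?thesis by linarith
  qed
  have ind: "j \<le> n \<Longrightarrow> 1 - \<delta>\<^sup>2 * (real j)\<^sup>2 - real j * B \<le> \<kappa> j" for j
  proof (induction j)
    case 0
    then show ?case by (simp add: \<kappa>_def G_def sum_mu)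
  next
    case (Suc j)
    have "\<delta>\<^sup>2 * (real j)\<^sup>2 + 2 * \<delta>\<^sup>2 * real j \<le> \<delta>\<^sup>2 * (real (Suc j))\<^sup>2"
      by (simp add: power2_eq_square algebra_simps)
    moreover have "1 - \<delta>\<^sup>2 * (real j)\<^sup>2 - real j * B - 2 * \<delta>\<^sup>2 * real j - B \<le> \<kappa> (Suc j)"
      using Suc step[of j] by simp
    ultimately show ?case by (simp add: algebra_simps)
  qed
  have "\<kappa> n \<le> (\<Sum>g\<in>\<Gamma> n. sqrt (hval r n g * hval s n g) * mu d g)"
    unfolding \<kappa>_def G_def f_def
    by (intro sum_mono prod_aff_le(1)[OF rs(1) rs'(1,2) rs(3)]) auto
  with ind[of n] show ?thesis by (simp add: B_def algebra_simps)
qed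

end

section \<open>Matrices commuting with all permutation-invariant matrices\<close>

lemma app_words_expand:
  assumes "\<And>w. w \<notin> words d d n \<Longrightarrow> f w = 0"
  shows "app X f = (\<lambda>w. \<Sum>v\<in>words d d n. f v * app X (ind v) w)"
proof -
  have "f = (\<lambda>w. \<Sum>v\<in>words d d n. f v * ind v w)"
  proof
    fix w
    have "(\<Sum>v\<in>words d d n. f v * ind v w) = (\<Sum>v\<in>words d d n. if v = w then f w else 0)"
      by (rule sum.cong) (auto simp: ind_def)
    then show "f w = (\<Sum>v\<in>words d d n. f v * ind v w)" using assms[of w] by (simp add: finite_words)
  qed
  then have "app X f = app X (\<lambda>w. \<Sum>v\<in>words d d n. f v * ind v w)" by (rule arg_cong)
  then show ?thesis by (simp add: app_sum app_scale)
qed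

lemma words_comp_iff:
  assumes "p permutes {..<n}"
  shows "w \<circ> p \<in> words d s n \<longleftrightarrow> w \<in> words d s n"
proof
  assume "w \<circ> p \<in> words d s n"
  then have "w \<circ> p \<circ> inv p \<in> words d s n" by (rule words_comp[OF _ permutes_inv[OF assms]])
  then show "w \<in> words d s n" by (simp add: comp_assoc permutes_inv_o[OF assms])
qed (rule words_comp[OF _ assms])

lemma app_outside:
  assumes "X \<in> perm_alg n" "\<And>w. w \<notin> words d s n \<Longrightarrow> f w = 0" "w \<notin> words d s n"
  shows "app X f w = 0"
  using assms(1)
proof (induction X rule: perm_alg_induct)
  case subspace
  then show ?case by (auto simp: subspace_def)
next
  case (perm p)
  then show ?case using assms(2,3) by (simp add: words_comp_iff)
qed

lemma comp_perm_cancel: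
  assumes "p permutes {..<n::nat}"
  shows "w \<circ> p = v \<circ> p \<longleftrightarrow> w = v"
proof
  assume "w \<circ> p = v \<circ> p"
  then have "w \<circ> p \<circ> inv p = v \<circ> p \<circ> inv p" by simp
  then show "w = v" by (simp add: comp_assoc permutes_inv_o[OF assms])
qed simp

lemma sum_ind:
  assumes "z \<in> words d s n"
  shows "(\<Sum>v\<in>words d s n. f v * ind z v) = f z"
proof -
  have "(\<Sum>v\<in>words d s n. f v * ind z v) = (\<Sum>v\<in>words d s n. if v = z then f z else 0)"
    by (rule sum.cong) (auto simp: ind_def)
  then show ?thesis using assms by (simp add: finite_words)
qed

definition perm_invariant :: "nat \<Rightarrow> (word \<Rightarrow> word \<Rightarrow> 'a) \<Rightarrow> bool" where
  "perm_invariant n X \<longleftrightarrow> (\<forall>p w v. p permutes {..<n} \<longrightarrow> X (w \<circ> p) (v \<circ> p) = X w v)"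

text \<open>\<open>Q w v x t\<close> is the entry in row (w, v) and column (x, t) of a matrix on two
  tensor factors; the two clauses say that it commutes with X on the first factor and with X on the
  second.\<close>

definition bi_invariant :: "nat \<Rightarrow> word set \<Rightarrow> (word \<Rightarrow> word \<Rightarrow> word \<Rightarrow> word \<Rightarrow> real) \<Rightarrow> bool" where
  "bi_invariant n W Q \<longleftrightarrow> (\<forall>X. perm_invariant n X \<longrightarrow> (\<forall>w\<in>W. \<forall>v\<in>W. \<forall>x\<in>W. \<forall>t\<in>W.
     (\<Sum>u\<in>W. X w u * Q u v x t) = (\<Sum>u\<in>W. Q w v u t * X u x) \<and>
     (\<Sum>u\<in>W. X v u * Q w u x t) = (\<Sum>u\<in>W. Q w v x u * X u t)))"

lemma bi_invariantD:
  assumes "bi_invariant n W Q" "perm_invariant n X" "w \<in> W" "v \<in> W" "x \<in> W" "t \<in> W"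
  shows "(\<Sum>u\<in>W. X w u * Q u v x t) = (\<Sum>u\<in>W. Q w v u t * X u x)"
    "(\<Sum>u\<in>W. X v u * Q w u x t) = (\<Sum>u\<in>W. Q w v x u * X u t)"
  using assms unfolding bi_invariant_def by blast+

definition quad :: "'a set \<Rightarrow> ('a \<Rightarrow> 'a \<Rightarrow> 'a \<Rightarrow> 'a \<Rightarrow> real) \<Rightarrow> ('a \<Rightarrow> 'a \<Rightarrow> real) \<Rightarrow> real" where
  "quad W Q \<phi> = (\<Sum>w\<in>W. \<Sum>v\<in>W. \<Sum>x\<in>W. \<Sum>t\<in>W. \<phi> w v * Q w v x t * \<phi> x t)"

definition orbit_matrix :: "nat \<Rightarrow> word \<Rightarrow> word \<Rightarrow> word \<Rightarrow> word \<Rightarrow> real" where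
  "orbit_matrix n x y w v = (\<Sum>p | p permutes {..<n}. ind (x \<circ> p) w * ind (y \<circ> p) v)"

lemma orbit_matrix_invariant: "perm_invariant n (orbit_matrix n x y)"
  unfolding perm_invariant_def
proof (intro allI impI)
  fix q w v assume q: "q permutes {..<n}"
  have "orbit_matrix n x y (w \<circ> q) (v \<circ> q)
      = (\<Sum>p | p permutes {..<n}. ind (x \<circ> (p \<circ> q)) (w \<circ> q) * ind (y \<circ> (p \<circ> q)) (v \<circ> q))"
    unfolding orbit_matrix_def
    using q by (rule sum_permutations_compose_right)
  also have "\<dots> = orbit_matrix n x y w v"
    unfolding orbit_matrix_def ind_def comp_assoc[symmetric] comp_perm_cancel[OF q] ..
  finally show "orbit_matrix n x y (w \<circ> q) (v \<circ> q) = orbit_matrix n x y w v" .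
qed

context jm_spectrum
begin

text \<open>A Weingarten-type inversion: summing the commutation relation with \<open>|x \<circ> p\<rangle>\<langle>y \<circ> p|\<close> over \<open>x\<close>
  expresses \<open>hprod d n\<close> times the matrix through permutations, and \<open>hprod d n\<close> is invertible on
  \<open>(C\<^sup>d)\<^sup>\<otimes>\<^sup>n\<close>.\<close>

lemma commutant_in_alg:
  fixes A :: "word \<Rightarrow> word \<Rightarrow> real"
  assumes d: "0 < d"
    and comm: "\<And>X w u. perm_invariant n X \<Longrightarrow> w \<in> words d d n \<Longrightarrow> u \<in> words d d n \<Longrightarrow>
      (\<Sum>v\<in>words d d n. A w v * X v u) = (\<Sum>v\<in>words d d n. X w v * A v u)"
  obtains Y where "Y \<in> perm_alg n"
    "\<And>y u. y \<in> words d d n \<Longrightarrow> u \<in> words d d n \<Longrightarrow> A y u = app Y (ind u) y"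
proof
  let ?W = "words d d n" and ?P = "{p. p permutes {..<n}}"
  define a where "a p = (\<Sum>x\<in>?W. A x (x \<circ> p))" for p
  define Z where "Z = (\<Sum>p\<in>?P. a p *\<^sub>R perm_op p)"
  \<comment> \<open>With 1 / 0 = 0 this is a pseudo-inverse of \<open>hprod d n\<close>. The
    projections where \<open>hval d n g\<close> is 0 vanish on the words over d letters, so there it
    is an inverse.\<close>
  define R where "R = fop (\<lambda>g. 1 / hval d n g)"
  define cut where "cut u v = (if v \<in> ?W then A v u else 0)" for u v
  have hprod: "real d ^ n * app (hprod d n) f y = (\<Sum>p\<in>?P. real (fixc d d n p) * f (y \<circ> p))" for f y
    unfolding app_simps(7)[symmetric] hprod_eq[OF d, of n d] by (simp add: app_sum_left)
  \<comment> \<open>Take the commutation of A with \<open>orbit_matrix n x y\<close> at the entry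
    (x, u) and sum over x. On one side the pairs with x = x o p count fixed words and yield
    \<open>hprod d n\<close>; on the other the sum over x yields the coefficients
    \<open>a p\<close>.\<close>
  have key: "real d ^ n * app (hprod d n) (cut u) y = app Z (ind u) y" if u: "u \<in> ?W" for u y
  proof (cases "y \<in> ?W")
    case True
    have yp: "y \<circ> p \<in> ?W" if "p \<in> ?P" for p using words_comp[OF True] that by simp
    have xp: "x \<circ> p \<in> ?W" if "p \<in> ?P" "x \<in> ?W" for p x using words_comp that by simp
    have "real d ^ n * app (hprod d n) (cut u) y = (\<Sum>p\<in>?P. real (fixc d d n p) * A (y \<circ> p) u)"
      unfolding hprod by (rule sum.cong) (auto simp: cut_def yp)
    also have "\<dots> = (\<Sum>p\<in>?P. \<Sum>x\<in>?W. ind (x \<circ> p) x * A (y \<circ> p) u)"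
    proof (rule sum.cong)
      fix p
      have "real (fixc d d n p) = (\<Sum>x\<in>?W. ind (x \<circ> p) x)"
        unfolding fixc_def ind_def by (simp add: sum.inter_filter[symmetric] finite_words eq_commute[of "_ \<circ> p"])
      then show "real (fixc d d n p) * A (y \<circ> p) u = (\<Sum>x\<in>?W. ind (x \<circ> p) x * A (y \<circ> p) u)"
        by (simp add: sum_distrib_right)
    qed simp
    also have "\<dots> = (\<Sum>x\<in>?W. \<Sum>p\<in>?P. ind (x \<circ> p) x * A (y \<circ> p) u)" by (rule sum.swap)
    also have "\<dots> = (\<Sum>x\<in>?W. \<Sum>v\<in>?W. orbit_matrix n x y x v * A v u)"
    proof (rule sum.cong)
      fix x
      have "(\<Sum>v\<in>?W. orbit_matrix n x y x v * A v u)
          = (\<Sum>p\<in>?P. \<Sum>v\<in>?W. (ind (x \<circ> p) x * A v u) * ind (y \<circ> p) v)"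
        unfolding orbit_matrix_def sum_distrib_right by (subst sum.swap) (simp add: mult_ac)
      also have "\<dots> = (\<Sum>p\<in>?P. ind (x \<circ> p) x * A (y \<circ> p) u)"
        by (intro sum.cong refl sum_ind yp)
      finally show "(\<Sum>p\<in>?P. ind (x \<circ> p) x * A (y \<circ> p) u) = (\<Sum>v\<in>?W. orbit_matrix n x y x v * A v u)" ..
    qed simp
    also have "\<dots> = (\<Sum>x\<in>?W. \<Sum>v\<in>?W. A x v * orbit_matrix n x y v u)"
      by (intro sum.cong refl comm[symmetric] orbit_matrix_invariant u)
    also have "\<dots> = (\<Sum>x\<in>?W. \<Sum>p\<in>?P. A x (x \<circ> p) * ind (y \<circ> p) u)"
    proof (rule sum.cong)
      fix x assume x: "x \<in> ?W"
      have "(\<Sum>v\<in>?W. A x v * orbit_matrix n x y v u)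
          = (\<Sum>p\<in>?P. \<Sum>v\<in>?W. (A x v * ind (y \<circ> p) u) * ind (x \<circ> p) v)"
        unfolding orbit_matrix_def sum_distrib_left by (subst sum.swap) (simp add: mult_ac)
      also have "\<dots> = (\<Sum>p\<in>?P. A x (x \<circ> p) * ind (y \<circ> p) u)"
        by (intro sum.cong refl sum_ind xp x)
      finally show "(\<Sum>v\<in>?W. A x v * orbit_matrix n x y v u) = (\<Sum>p\<in>?P. A x (x \<circ> p) * ind (y \<circ> p) u)" .
    qed simp
    also have "\<dots> = (\<Sum>p\<in>?P. a p * ind (y \<circ> p) u)"
      by (subst sum.swap) (simp add: a_def sum_distrib_right)
    also have "\<dots> = app Z (ind u) y"
      unfolding Z_def app_sum_left by (rule sum.cong) (auto simp: ind_def)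
    finally show ?thesis .
  next
    case False
    have "app (hprod d n) (cut u) y = 0"
      by (rule app_outside[OF hprod_in[OF order_refl] _ False]) (simp add: cut_def)
    moreover have "app Z (ind u) y = 0"
      unfolding Z_def
      by (rule app_outside[OF _ _ False]) (use u in \<open>auto simp: ind_def intro!: perm_alg_closed perm_op_in\<close>)
    ultimately show ?thesis by simp
  qed
  have inv: "app (R * hprod d n) (cut u) y = cut u y" if y: "y \<in> ?W" for u y
  proof -
    have "R * hprod d n = fop (\<lambda>g. 1 / hval d n g * hval d n g)"
      unfolding R_def hprod_fop by (rule fop_mult)
    moreover have "1 = fop (\<lambda>g. 1)" by (rule eq_fop) simp
    ultimately have e: "1 - R * hprod d n = (\<Sum>g\<in>\<Gamma> n. (1 - 1 / hval d n g * hval d n g) *\<^sub>R E n g)"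
      by (simp only: fop_def sum_subtractf scaleR_diff_left)
    have "cut u y - app (R * hprod d n) (cut u) y = app (1 - R * hprod d n) (cut u) y"
      by (simp only: app_simps(2,4))
    also have "\<dots> = (\<Sum>g\<in>\<Gamma> n. (1 - 1 / hval d n g * hval d n g) * app (E n g) (cut u) y)"
      unfolding e by (simp only: app_sum_left app_simps(7))
    also have "\<dots> = 0"
    proof (intro sum.neutral ballI)
      fix g assume g: "g \<in> \<Gamma> n"
      show "(1 - 1 / hval d n g * hval d n g) * app (E n g) (cut u) y = 0"
      proof (cases "hval d n g = 0")
        case True
        have "app (E n g) (cut u) y = (\<Sum>v\<in>?W. cut u v * app (E n g) (ind v) y)"
          by (subst app_words_expand[of d n "cut u"]) (auto simp: cut_def)
        also have "\<dots> = 0"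
          using E_zero_words[OF d g _ _ y] True by (intro sum.neutral) simp
        finally show ?thesis by simp
      qed simp
    qed
    finally show ?thesis by simp
  qed
  show "(1 / real d ^ n) *\<^sub>R (R * Z) \<in> perm_alg n"
    unfolding R_def Z_def by (intro perm_alg_closed mult_in fop_in perm_op_in) auto
  fix y u assume yu: "y \<in> ?W" "u \<in> ?W"
  have "app Z (ind u) = app (real d ^ n *\<^sub>R hprod d n) (cut u)"
    using key[OF yu(2)] by (intro ext) simp
  then have "app (R * Z) (ind u) y = app (R * (real d ^ n *\<^sub>R hprod d n)) (cut u) y"
    by (simp only: app_simps(6))
  also have "\<dots> = real d ^ n * app (R * hprod d n) (cut u) y"
    by (simp only: mult_scaleR_right app_simps(7))
  also have "\<dots> = real d ^ n * A y u" using inv[OF yu(1)] yu(1) by (simp only: cut_def if_True)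
  finally show "A y u = app ((1 / real d ^ n) *\<^sub>R (R * Z)) (ind u) y"
    using d by simp
qed

text \<open>The operator \<open>broot d k\<close> is the square root of the average of \<open>(U P\<^sub>k U\<^sup>*)\<^sup>\<otimes>\<^sup>n\<close>, up to scaling.\<close>

definition broot :: "nat \<Rightarrow> nat \<Rightarrow> word lop" where
  "broot d k = fop (\<lambda>g. sqrt (hval k n g / hval d n g))"

text \<open>Both \<open>hprod k n\<close> and \<open>hprod d n\<close> are central and
  \<open>broot\<close> is a function of their eigenvalues, whatever values occur off the
  support.\<close>

lemma broot_central:
  assumes "0 < k" "0 < d" "p permutes {..<n}"
  shows "perm_op p * broot d k = broot d k * perm_op p"
  unfolding broot_def
  by (rule fop_commute_fun[where F = "hval k n" and F' = "hval d n" and f = "\<lambda>a b. sqrt (a / b)"])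
     (use hprod_central[OF assms(1,3)] hprod_central[OF assms(2,3)] in \<open>simp_all add: hprod_fop\<close>)

lemma broot_invariant:
  assumes "0 < k" "0 < d"
  shows "perm_invariant n (\<lambda>w v. app (broot d k) (ind v) w)"
  unfolding perm_invariant_def
proof (intro allI impI)
  fix p w v assume p: "p permutes {..<n}"
  have "app (broot d k) (ind (v \<circ> p)) (w \<circ> p) = app (perm_op p * broot d k) (ind (v \<circ> p)) w" by simp
  also have "\<dots> = app (broot d k * perm_op p) (ind (v \<circ> p)) w"
    by (simp only: broot_central[OF assms p])
  also have "\<dots> = app (broot d k) (\<lambda>w. ind (v \<circ> p) (w \<circ> p)) w" by (simp add: app_perm_op[abs_def])
  also have "(\<lambda>w. ind (v \<circ> p) (w \<circ> p)) = ind v" by (rule ext) (simp add: ind_def comp_perm_cancel[OF p])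
  finally show "app (broot d k) (ind (v \<circ> p)) (w \<circ> p) = app (broot d k) (ind v) w" .
qed

section \<open>The purified averaged states and their overlap\<close>

lemma tau_fop_null:
  assumes "Y \<in> perm_alg n" "\<And>g. g \<in> \<Gamma> n \<Longrightarrow> F g * mu d g = 0"
  shows "tau d (Y * fop F) = 0"
  using assms(1)
proof (induction Y rule: perm_alg_induct)
  case subspace
  then show ?case by (auto simp: subspace_def algebra_simps)
next
  case (perm p)
  have "F g * tau d (perm_op p * E n g) = 0" if "g \<in> \<Gamma> n" for g
    using assms(2)[OF that] tau_perm_E_zero[OF _ that perm] by auto
  then have "(\<Sum>g\<in>\<Gamma> n. F g * tau d (perm_op p * E n g)) = 0" by (rule sum.neutral[OF ballI])
  then show ?case by (simp add: fop_def sum_distrib_left tau_sum)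
qed

lemma hprod_commute:
  assumes "0 < s" "Y \<in> perm_alg n"
  shows "hprod s n * Y = Y * hprod s n"
  using assms(2)
proof (induction Y rule: perm_alg_induct)
  case subspace
  then show ?case by (auto simp: subspace_def algebra_simps)
qed (simp add: hprod_central assms(1))

lemma hval_pos:
  assumes "0 < d" "g \<in> \<Gamma> n" "hval d n g * mu d g \<noteq> 0"
  shows "0 < hval d n g"
  using hval_nonneg[OF assms(1) order_refl order_refl assms(2)] assms(3) by (auto simp: less_le)

text \<open>The square of \<open>broot\<close> reweights the d-letter trace to the k-letter trace.
  Off the support of the d-letter measure the quotient is meaningless, but by
  \<open>hval_mu_zero\<close> both sides are null there.\<close>

lemma om_transfer:
  assumes k: "0 < k" "k \<le> d" and Y: "Y \<in> perm_alg n"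
  shows "om d k n Y = om d d n (Y * (broot d k * broot d k))"
proof -
  have d: "0 < d" using k by simp
  let ?b = "\<lambda>g. sqrt (hval k n g / hval d n g)"
  have "om d d n (Y * (broot d k * broot d k)) = tau d (hprod d n * (Y * (broot d k * broot d k)))"
    using d Y by (intro om_eq_tau) (auto simp: broot_def intro!: mult_in fop_in)
  also have "hprod d n * (Y * (broot d k * broot d k)) = Y * fop (\<lambda>g. hval d n g * (?b g * ?b g))"
    unfolding mult.assoc[symmetric] hprod_commute[OF d Y]
    by (simp add: mult.assoc hprod_fop broot_def fop_mult)
  also have "tau d (Y * fop (\<lambda>g. hval d n g * (?b g * ?b g))) - tau d (Y * fop (hval k n))
      = tau d (Y * fop (\<lambda>g. hval d n g * (?b g * ?b g) - hval k n g))"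
    unfolding tau_linear(2)[symmetric] right_diff_distrib[symmetric]
    by (simp add: fop_def sum_subtractf scaleR_diff_left)
  moreover have "tau d (Y * fop (\<lambda>g. hval d n g * (?b g * ?b g) - hval k n g)) = 0"
  proof (rule tau_fop_null[OF Y])
    fix g assume g: "g \<in> \<Gamma> n"
    show "(hval d n g * (?b g * ?b g) - hval k n g) * mu d g = 0"
    proof (cases "hval d n g * mu d g = 0")
      case True
      then show ?thesis using hval_mu_zero[OF k g True] by (auto simp: left_diff_distrib)
    next
      case False
      then have "0 < hval d n g" "0 \<le> hval k n g"
        using hval_pos[OF d g] hval_nonneg[OF k order_refl g] by auto
      then show ?thesis by simp
    qed
  qed
  ultimately have "om d d n (Y * (broot d k * broot d k)) = tau d (Y * hprod k n)"
    by (simp add: hprod_fop)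
  also have "\<dots> = om d k n Y"
    using om_eq_tau[OF k order_refl Y] hprod_commute[OF k(1) Y] by simp
  finally show ?thesis ..
qed

text \<open>\<open>broot d k\<close> read as a vector on two copies of the word space: the canonical
  purification of the averaged state. It is real and normalised.\<close>

definition psi :: "nat \<Rightarrow> nat \<Rightarrow> word \<Rightarrow> word \<Rightarrow> real" where
  "psi d k w v = app (broot d k) (ind v) w / sqrt (real d ^ n)"

lemma app_mult_words:
  assumes "Y \<in> perm_alg n" "u \<in> words d d n"
  shows "app (X * Y) (ind u) w = (\<Sum>v\<in>words d d n. app X (ind v) w * app Y (ind u) v)"
proof -
  have "app X (app Y (ind u)) = (\<lambda>w. \<Sum>v\<in>words d d n. app Y (ind u) v * app X (ind v) w)"
    by (rule app_words_expand, rule app_outside[OF assms(1)]) (use assms(2) in \<open>auto simp: ind_def\<close>)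
  then show ?thesis by (simp add: mult.commute)
qed

lemma symop_entry:
  assumes "symop n X" "u \<in> words d d n" "w \<in> words d d n"
  shows "app X (ind u) w = app X (ind w) u"
  using symopD[OF assms(1) closed_words_words[of n d d], of "ind u" "ind w"]
    sum_ind[OF assms(3), of "app X (ind u)"] sum_ind[OF assms(2), of "app X (ind w)"]
  by (simp add: mult.commute)

lemma psi_sym: "w \<in> words d d n \<Longrightarrow> v \<in> words d d n \<Longrightarrow> psi d k w v = psi d k v w"
  unfolding psi_def broot_def by (simp add: symop_entry[OF symop_fop, of w d v])

text \<open>The overlap is a trace of a product of two roots; the weight \<open>hval d n g\<close>
  contributed by the trace cancels their denominators, which leaves the affinity.\<close>

lemma psi_inner:
  assumes "0 < k" "k \<le> d" "0 < l" "l \<le> d"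
  shows "(\<Sum>w\<in>words d d n. \<Sum>v\<in>words d d n. psi d k w v * psi d l w v)
    = (\<Sum>g\<in>\<Gamma> n. sqrt (hval k n g * hval l n g) * mu d g)"
proof -
  have d: "0 < d" using assms by simp
  let ?W = "words d d n"
  have "(\<Sum>w\<in>?W. \<Sum>v\<in>?W. psi d k w v * psi d l w v) = (\<Sum>w\<in>?W. \<Sum>v\<in>?W. psi d k w v * psi d l v w)"
    by (intro sum.cong refl arg_cong2[of _ _ _ _ "(*)"] psi_sym)
  also have "\<dots> = om d d n (broot d k * broot d l)"
    unfolding om_def sum_divide_distrib psi_def
    by (intro sum.cong refl, subst app_mult_words[of _ _ d])
       (auto simp: broot_def fop_in sum_divide_distrib)
  also have "\<dots> = tau d (hprod d n * (broot d k * broot d l))"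
    using d by (intro om_eq_tau) (auto simp: broot_def intro!: mult_in fop_in)
  also have "\<dots> = (\<Sum>g\<in>\<Gamma> n. hval d n g * (sqrt (hval k n g / hval d n g) * sqrt (hval l n g / hval d n g)) * mu d g)"
    by (rule tau_eq_sum) (simp add: broot_def hprod_fop fop_mult fop_E)
  also have "\<dots> = (\<Sum>g\<in>\<Gamma> n. sqrt (hval k n g * hval l n g) * mu d g)"
  proof (rule sum.cong)
    fix g assume g: "g \<in> \<Gamma> n"
    show "hval d n g * (sqrt (hval k n g / hval d n g) * sqrt (hval l n g / hval d n g)) * mu d g
        = sqrt (hval k n g * hval l n g) * mu d g"
    proof (cases "hval d n g * mu d g = 0")
      case True
      then show ?thesis using hval_mu_zero[OF assms(1,2) g True] by auto
    next
      case False
      then have "0 < hval d n g" using hval_pos[OF d g] by auto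
      then show ?thesis by (simp add: real_sqrt_divide real_sqrt_mult)
    qed
  qed simp
  finally show ?thesis .
qed

text \<open>Let \<Omega> be the sum of all |w, w>. The left side is the k-letter trace of Q
  \<Omega>, read as a matrix. That matrix lies in the group algebra, so \<open>om_transfer\<close>
  turns the trace into a d-letter trace with \<open>broot\<close> twice; one \<open>broot\<close>
  stays outside as the left vector and invariance moves the other through Q onto \<Omega>.\<close>

theorem twirled_value:
  fixes Q :: "word \<Rightarrow> word \<Rightarrow> word \<Rightarrow> word \<Rightarrow> real" and d :: nat
  defines "W \<equiv> words d d n"
  assumes k: "0 < k" "k \<le> d" and inv: "bi_invariant n W Q"
  shows "(\<Sum>w\<in>words d k n. \<Sum>v\<in>words d k n. Q w w v v) / real k ^ n = quad W Q (psi d k)"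
proof -
  have d: "0 < d" using k by simp
  note left = bi_invariantD(1)[OF inv] and right = bi_invariantD(2)[OF inv]
  have finW: "finite W" unfolding W_def by (rule finite_words)
  \<comment> \<open>X on the first factor and the transpose of X on the second agree on \<Omega>, so
    invariance on both factors makes A commute with X.\<close>
  define A where "A w v = (\<Sum>u\<in>W. Q w v u u)" for w v
  have comm: "(\<Sum>v\<in>W. A w v * X v u) = (\<Sum>v\<in>W. X w v * A v u)"
    if X: "perm_invariant n X" and wu: "w \<in> W" "u \<in> W" for X w u
  proof -
    have Xt: "perm_invariant n (\<lambda>a b. X b a)" using X by (simp add: perm_invariant_def)
    have "(\<Sum>v\<in>W. X w v * A v u) = (\<Sum>t\<in>W. \<Sum>v\<in>W. X w v * Q v u t t)"
      unfolding A_def sum_distrib_left by (rule sum.swap)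
    also have "\<dots> = (\<Sum>t\<in>W. \<Sum>v\<in>W. Q w u v t * X v t)"
      by (intro sum.cong refl left X wu)
    also have "\<dots> = (\<Sum>v\<in>W. \<Sum>t\<in>W. Q w u v t * X v t)" by (rule sum.swap)
    also have "\<dots> = (\<Sum>v\<in>W. \<Sum>t\<in>W. X t u * Q w t v v)"
      by (intro sum.cong refl right[OF Xt, symmetric] wu)
    also have "\<dots> = (\<Sum>t\<in>W. A w t * X t u)"
      unfolding A_def sum_distrib_right by (subst sum.swap) (simp add: mult.commute)
    finally show ?thesis ..
  qed
  obtain Y where Y: "Y \<in> perm_alg n" "\<And>y u. y \<in> W \<Longrightarrow> u \<in> W \<Longrightarrow> A y u = app Y (ind u) y"
    using commutant_in_alg[OF d comm[unfolded W_def]] unfolding W_def by blast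
  have sub: "words d k n \<subseteq> W" unfolding W_def by (rule words_mono[OF k(2)])
  \<comment> \<open>The projection onto words over k letters is permutation-invariant, so Q has no
    entries between |w, w> inside and |v, v> outside its range.\<close>
  have diag: "(\<Sum>v\<in>words d k n. Q w w v v) = A w w" if w: "w \<in> words d k n" for w
  proof -
    define P where "P a b = (if a = b \<and> a \<in> words d k n then 1 else 0 :: real)" for a b
    have P: "perm_invariant n P"
      by (auto simp: perm_invariant_def P_def comp_perm_cancel words_comp_iff)
    have "Q w w v v = 0" if v: "v \<in> W - words d k n" for v
    proof -
      have "(\<Sum>u\<in>W. P w u * Q u w v v) = (\<Sum>u\<in>W. Q w w u v * P u v)"
        using w v sub by (intro left P) auto
      moreover have "(\<Sum>u\<in>W. P w u * Q u w v v) = (\<Sum>u\<in>W. if u = w then Q w w v v else 0)"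
        using w by (intro sum.cong refl) (auto simp: P_def)
      moreover have "(\<Sum>u\<in>W. Q w w u v * P u v) = 0"
        using v by (intro sum.neutral) (auto simp: P_def)
      ultimately show ?thesis using w sub finW by auto
    qed
    then show ?thesis unfolding A_def by (intro sum.mono_neutral_left finW sub) auto
  qed
  let ?B = "\<lambda>w v. app (broot d k) (ind v) w"
  have B: "perm_invariant n ?B" by (rule broot_invariant[OF k(1) d])
  have Bsym: "?B w v = ?B v w" if "w \<in> W" "v \<in> W" for w v
    using that unfolding broot_def W_def by (intro symop_entry[OF symop_fop])
  have "(\<Sum>w\<in>words d k n. \<Sum>v\<in>words d k n. Q w w v v) / real k ^ n = (\<Sum>w\<in>words d k n. app Y (ind w) w) / real k ^ n"
    using sub by (intro arg_cong2[of _ _ _ _ "(/)"] sum.cong refl) (auto simp: diag Y(2))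
  also have "\<dots> = om d d n (Y * (broot d k * broot d k))"
    unfolding om_def[symmetric] by (rule om_transfer[OF k Y(1)])
  also have "\<dots> = (\<Sum>u\<in>W. \<Sum>v\<in>W. \<Sum>w\<in>W. A u v * (?B v w * ?B w u)) / real d ^ n"
  proof -
    have "app (Y * (broot d k * broot d k)) (ind u) u = (\<Sum>v\<in>W. \<Sum>w\<in>W. A u v * (?B v w * ?B w u))"
      if u: "u \<in> W" for u
    proof -
      have "broot d k * broot d k \<in> perm_alg n" "broot d k \<in> perm_alg n"
        by (auto simp: broot_def intro!: mult_in fop_in)
      then show ?thesis
        using u Y(2)[OF u] unfolding W_def
        by (subst app_mult_words[of _ _ d]) (auto simp: app_mult_words[of "broot d k" u d] sum_distrib_left
            simp del: app_simps(6) intro!: sum.cong)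
    qed
    then show ?thesis by (simp add: om_def W_def[symmetric] del: app_simps(6))
  qed
  also have "(\<Sum>u\<in>W. \<Sum>v\<in>W. \<Sum>w\<in>W. A u v * (?B v w * ?B w u))
      = (\<Sum>w\<in>W. \<Sum>v\<in>W. \<Sum>u\<in>W. ?B w v * (?B w u * A u v))"
  proof -
    have "(\<Sum>u\<in>W. \<Sum>v\<in>W. \<Sum>w\<in>W. A u v * (?B v w * ?B w u))
        = (\<Sum>u\<in>W. \<Sum>v\<in>W. \<Sum>w\<in>W. ?B w v * (?B w u * A u v))"
      by (intro sum.cong refl) (simp add: Bsym mult_ac)
    also have "\<dots> = (\<Sum>u\<in>W. \<Sum>w\<in>W. \<Sum>v\<in>W. ?B w v * (?B w u * A u v))"
      by (intro sum.cong refl sum.swap)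
    also have "\<dots> = (\<Sum>w\<in>W. \<Sum>u\<in>W. \<Sum>v\<in>W. ?B w v * (?B w u * A u v))" by (rule sum.swap)
    also have "\<dots> = (\<Sum>w\<in>W. \<Sum>v\<in>W. \<Sum>u\<in>W. ?B w v * (?B w u * A u v))"
      by (intro sum.cong refl sum.swap)
    finally show ?thesis .
  qed
  also have "\<dots> = (\<Sum>w\<in>W. \<Sum>v\<in>W. ?B w v * (\<Sum>x\<in>W. \<Sum>t\<in>W. Q w v x t * ?B x t))"
  proof (intro sum.cong refl)
    fix w v assume wv: "w \<in> W" "v \<in> W"
    have "(\<Sum>u\<in>W. ?B w u * A u v) = (\<Sum>t\<in>W. \<Sum>u\<in>W. ?B w u * Q u v t t)"
      unfolding A_def sum_distrib_left by (rule sum.swap)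
    also have "\<dots> = (\<Sum>t\<in>W. \<Sum>u\<in>W. Q w v u t * ?B u t)"
      by (intro sum.cong refl left[OF B] wv)
    also have "\<dots> = (\<Sum>x\<in>W. \<Sum>t\<in>W. Q w v x t * ?B x t)" by (rule sum.swap)
    finally show "(\<Sum>u\<in>W. ?B w v * (?B w u * A u v)) = ?B w v * (\<Sum>x\<in>W. \<Sum>t\<in>W. Q w v x t * ?B x t)"
      unfolding sum_distrib_left[symmetric] by (rule arg_cong)
  qed
  also have "\<dots> / real d ^ n = quad W Q (psi d k)"
    unfolding quad_def psi_def sum_divide_distrib sum_distrib_left
    by (intro sum.cong refl) simp
  finally show ?thesis .
qed

end

section \<open>Invariant testers\<close>

text \<open>In place of a Haar average, invariance is obtained from uniqueness: a convex closed set has a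
  single element of least norm, which is therefore fixed by every isometry preserving the set.\<close>

lemma parallelogram_mean:
  fixes f g :: "'a \<Rightarrow> complex"
  shows "(\<Sum>x\<in>I. (cmod (f x - g x))\<^sup>2)
    = 2 * (\<Sum>x\<in>I. (cmod (f x))\<^sup>2) + 2 * (\<Sum>x\<in>I. (cmod (g x))\<^sup>2) - 4 * (\<Sum>x\<in>I. (cmod ((f x + g x) / 2))\<^sup>2)"
proof -
  have "(cmod (f x - g x))\<^sup>2 = 2 * (cmod (f x))\<^sup>2 + 2 * (cmod (g x))\<^sup>2 - 4 * (cmod ((f x + g x) / 2))\<^sup>2" for x
    by (simp only: cmod_power2) (simp add: power2_eq_square field_simps)
  then show ?thesis by (simp add: sum.distrib sum_subtractf sum_distrib_left)
qed

text \<open>By the parallelogram law a minimising sequence is Cauchy in each coordinate, and two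
  minimisers agree on I. Midpoints and pointwise sequential limits are all that is asked of
  K.\<close>

lemma least_norm_exists:
  fixes K :: "('a \<Rightarrow> complex) set"
  assumes fin: "finite I" and ne: "K \<noteq> {}"
    and mean: "\<And>f g. f \<in> K \<Longrightarrow> g \<in> K \<Longrightarrow> (\<lambda>x. (f x + g x) / 2) \<in> K"
    and closed: "\<And>F f. (\<And>n. F n \<in> K) \<Longrightarrow> (\<And>x. x \<in> I \<Longrightarrow> (\<lambda>n::nat. F n x) \<longlonglongrightarrow> f x) \<Longrightarrow> f \<in> K"
  obtains f where "f \<in> K"
    "\<And>g x. g \<in> K \<Longrightarrow> (\<Sum>x\<in>I. (cmod (g x))\<^sup>2) = (\<Sum>x\<in>I. (cmod (f x))\<^sup>2) \<Longrightarrow> x \<in> I \<Longrightarrow> g x = f x"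
proof -
  define nrm where "nrm f = (\<Sum>x\<in>I. (cmod (f x))\<^sup>2)" for f :: "'a \<Rightarrow> complex"
  define m where "m = Inf (nrm ` K)"
  have bdd: "bdd_below (nrm ` K)"
    by (rule bdd_belowI2[where m = 0]) (simp add: nrm_def sum_nonneg)
  have m_le: "m \<le> nrm f" if "f \<in> K" for f
    unfolding m_def using bdd that by (intro cInf_lower) auto
  have dist: "(\<Sum>x\<in>I. (cmod (f x - g x))\<^sup>2) \<le> 2 * nrm f + 2 * nrm g - 4 * m" if "f \<in> K" "g \<in> K" for f g
    using parallelogram_mean[of f g I] m_le[OF mean[OF that]] by (simp add: nrm_def)
  have "\<exists>f\<in>K. nrm f < m + 1 / real (Suc n)" for n
  proof -
    have "Inf (nrm ` K) < m + 1 / real (Suc n)" by (simp add: m_def)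
    then show ?thesis using ne bdd by (subst (asm) cInf_less_iff) auto
  qed
  then obtain F where F: "\<And>n. F n \<in> K" "\<And>n. nrm (F n) < m + 1 / real (Suc n)" by metis
  have cauchy: "Cauchy (\<lambda>n. F n x)" if x: "x \<in> I" for x
  proof (rule metric_CauchyI)
    fix e :: real assume e: "0 < e"
    obtain M where M: "4 / e\<^sup>2 < real M" using reals_Archimedean2 by blast
    have "dist (F i x) (F j x) < e" if ij: "i \<ge> M" "j \<ge> M" for i j
    proof -
      have "(cmod (F i x - F j x))\<^sup>2 \<le> (\<Sum>x\<in>I. (cmod (F i x - F j x))\<^sup>2)"
        using x fin by (intro member_le_sum) auto
      also have "\<dots> \<le> 2 * nrm (F i) + 2 * nrm (F j) - 4 * m" by (intro dist F)
      also have "\<dots> < 2 / real (Suc i) + 2 / real (Suc j)" using F(2)[of i] F(2)[of j] by simp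
      also have "\<dots> \<le> 2 / real (Suc M) + 2 / real (Suc M)"
        using ij by (intro add_mono divide_left_mono) auto
      also have "\<dots> < e\<^sup>2"
      proof -
        have "4 < e\<^sup>2 * real M" using M e by (simp add: divide_less_eq mult.commute)
        then have "4 < e\<^sup>2 * real (Suc M)" using e by (simp add: algebra_simps add_strict_increasing2)
        then show ?thesis by (simp add: divide_less_eq flip: add_divide_distrib)
      qed
      finally have "(cmod (F i x - F j x))\<^sup>2 < e\<^sup>2" .
      then show ?thesis using e by (simp add: dist_norm power_less_imp_less_base)
    qed
    then show "\<exists>M. \<forall>i\<ge>M. \<forall>j\<ge>M. dist (F i x) (F j x) < e" by blast
  qed
  define f where "f x = lim (\<lambda>n. F n x)" for x
  have lim: "(\<lambda>n. F n x) \<longlonglongrightarrow> f x" if "x \<in> I" for x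
    unfolding f_def using cauchy[OF that] by (simp add: Cauchy_convergent_iff convergent_LIMSEQ_iff)
  have fK: "f \<in> K" by (rule closed[OF F(1) lim])
  have "nrm f \<le> m"
  proof (rule LIMSEQ_le)
    show "(\<lambda>n. nrm (F n)) \<longlonglongrightarrow> nrm f"
      unfolding nrm_def by (intro tendsto_sum tendsto_power tendsto_norm lim)
    show "(\<lambda>n. m + 1 / real (Suc n)) \<longlonglongrightarrow> m"
      using tendsto_add[OF tendsto_const[of m] LIMSEQ_inverse_real_of_nat] by (simp add: inverse_eq_divide)
    show "\<exists>N. \<forall>n\<ge>N. nrm (F n) \<le> m + 1 / real (Suc n)" using F(2) less_imp_le by blast
  qed
  moreover have "g x = f x" if g: "g \<in> K" "nrm g = nrm f" "x \<in> I" for g x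
  proof -
    have "(\<Sum>x\<in>I. (cmod (g x - f x))\<^sup>2) \<le> 0" using dist[OF g(1) fK] g(2) \<open>nrm f \<le> m\<close> by simp
    then have "(\<Sum>x\<in>I. (cmod (g x - f x))\<^sup>2) = 0" by (simp add: sum_nonneg order_antisym)
    then show ?thesis using g(3) fin by (simp add: sum_nonneg_eq_0_iff)
  qed
  ultimately show ?thesis using fK that unfolding nrm_def by blast
qed

subsection \<open>Conjugation by unitaries\<close>

definition unitary_on :: "'a set \<Rightarrow> ('a \<Rightarrow> 'a \<Rightarrow> complex) \<Rightarrow> bool" where
  "unitary_on I V \<longleftrightarrow> (\<forall>x\<in>I. \<forall>y\<in>I. (\<Sum>a\<in>I. cnj (V a x) * V a y) = (if x = y then 1 else 0)
      \<and> (\<Sum>a\<in>I. V x a * cnj (V y a)) = (if x = y then 1 else 0))"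

lemma unitary_onD:
  assumes "unitary_on I V" "x \<in> I" "y \<in> I"
  shows "(\<Sum>a\<in>I. cnj (V a x) * V a y) = (if x = y then 1 else 0)"
    "(\<Sum>a\<in>I. V x a * cnj (V y a)) = (if x = y then 1 else 0)"
  using assms unfolding unitary_on_def by blast+

definition conj_by :: "'a set \<Rightarrow> ('a \<Rightarrow> 'a \<Rightarrow> complex) \<Rightarrow> ('a \<Rightarrow> 'a \<Rightarrow> complex) \<Rightarrow> 'a \<Rightarrow> 'a \<Rightarrow> complex" where
  "conj_by I V T x y = (\<Sum>a\<in>I. cnj (V a x) * (\<Sum>b\<in>I. T a b * V b y))"

lemma cmod_square: "complex_of_real ((cmod z)\<^sup>2) = z * cnj z"
  by (rule complex_norm_square)

lemma isometry_inner:
  fixes U :: "'a \<Rightarrow> 'a \<Rightarrow> complex"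
  assumes "finite I" and U: "\<And>a b. a \<in> I \<Longrightarrow> b \<in> I \<Longrightarrow> (\<Sum>x\<in>I. cnj (U x a) * U x b) = (if a = b then 1 else 0)"
  shows "(\<Sum>x\<in>I. cnj (\<Sum>a\<in>I. U x a * g a) * (\<Sum>b\<in>I. U x b * h b)) = (\<Sum>a\<in>I. cnj (g a) * h a)"
proof -
  have "(\<Sum>x\<in>I. cnj (\<Sum>a\<in>I. U x a * g a) * (\<Sum>b\<in>I. U x b * h b))
      = (\<Sum>x\<in>I. \<Sum>a\<in>I. \<Sum>b\<in>I. (cnj (g a) * h b) * (cnj (U x a) * U x b))"
    unfolding cnj_sum sum_product by (simp add: mult_ac)
  also have "\<dots> = (\<Sum>a\<in>I. \<Sum>x\<in>I. \<Sum>b\<in>I. (cnj (g a) * h b) * (cnj (U x a) * U x b))"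
    by (rule sum.swap)
  also have "\<dots> = (\<Sum>a\<in>I. \<Sum>b\<in>I. \<Sum>x\<in>I. (cnj (g a) * h b) * (cnj (U x a) * U x b))"
    by (rule sum.cong[OF refl], rule sum.swap)
  also have "\<dots> = (\<Sum>a\<in>I. \<Sum>b\<in>I. if b = a then cnj (g a) * h a else 0)"
    unfolding sum_distrib_left[symmetric] by (intro sum.cong refl) (auto simp: U)
  finally show ?thesis using assms(1) by simp
qed

lemma unitary_isometry:
  assumes "finite I" "unitary_on I V"
  shows "(\<Sum>x\<in>I. (cmod (\<Sum>a\<in>I. V x a * g a))\<^sup>2) = (\<Sum>a\<in>I. (cmod (g a))\<^sup>2)"
    and "(\<Sum>x\<in>I. (cmod (\<Sum>a\<in>I. cnj (V a x) * g a))\<^sup>2) = (\<Sum>a\<in>I. (cmod (g a))\<^sup>2)"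
proof -
  have gen: "(\<Sum>x\<in>I. (cmod (\<Sum>a\<in>I. U x a * g a))\<^sup>2) = (\<Sum>a\<in>I. (cmod (g a))\<^sup>2)"
    if U: "\<And>a b. a \<in> I \<Longrightarrow> b \<in> I \<Longrightarrow> (\<Sum>x\<in>I. cnj (U x a) * U x b) = (if a = b then 1 else 0)" for U
  proof -
    have "complex_of_real (\<Sum>x\<in>I. (cmod (\<Sum>a\<in>I. U x a * g a))\<^sup>2) = complex_of_real (\<Sum>a\<in>I. (cmod (g a))\<^sup>2)"
      unfolding of_real_sum cmod_square using isometry_inner[OF assms(1) U, of g g]
      by (simp only: mult.commute)
    then show ?thesis by (simp only: of_real_eq_iff)
  qed
  show "(\<Sum>x\<in>I. (cmod (\<Sum>a\<in>I. V x a * g a))\<^sup>2) = (\<Sum>a\<in>I. (cmod (g a))\<^sup>2)"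
    by (rule gen) (rule unitary_onD(1)[OF assms(2)])
  show "(\<Sum>x\<in>I. (cmod (\<Sum>a\<in>I. cnj (V a x) * g a))\<^sup>2) = (\<Sum>a\<in>I. (cmod (g a))\<^sup>2)"
    by (rule gen) (use unitary_onD(2)[OF assms(2)] in simp)
qed

text \<open>The isometry that lets uniqueness of the least-norm tester force its invariance.\<close>

lemma conj_by_norm:
  assumes "finite I" "unitary_on I V"
  shows "(\<Sum>(x, y)\<in>I \<times> I. (cmod (conj_by I V T x y))\<^sup>2) = (\<Sum>(x, y)\<in>I \<times> I. (cmod (T x y))\<^sup>2)"
proof -
  have row: "(\<Sum>y\<in>I. (cmod (\<Sum>b\<in>I. h b * V b y))\<^sup>2) = (\<Sum>b\<in>I. (cmod (h b))\<^sup>2)" for h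
  proof -
    have "cmod (\<Sum>b\<in>I. h b * V b y) = cmod (\<Sum>b\<in>I. cnj (V b y) * cnj (h b))" for y
      by (subst complex_mod_cnj[symmetric]) (simp add: mult.commute)
    then show ?thesis using unitary_isometry(2)[OF assms, of "\<lambda>b. cnj (h b)"] by simp
  qed
  have "(\<Sum>(x, y)\<in>I \<times> I. (cmod (conj_by I V T x y))\<^sup>2)
      = (\<Sum>y\<in>I. \<Sum>x\<in>I. (cmod (\<Sum>a\<in>I. cnj (V a x) * (\<Sum>b\<in>I. T a b * V b y)))\<^sup>2)"
    unfolding sum.cartesian_product[symmetric] conj_by_def by (rule sum.swap)
  also have "\<dots> = (\<Sum>a\<in>I. \<Sum>y\<in>I. (cmod (\<Sum>b\<in>I. T a b * V b y))\<^sup>2)"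
    unfolding unitary_isometry(2)[OF assms] by (rule sum.swap)
  also have "\<dots> = (\<Sum>(x, y)\<in>I \<times> I. (cmod (T x y))\<^sup>2)"
    unfolding row sum.cartesian_product ..
  finally show ?thesis .
qed

lemma qform_conj_by:
  "qform I (conj_by I V T) v = qform I T (\<lambda>a. \<Sum>y\<in>I. V a y * v y)"
proof -
  have "qform I (conj_by I V T) v
      = (\<Sum>x\<in>I. \<Sum>y\<in>I. \<Sum>a\<in>I. \<Sum>b\<in>I. cnj (V a x * v x) * T a b * (V b y * v y))"
    unfolding qform_def conj_by_def by (simp add: sum_distrib_left sum_distrib_right mult_ac)
  also have "\<dots> = (\<Sum>x\<in>I. \<Sum>a\<in>I. \<Sum>y\<in>I. \<Sum>b\<in>I. cnj (V a x * v x) * T a b * (V b y * v y))"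
    by (rule sum.cong[OF refl], rule sum.swap)
  also have "\<dots> = (\<Sum>a\<in>I. \<Sum>x\<in>I. \<Sum>y\<in>I. \<Sum>b\<in>I. cnj (V a x * v x) * T a b * (V b y * v y))"
    by (rule sum.swap)
  also have "\<dots> = (\<Sum>a\<in>I. \<Sum>x\<in>I. \<Sum>b\<in>I. \<Sum>y\<in>I. cnj (V a x * v x) * T a b * (V b y * v y))"
    by (rule sum.cong[OF refl], rule sum.cong[OF refl], rule sum.swap)
  also have "\<dots> = (\<Sum>a\<in>I. \<Sum>b\<in>I. \<Sum>x\<in>I. \<Sum>y\<in>I. cnj (V a x * v x) * T a b * (V b y * v y))"
    by (rule sum.cong[OF refl], rule sum.swap)
  also have "\<dots> = qform I T (\<lambda>a. \<Sum>y\<in>I. V a y * v y)"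
    unfolding qform_def
  proof (intro sum.cong refl)
    fix a b
    have "cnj (\<Sum>y\<in>I. V a y * v y) * T a b * (\<Sum>y\<in>I. V b y * v y)
        = T a b * ((\<Sum>x\<in>I. cnj (V a x * v x)) * (\<Sum>y\<in>I. V b y * v y))" by simp
    also have "\<dots> = (\<Sum>x\<in>I. \<Sum>y\<in>I. cnj (V a x * v x) * T a b * (V b y * v y))"
      unfolding sum_product unfolding sum_distrib_left
      by (intro sum.cong refl) (simp only: mult_ac)
    finally show "(\<Sum>x\<in>I. \<Sum>y\<in>I. cnj (V a x * v x) * T a b * (V b y * v y))
        = cnj (\<Sum>y\<in>I. V a y * v y) * T a b * (\<Sum>y\<in>I. V b y * v y)" ..
  qed
  finally show ?thesis .
qed

lemma conj_by_fixed_commute: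
  assumes "finite I" "unitary_on I V" "\<And>x y. x \<in> I \<Longrightarrow> y \<in> I \<Longrightarrow> conj_by I V T x y = T x y"
    and "x \<in> I" "y \<in> I"
  shows "(\<Sum>a\<in>I. V x a * T a y) = (\<Sum>b\<in>I. T x b * V b y)"
proof -
  have "(\<Sum>a\<in>I. V x a * T a y) = (\<Sum>a\<in>I. V x a * conj_by I V T a y)"
    using assms by (intro sum.cong refl) auto
  also have "\<dots> = (\<Sum>c\<in>I. \<Sum>a\<in>I. V x a * cnj (V c a) * (\<Sum>b\<in>I. T c b * V b y))"
    unfolding conj_by_def sum_distrib_left by (subst sum.swap) (simp add: mult_ac)
  also have "\<dots> = (\<Sum>c\<in>I. if c = x then (\<Sum>b\<in>I. T x b * V b y) else 0)"
    unfolding sum_distrib_right[symmetric]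
    using assms(2,4) by (intro sum.cong refl) (auto simp: unitary_on_def)
  finally show ?thesis using assms(1,4) by simp
qed

subsection \<open>Tensor powers\<close>

lemma sum_copy_indices_Suc:
  "(\<Sum>x\<in>copy_indices d (Suc n). f x) = (\<Sum>p\<in>{..<d} \<times> {..<d}. \<Sum>xs\<in>copy_indices d n. f (p # xs))"
proof -
  have "(\<Sum>x\<in>copy_indices d (Suc n). f x) = (\<Sum>(p, xs)\<in>({..<d} \<times> {..<d}) \<times> copy_indices d n. f (p # xs))"
    by (rule sum.reindex_bij_witness[of _ "\<lambda>(p, xs). p # xs" "\<lambda>x. (hd x, tl x)"])
       (auto simp: copy_indices_def length_Suc_conv)
  then show ?thesis by (simp add: sum.cartesian_product)
qed

lemma finite_copy_indices: "finite (copy_indices d n)"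
  unfolding copy_indices_def
  using finite_lists_length_eq[of "{..<d} \<times> {..<d}" n] by (simp add: conj_commute)

lemma sum_prod_copy_indices:
  fixes h :: "nat \<Rightarrow> nat \<times> nat \<Rightarrow> 'a::comm_semiring_1"
  shows "(\<Sum>x\<in>copy_indices d n. \<Prod>t<n. h t (x ! t)) = (\<Prod>t<n. \<Sum>p\<in>{..<d} \<times> {..<d}. h t p)"
proof (induction n arbitrary: h)
  case 0
  have "copy_indices d 0 = {[]}" by (auto simp: copy_indices_def)
  then show ?case by simp
next
  case (Suc n)
  have "(\<Sum>x\<in>copy_indices d (Suc n). \<Prod>t<Suc n. h t (x ! t))
      = (\<Sum>p\<in>{..<d} \<times> {..<d}. h 0 p * (\<Sum>xs\<in>copy_indices d n. \<Prod>t<n. h (Suc t) (xs ! t)))"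
    by (simp add: sum_copy_indices_Suc prod.lessThan_Suc_shift sum_distrib_left del: prod.lessThan_Suc)
  also have "\<dots> = (\<Prod>t<Suc n. \<Sum>p\<in>{..<d} \<times> {..<d}. h t p)"
    unfolding Suc[of "\<lambda>t. h (Suc t)"] prod.lessThan_Suc_shift by (simp add: sum_distrib_right)
  finally show ?case .
qed

lemma copy_indices_nth: "x \<in> copy_indices d n \<Longrightarrow> t < n \<Longrightarrow> x ! t \<in> {..<d} \<times> {..<d}"
  unfolding copy_indices_def using nth_mem by blast

lemma copy_indices_eq_iff:
  "x \<in> copy_indices d n \<Longrightarrow> y \<in> copy_indices d n \<Longrightarrow> x = y \<longleftrightarrow> (\<forall>t<n. x ! t = y ! t)"
  by (auto simp: copy_indices_def intro: nth_equalityI)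

definition tensor_matrix :: "nat \<Rightarrow> (nat \<times> nat \<Rightarrow> nat \<times> nat \<Rightarrow> 'a::comm_semiring_1) \<Rightarrow>
    (nat \<times> nat) list \<Rightarrow> (nat \<times> nat) list \<Rightarrow> 'a" where
  "tensor_matrix n \<kappa> x y = (\<Prod>t<n. \<kappa> (x ! t) (y ! t))"

lemma tensor_unitary:
  assumes "unitary_on ({..<d} \<times> {..<d}) \<kappa>"
  shows "unitary_on (copy_indices d n) (tensor_matrix n \<kappa>)"
  unfolding unitary_on_def
proof (intro ballI conjI)
  fix x y assume xy: "x \<in> copy_indices d n" "y \<in> copy_indices d n"
  have e: "(\<Prod>t<n. if x ! t = y ! t then 1 else 0 :: complex) = (if x = y then 1 else 0)"
    unfolding copy_indices_eq_iff[OF xy] by (auto intro: prod_zero)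
  have "(\<Sum>a\<in>copy_indices d n. cnj (tensor_matrix n \<kappa> a x) * tensor_matrix n \<kappa> a y)
      = (\<Sum>a\<in>copy_indices d n. \<Prod>t<n. cnj (\<kappa> (a ! t) (x ! t)) * \<kappa> (a ! t) (y ! t))"
    by (simp add: tensor_matrix_def prod.distrib)
  also have "\<dots> = (\<Prod>t<n. if x ! t = y ! t then 1 else 0)"
    unfolding sum_prod_copy_indices[of "\<lambda>t p. cnj (\<kappa> p (x ! t)) * \<kappa> p (y ! t)"]
    by (intro prod.cong refl unitary_onD[OF assms] copy_indices_nth[OF xy(1)] copy_indices_nth[OF xy(2)]) auto
  finally show "(\<Sum>a\<in>copy_indices d n. cnj (tensor_matrix n \<kappa> a x) * tensor_matrix n \<kappa> a y)
      = (if x = y then 1 else 0)" unfolding e .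
  have "(\<Sum>a\<in>copy_indices d n. tensor_matrix n \<kappa> x a * cnj (tensor_matrix n \<kappa> y a))
      = (\<Sum>a\<in>copy_indices d n. \<Prod>t<n. \<kappa> (x ! t) (a ! t) * cnj (\<kappa> (y ! t) (a ! t)))"
    by (simp add: tensor_matrix_def prod.distrib)
  also have "\<dots> = (\<Prod>t<n. if x ! t = y ! t then 1 else 0)"
    unfolding sum_prod_copy_indices[of "\<lambda>t p. \<kappa> (x ! t) p * cnj (\<kappa> (y ! t) p)"]
    by (intro prod.cong refl unitary_onD[OF assms] copy_indices_nth[OF xy(1)] copy_indices_nth[OF xy(2)]) auto
  finally show "(\<Sum>a\<in>copy_indices d n. tensor_matrix n \<kappa> x a * cnj (tensor_matrix n \<kappa> y a))
      = (if x = y then 1 else 0)" unfolding e .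
qed

lemma tensor_matrix_power:
  assumes "x \<in> copy_indices d n" "\<And>p. p \<in> {..<d} \<times> {..<d} \<Longrightarrow> \<psi>' p = (\<Sum>q\<in>{..<d} \<times> {..<d}. \<kappa> p q * \<psi> q)"
  shows "(\<Sum>y\<in>copy_indices d n. tensor_matrix n \<kappa> x y * tensor_power n \<psi> y) = tensor_power n \<psi>' x"
proof -
  have "(\<Sum>y\<in>copy_indices d n. tensor_matrix n \<kappa> x y * tensor_power n \<psi> y)
      = (\<Sum>y\<in>copy_indices d n. \<Prod>t<n. \<kappa> (x ! t) (y ! t) * \<psi> (y ! t))"
    by (simp add: tensor_matrix_def tensor_power_def prod.distrib)
  also have "\<dots> = (\<Prod>t<n. \<Sum>q\<in>{..<d} \<times> {..<d}. \<kappa> (x ! t) q * \<psi> q)"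
    by (rule sum_prod_copy_indices)
  also have "\<dots> = tensor_power n \<psi>' x"
    unfolding tensor_power_def
    by (intro prod.cong refl assms(2)[symmetric] copy_indices_nth[OF assms(1)]) simp
  finally show ?thesis .
qed

definition preserves_states :: "nat \<Rightarrow> (nat \<times> nat \<Rightarrow> nat \<times> nat \<Rightarrow> complex) \<Rightarrow> (nat \<times> nat \<Rightarrow> complex) set \<Rightarrow> bool" where
  "preserves_states d \<kappa> A \<longleftrightarrow> (\<forall>\<psi>\<in>A. \<exists>\<psi>'\<in>A. \<forall>p\<in>{..<d} \<times> {..<d}. \<psi>' p = (\<Sum>q\<in>{..<d} \<times> {..<d}. \<kappa> p q * \<psi> q))"

lemma qform_cong: "(\<And>x. x \<in> I \<Longrightarrow> u x = v x) \<Longrightarrow> qform I T u = qform I T v"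
  unfolding qform_def by (intro sum.cong refl) simp

lemma is_tester_hermitian:
  assumes "is_tester d n Yes No T" "x \<in> copy_indices d n" "y \<in> copy_indices d n"
  shows "T y x = cnj (T x y)"
  using assms unfolding is_tester_def between_zero_id_def by blast

lemma is_tester_bounds:
  assumes "is_tester d n Yes No T"
  shows "0 \<le> Re (qform (copy_indices d n) T v)"
    "Re (qform (copy_indices d n) T v) \<le> (\<Sum>x\<in>copy_indices d n. (cmod (v x))\<^sup>2)"
  using assms unfolding is_tester_def between_zero_id_def by blast+

lemma is_tester_accept:
  assumes "is_tester d n Yes No T"
  shows "\<psi> \<in> Yes \<Longrightarrow> 2 / 3 \<le> accept_prob d n T \<psi>" "\<psi> \<in> No \<Longrightarrow> accept_prob d n T \<psi> \<le> 1 / 3"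
  using assms unfolding is_tester_def by blast+

lemma is_tester_conj_by:
  assumes T: "is_tester d n Yes No T" and \<kappa>: "unitary_on ({..<d} \<times> {..<d}) \<kappa>"
    and pres: "preserves_states d \<kappa> Yes" "preserves_states d \<kappa> No"
  shows "is_tester d n Yes No (conj_by (copy_indices d n) (tensor_matrix n \<kappa>) T)"
proof -
  let ?I = "copy_indices d n" and ?V = "tensor_matrix n \<kappa>"
  note U = tensor_unitary[OF \<kappa>, of n]
  have acc: "\<exists>\<psi>'\<in>A. accept_prob d n (conj_by ?I ?V T) \<psi> = accept_prob d n T \<psi>'"
    if pA: "preserves_states d \<kappa> A" "\<psi> \<in> A" for A \<psi>
  proof -
    obtain \<psi>' where \<psi>': "\<psi>' \<in> A" "\<forall>p\<in>{..<d} \<times> {..<d}. \<psi>' p = (\<Sum>q\<in>{..<d} \<times> {..<d}. \<kappa> p q * \<psi> q)"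
      using pA unfolding preserves_states_def by blast
    then have "accept_prob d n (conj_by ?I ?V T) \<psi> = accept_prob d n T \<psi>'"
      unfolding accept_prob_def qform_conj_by
      by (intro arg_cong[of _ _ Re] qform_cong tensor_matrix_power) auto
    then show ?thesis using \<psi>'(1) by blast
  qed
  have herm: "conj_by ?I ?V T y x = cnj (conj_by ?I ?V T x y)" if "x \<in> ?I" "y \<in> ?I" for x y
  proof -
    have "cnj (conj_by ?I ?V T x y) = (\<Sum>a\<in>?I. \<Sum>b\<in>?I. ?V a x * (cnj (T a b) * cnj (?V b y)))"
      by (simp add: conj_by_def sum_distrib_left)
    also have "\<dots> = (\<Sum>b\<in>?I. \<Sum>a\<in>?I. ?V a x * (cnj (T a b) * cnj (?V b y)))" by (rule sum.swap)
    also have "\<dots> = (\<Sum>b\<in>?I. \<Sum>a\<in>?I. cnj (?V b y) * (T b a * ?V a x))"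
    proof (intro sum.cong refl)
      fix a b assume "a \<in> ?I" "b \<in> ?I"
      then have "cnj (T a b) = T b a" using is_tester_hermitian[OF T, of b a] by simp
      then show "?V a x * (cnj (T a b) * cnj (?V b y)) = cnj (?V b y) * (T b a * ?V a x)" by simp
    qed
    finally show ?thesis by (simp add: conj_by_def sum_distrib_left)
  qed
  have "between_zero_id ?I (conj_by ?I ?V T)"
    unfolding between_zero_id_def qform_conj_by
  proof (intro conjI ballI allI)
    fix v
    show "0 \<le> Re (qform ?I T (\<lambda>a. \<Sum>y\<in>?I. ?V a y * v y))" by (rule is_tester_bounds[OF T])
    show "Re (qform ?I T (\<lambda>a. \<Sum>y\<in>?I. ?V a y * v y)) \<le> (\<Sum>x\<in>?I. (cmod (v x))\<^sup>2)"
      using is_tester_bounds(2)[OF T, of "\<lambda>a. \<Sum>y\<in>?I. ?V a y * v y"]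
      by (simp only: unitary_isometry(1)[OF finite_copy_indices U])
  qed (rule herm)
  then show ?thesis
    using acc[OF pres(1)] acc[OF pres(2)] is_tester_accept[OF T] unfolding is_tester_def by metis
qed

lemma is_tester_mean:
  assumes "is_tester d n Yes No T" "is_tester d n Yes No T'"
  shows "is_tester d n Yes No (\<lambda>x y. (T x y + T' x y) / 2)"
proof -
  have "qform I (\<lambda>x y. (T x y + T' x y) / 2) v = (qform I T v + qform I T' v) / 2" for I v
    unfolding qform_def sum.distrib[symmetric] sum_divide_distrib
    by (intro sum.cong refl) (simp add: algebra_simps add_divide_distrib)
  note q0 = this
  have q: "Re (qform I (\<lambda>x y. (T x y + T' x y) / 2) v) = (Re (qform I T v) + Re (qform I T' v)) / 2" for I v
    unfolding q0 by simp
  have lo: "a \<le> x \<Longrightarrow> a \<le> y \<Longrightarrow> a \<le> (x + y) / 2" and hi: "x \<le> a \<Longrightarrow> y \<le> a \<Longrightarrow> (x + y) / 2 \<le> a"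
    for a x y :: real by simp_all
  note T = is_tester_bounds[OF assms(1)] is_tester_accept[OF assms(1), unfolded accept_prob_def]
    and T' = is_tester_bounds[OF assms(2)] is_tester_accept[OF assms(2), unfolded accept_prob_def]
  show ?thesis
    unfolding is_tester_def between_zero_id_def accept_prob_def q
  proof (intro conjI ballI allI)
    fix x y assume xy: "x \<in> copy_indices d n" "y \<in> copy_indices d n"
    show "(T y x + T' y x) / 2 = cnj ((T x y + T' x y) / 2)"
      unfolding is_tester_hermitian[OF assms(1) xy] is_tester_hermitian[OF assms(2) xy] by simp
  qed (intro lo hi T T'; assumption)+
qed

lemma is_tester_closed:
  assumes T: "\<And>m. is_tester d n Yes No (F m)"
    and lim: "\<And>x y. x \<in> copy_indices d n \<Longrightarrow> y \<in> copy_indices d n \<Longrightarrow> (\<lambda>m::nat. F m x y) \<longlonglongrightarrow> f x y"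
  shows "is_tester d n Yes No f"
proof -
  let ?I = "copy_indices d n"
  have q: "(\<lambda>m. Re (qform ?I (F m) v)) \<longlonglongrightarrow> Re (qform ?I f v)" for v
    unfolding qform_def by (intro tendsto_Re tendsto_sum tendsto_mult tendsto_const lim)
  show ?thesis
    unfolding is_tester_def between_zero_id_def accept_prob_def
  proof (intro conjI ballI allI)
    fix x y assume xy: "x \<in> ?I" "y \<in> ?I"
    show "f y x = cnj (f x y)"
      using lim[OF xy(2,1)] tendsto_cnj[OF lim[OF xy]] unfolding is_tester_hermitian[OF T xy]
      by (rule LIMSEQ_unique)
  next
    fix v show "0 \<le> Re (qform ?I f v)"
      by (rule LIMSEQ_le_const[OF q]) (use is_tester_bounds[OF T] in blast)
    show "Re (qform ?I f v) \<le> (\<Sum>x\<in>?I. (cmod (v x))\<^sup>2)"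
      by (rule LIMSEQ_le_const2[OF q]) (use is_tester_bounds[OF T] in blast)
  next
    fix \<psi> assume "\<psi> \<in> Yes"
    then show "2 / 3 \<le> Re (qform ?I f (tensor_power n \<psi>))"
      using is_tester_accept(1)[OF T] by (intro LIMSEQ_le_const[OF q] exI[of _ 0]) (simp add: accept_prob_def)
  next
    fix \<psi> assume "\<psi> \<in> No"
    then show "Re (qform ?I f (tensor_power n \<psi>)) \<le> 1 / 3"
      using is_tester_accept(2)[OF T] by (intro LIMSEQ_le_const2[OF q] exI[of _ 0]) (simp add: accept_prob_def)
  qed
qed

lemma invariant_tester_exists:
  assumes "is_tester d n Yes No T"
  obtains T0 where "is_tester d n Yes No T0"
    "\<And>\<kappa> x y. unitary_on ({..<d} \<times> {..<d}) \<kappa> \<Longrightarrow> preserves_states d \<kappa> Yes \<Longrightarrow> preserves_states d \<kappa> No \<Longrightarrow>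
      x \<in> copy_indices d n \<Longrightarrow> y \<in> copy_indices d n \<Longrightarrow>
      (\<Sum>a\<in>copy_indices d n. tensor_matrix n \<kappa> x a * T0 a y) = (\<Sum>b\<in>copy_indices d n. T0 x b * tensor_matrix n \<kappa> b y)"
proof -
  let ?I = "copy_indices d n"
  define K where "K = {f. is_tester d n Yes No (\<lambda>x y. f (x, y))}"
  have fin: "finite (?I \<times> ?I)" using finite_copy_indices by blast
  have ne: "K \<noteq> {}" using assms by (auto simp: K_def intro!: exI[of _ "\<lambda>(x, y). T x y"])
  have mean: "(\<lambda>x. (f x + g x) / 2) \<in> K" if "f \<in> K" "g \<in> K" for f g
    using that is_tester_mean by (simp add: K_def)
  have closed: "f \<in> K" if "\<And>m. F m \<in> K" "\<And>x. x \<in> ?I \<times> ?I \<Longrightarrow> (\<lambda>m::nat. F m x) \<longlonglongrightarrow> f x" for F f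
    unfolding K_def mem_Collect_eq
    by (rule is_tester_closed[where F = "\<lambda>m x y. F m (x, y)"]) (use that in \<open>auto simp: K_def\<close>)
  obtain f where f: "f \<in> K" "\<And>g x. g \<in> K \<Longrightarrow>
      (\<Sum>x\<in>?I \<times> ?I. (cmod (g x))\<^sup>2) = (\<Sum>x\<in>?I \<times> ?I. (cmod (f x))\<^sup>2) \<Longrightarrow> x \<in> ?I \<times> ?I \<Longrightarrow> g x = f x"
  proof (rule least_norm_exists[OF fin ne])
    show "(\<lambda>x. (f x + g x) / 2) \<in> K" if "f \<in> K" "g \<in> K" for f g using that by (rule mean)
    show "f \<in> K" if "\<And>m. F m \<in> K" "\<And>x. x \<in> ?I \<times> ?I \<Longrightarrow> (\<lambda>m::nat. F m x) \<longlonglongrightarrow> f x" for F f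
      using that by (rule closed)
  qed blast
  define T0 where "T0 x y = f (x, y)" for x y
  have T0: "is_tester d n Yes No T0" using f(1) by (simp add: K_def T0_def[abs_def])
  have "(\<Sum>a\<in>?I. tensor_matrix n \<kappa> x a * T0 a y) = (\<Sum>b\<in>?I. T0 x b * tensor_matrix n \<kappa> b y)"
    if \<kappa>: "unitary_on ({..<d} \<times> {..<d}) \<kappa>" "preserves_states d \<kappa> Yes" "preserves_states d \<kappa> No"
      and xy: "x \<in> ?I" "y \<in> ?I" for \<kappa> x y
  proof (rule conj_by_fixed_commute[OF finite_copy_indices tensor_unitary[OF \<kappa>(1)] _ xy])
    fix x y assume xy: "x \<in> ?I" "y \<in> ?I"
    let ?g = "\<lambda>(x, y). conj_by ?I (tensor_matrix n \<kappa>) T0 x y"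
    have "?g (x, y) = f (x, y)"
    proof (rule f(2))
      show "?g \<in> K" using is_tester_conj_by[OF T0 \<kappa>] by (simp add: K_def)
      have "(\<Sum>x\<in>?I \<times> ?I. (cmod (?g x))\<^sup>2) = (\<Sum>(x, y)\<in>?I \<times> ?I. (cmod (T0 x y))\<^sup>2)"
        using conj_by_norm[OF finite_copy_indices tensor_unitary[OF \<kappa>(1)], of n T0]
        by (simp add: case_prod_unfold)
      then show "(\<Sum>x\<in>?I \<times> ?I. (cmod (?g x))\<^sup>2) = (\<Sum>x\<in>?I \<times> ?I. (cmod (f x))\<^sup>2)"
        by (simp add: T0_def case_prod_unfold)
    qed (use xy in auto)
    then show "conj_by ?I (tensor_matrix n \<kappa>) T0 x y = T0 x y" by (simp add: T0_def)
  qed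
  then show ?thesis using that T0 by blast
qed

section \<open>From local unitary invariance to permutation-invariant matrices\<close>

subsection \<open>Matrices generated by one-particle operators\<close>

definition comm_on :: "'a set \<Rightarrow> ('a \<Rightarrow> 'a \<Rightarrow> real) \<Rightarrow> ('a \<Rightarrow> 'a \<Rightarrow> real) \<Rightarrow> bool" where
  "comm_on W M X \<longleftrightarrow> (\<forall>w\<in>W. \<forall>x\<in>W. (\<Sum>u\<in>W. X w u * M u x) = (\<Sum>u\<in>W. M w u * X u x))"

lemma comm_on_cong:
  "(\<And>w u. w \<in> W \<Longrightarrow> u \<in> W \<Longrightarrow> X w u = Y w u) \<Longrightarrow> comm_on W M X \<longleftrightarrow> comm_on W M Y"
  unfolding comm_on_def by (simp cong: sum.cong)

lemma comm_on_diff: "comm_on W M X \<Longrightarrow> comm_on W M Y \<Longrightarrow> comm_on W M (\<lambda>w u. X w u - Y w u)"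
  by (simp add: comm_on_def left_diff_distrib right_diff_distrib sum_subtractf)

lemma comm_on_scale: "comm_on W M X \<Longrightarrow> comm_on W M (\<lambda>w u. c * X w u)"
  by (simp add: comm_on_def mult.assoc mult.left_commute[of _ c] sum_distrib_left[symmetric])

lemma comm_on_sum:
  assumes "\<And>i. i \<in> I \<Longrightarrow> comm_on W M (X i)"
  shows "comm_on W M (\<lambda>w u. \<Sum>i\<in>I. X i w u)"
  unfolding comm_on_def
proof (intro ballI)
  fix w x assume wx: "w \<in> W" "x \<in> W"
  have "(\<Sum>u\<in>W. (\<Sum>i\<in>I. X i w u) * M u x) = (\<Sum>i\<in>I. \<Sum>u\<in>W. X i w u * M u x)"
    unfolding sum_distrib_right by (rule sum.swap)
  also have "\<dots> = (\<Sum>i\<in>I. \<Sum>u\<in>W. M w u * X i u x)"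
    by (rule sum.cong[OF refl]) (use assms wx in \<open>simp add: comm_on_def\<close>)
  also have "\<dots> = (\<Sum>u\<in>W. M w u * (\<Sum>i\<in>I. X i u x))"
    unfolding sum_distrib_left by (rule sum.swap)
  finally show "(\<Sum>u\<in>W. (\<Sum>i\<in>I. X i w u) * M u x) = (\<Sum>u\<in>W. M w u * (\<Sum>i\<in>I. X i u x))" .
qed

lemma comm_on_mult:
  assumes "comm_on W M X" "comm_on W M Y"
  shows "comm_on W M (\<lambda>w u. \<Sum>v\<in>W. X w v * Y v u)"
  unfolding comm_on_def
proof (intro ballI)
  fix w x assume wx: "w \<in> W" "x \<in> W"
  have "(\<Sum>u\<in>W. (\<Sum>v\<in>W. X w v * Y v u) * M u x) = (\<Sum>v\<in>W. X w v * (\<Sum>u\<in>W. Y v u * M u x))"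
    unfolding sum_distrib_right sum_distrib_left by (subst sum.swap) (simp only: mult.assoc)
  also have "\<dots> = (\<Sum>v\<in>W. X w v * (\<Sum>u\<in>W. M v u * Y u x))"
    using assms(2) wx by (intro sum.cong refl) (auto simp: comm_on_def)
  also have "\<dots> = (\<Sum>u\<in>W. (\<Sum>v\<in>W. X w v * M v u) * Y u x)"
    unfolding sum_distrib_right sum_distrib_left by (subst sum.swap) (simp only: mult.assoc)
  also have "\<dots> = (\<Sum>u\<in>W. (\<Sum>v\<in>W. M w v * X v u) * Y u x)"
    using assms(1) wx by (intro sum.cong refl) (auto simp: comm_on_def)
  also have "\<dots> = (\<Sum>v\<in>W. M w v * (\<Sum>u\<in>W. X v u * Y u x))"
    unfolding sum_distrib_right sum_distrib_left by (subst sum.swap) (simp only: mult.assoc)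
  finally show "(\<Sum>u\<in>W. (\<Sum>v\<in>W. X w v * Y v u) * M u x) = (\<Sum>u\<in>W. M w u * (\<Sum>v\<in>W. X u v * Y v x))" .
qed

text \<open>The derivation action on words of the matrix unit with row \<alpha> and column \<beta>:
  one copy of it at each site in turn.\<close>

definition one_site :: "nat \<Rightarrow> nat \<Rightarrow> nat \<Rightarrow> word \<Rightarrow> word \<Rightarrow> real" where
  "one_site n \<alpha> \<beta> v u = (\<Sum>l<n. of_bool (v l = \<alpha> \<and> u l = \<beta> \<and> (\<forall>k. k \<noteq> l \<longrightarrow> v k = u k)))"

definition inj_maps :: "nat \<Rightarrow> nat \<Rightarrow> (nat \<Rightarrow> nat) set" where
  "inj_maps m n = {f \<in> {..<m} \<rightarrow>\<^sub>E {..<n}. inj_on f {..<m}}"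

definition sites_match :: "(nat \<Rightarrow> nat) \<Rightarrow> (nat \<Rightarrow> nat) \<Rightarrow> nat \<Rightarrow> (nat \<Rightarrow> nat) \<Rightarrow> word \<Rightarrow> word \<Rightarrow> bool" where
  "sites_match a b m f w u \<longleftrightarrow>
    (\<forall>t<m. w (f t) = a t \<and> u (f t) = b t) \<and> (\<forall>l. l \<notin> f ` {..<m} \<longrightarrow> w l = u l)"

text \<open>Matrix units placed on m distinct sites, summed over all placements. Distinctness is
  what lets m = n reach products over all sites.\<close>

definition multi_site :: "nat \<Rightarrow> nat \<Rightarrow> (nat \<Rightarrow> nat) \<Rightarrow> (nat \<Rightarrow> nat) \<Rightarrow> word \<Rightarrow> word \<Rightarrow> real" where
  "multi_site n m a b w u = (\<Sum>f\<in>inj_maps m n. of_bool (sites_match a b m f w u))"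

lemma finite_inj_maps: "finite (inj_maps m n)"
  unfolding inj_maps_def by (rule finite_subset[of _ "{..<m} \<rightarrow>\<^sub>E {..<n}"]) (auto intro: finite_PiE)

lemma sum_inj_maps_Suc:
  fixes F :: "(nat \<Rightarrow> nat) \<Rightarrow> real"
  shows "(\<Sum>f\<in>inj_maps (Suc m) n. F f) = (\<Sum>f\<in>inj_maps m n. \<Sum>l\<in>{..<n} - f ` {..<m}. F (f(m := l)))"
proof -
  have "(\<Sum>f\<in>inj_maps (Suc m) n. F f)
      = (\<Sum>(f, l)\<in>(SIGMA f:inj_maps m n. {..<n} - f ` {..<m}). F (f(m := l)))"
  proof (rule sum.reindex_bij_witness[of _ "\<lambda>(f, l). f(m := l)" "\<lambda>f. (f(m := undefined), f m)"], goal_cases)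
    case (1 f) then show ?case by auto
  next
    case (2 f)
    then have f: "f \<in> {..<Suc m} \<rightarrow>\<^sub>E {..<n}" "inj_on f {..<Suc m}" by (auto simp: inj_maps_def)
    have "f m \<noteq> f t" if "t < m" for t using inj_onD[OF f(2), of m t] that by auto
    moreover have "(f(m := undefined)) ` {..<m} = f ` {..<m}" by (intro image_cong) auto
    moreover have "inj_on (f(m := undefined)) {..<m}"
      using f(2) by (auto simp: inj_on_def)
    moreover have "f(m := undefined) \<in> {..<m} \<rightarrow>\<^sub>E {..<n}"
      using f(1) by (auto simp: PiE_def extensional_def Pi_def)
    moreover have "f m < n" using f(1) by auto
    ultimately show ?case by (auto simp: inj_maps_def)
  next
    case (3 p)
    then show ?case by (auto simp: inj_maps_def PiE_def extensional_def fun_eq_iff)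
  next
    case (4 p)
    then obtain f l where p: "p = (f, l)" "f \<in> {..<m} \<rightarrow>\<^sub>E {..<n}" "inj_on f {..<m}" "l < n" "l \<notin> f ` {..<m}"
      by (auto simp: inj_maps_def)
    have "inj_on (f(m := l)) {..<Suc m}"
      using p(3,5) by (auto simp: inj_on_def less_Suc_eq)
    moreover have "f(m := l) \<in> {..<Suc m} \<rightarrow>\<^sub>E {..<n}"
      using p(2,4) by (auto simp: PiE_def extensional_def Pi_def less_Suc_eq)
    ultimately show ?case by (simp add: p(1) inj_maps_def)
  next
    case (5 f) then show ?case by auto
  qed
  also have "\<dots> = (\<Sum>f\<in>inj_maps m n. \<Sum>l\<in>{..<n} - f ` {..<m}. F (f(m := l)))"
    by (rule sum.Sigma[symmetric]) (simp_all add: finite_inj_maps)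
  finally show ?thesis .
qed

text \<open>The extra matrix unit lands either on a fresh site, giving m + 1 sites, or on the site
  of some t, where it multiplies the unit already there and survives only if b t = \<alpha>. Solved
  for the first term this generates all \<open>multi_site\<close> operators from
  \<open>one_site\<close>.\<close>

lemma multi_site_mult:
  assumes w: "w \<in> words d d n" and u: "u \<in> words d d n" and \<alpha>: "\<alpha> < d"
  shows "(\<Sum>v\<in>words d d n. multi_site n m a b w v * one_site n \<alpha> \<beta> v u)
    = multi_site n (Suc m) (a(m := \<alpha>)) (b(m := \<beta>)) w u
      + (\<Sum>t<m. of_bool (b t = \<alpha>) * multi_site n m a (b(t := \<beta>)) w u)"
proof -
  let ?W = "words d d n"
  define H where "H f l = (of_bool (u l = \<beta> \<and> sites_match a b m f w (u(l := \<alpha>))) :: real)" for f l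
  have inner: "(\<Sum>v\<in>?W. of_bool (sites_match a b m f w v) * of_bool (v l = \<alpha> \<and> u l = \<beta> \<and> (\<forall>k. k \<noteq> l \<longrightarrow> v k = u k))) = H f l"
    if l: "l < n" for f l
  proof -
    have ul: "u(l := \<alpha>) \<in> ?W" using u l \<alpha> by (auto simp: words_def)
    have "(\<Sum>v\<in>?W. of_bool (sites_match a b m f w v) * of_bool (v l = \<alpha> \<and> u l = \<beta> \<and> (\<forall>k. k \<noteq> l \<longrightarrow> v k = u k)))
        = (\<Sum>v\<in>?W. if v = u(l := \<alpha>) then H f l else 0)"
    proof (intro sum.cong refl)
      fix v
      have "v l = \<alpha> \<and> (\<forall>k. k \<noteq> l \<longrightarrow> v k = u k) \<longleftrightarrow> v = u(l := \<alpha>)" by (auto simp: fun_eq_iff)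
      then show "of_bool (sites_match a b m f w v) * of_bool (v l = \<alpha> \<and> u l = \<beta> \<and> (\<forall>k. k \<noteq> l \<longrightarrow> v k = u k))
          = (if v = u(l := \<alpha>) then H f l else 0)"
        by (auto simp: H_def)
    qed
    then show ?thesis using ul by (simp add: finite_words)
  qed
  have "(\<Sum>v\<in>?W. multi_site n m a b w v * one_site n \<alpha> \<beta> v u)
      = (\<Sum>v\<in>?W. \<Sum>f\<in>inj_maps m n. \<Sum>l<n. of_bool (sites_match a b m f w v)
          * of_bool (v l = \<alpha> \<and> u l = \<beta> \<and> (\<forall>k. k \<noteq> l \<longrightarrow> v k = u k)))"
    by (simp only: multi_site_def one_site_def sum_product)
  also have "\<dots> = (\<Sum>f\<in>inj_maps m n. \<Sum>l<n. \<Sum>v\<in>?W. of_bool (sites_match a b m f w v)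
          * of_bool (v l = \<alpha> \<and> u l = \<beta> \<and> (\<forall>k. k \<noteq> l \<longrightarrow> v k = u k)))"
    by (subst sum.swap, rule sum.cong[OF refl], rule sum.swap)
  also have "\<dots> = (\<Sum>f\<in>inj_maps m n. \<Sum>l<n. H f l)"
    by (intro sum.cong refl inner) simp
  also have "\<dots> = (\<Sum>f\<in>inj_maps m n. (\<Sum>l\<in>{..<n} - f ` {..<m}. H f l) + (\<Sum>t<m. H f (f t)))"
  proof (intro sum.cong refl)
    fix f assume "f \<in> inj_maps m n"
    then have f: "f ` {..<m} \<subseteq> {..<n}" "inj_on f {..<m}" by (auto simp: inj_maps_def)
    have "(\<Sum>l<n. H f l) = (\<Sum>l\<in>{..<n} - f ` {..<m}. H f l) + (\<Sum>l\<in>f ` {..<m}. H f l)"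
      using f(1) by (intro sum.subset_diff) auto
    then show "(\<Sum>l<n. H f l) = (\<Sum>l\<in>{..<n} - f ` {..<m}. H f l) + (\<Sum>t<m. H f (f t))"
      using f(2) by (simp add: sum.reindex)
  qed
  also have "\<dots> = multi_site n (Suc m) (a(m := \<alpha>)) (b(m := \<beta>)) w u
      + (\<Sum>t<m. of_bool (b t = \<alpha>) * multi_site n m a (b(t := \<beta>)) w u)"
  proof -
    have 1: "H f l = of_bool (sites_match (a(m := \<alpha>)) (b(m := \<beta>)) (Suc m) (f(m := l)) w u)"
      if l: "l \<in> {..<n} - f ` {..<m}" for f l
    proof -
      have "(f(m := l)) ` {..<Suc m} = insert l (f ` {..<m})" by (auto simp: less_Suc_eq image_iff)
      moreover have "\<And>t. t < m \<Longrightarrow> f t \<noteq> l" using l by auto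
      ultimately have "(u l = \<beta> \<and> sites_match a b m f w (u(l := \<alpha>)))
          \<longleftrightarrow> sites_match (a(m := \<alpha>)) (b(m := \<beta>)) (Suc m) (f(m := l)) w u"
        using l unfolding sites_match_def by (auto simp: less_Suc_eq)
      then show ?thesis by (simp only: H_def)
    qed
    have 2: "H f (f t) = of_bool (b t = \<alpha>) * of_bool (sites_match a (b(t := \<beta>)) m f w u)"
      if f: "f \<in> inj_maps m n" and t: "t < m" for f t
    proof -
      have "\<And>t'. t' < m \<Longrightarrow> f t' = f t \<longleftrightarrow> t' = t" using f t by (auto simp: inj_maps_def inj_on_def)
      then have "(u (f t) = \<beta> \<and> sites_match a b m f w (u(f t := \<alpha>)))
          \<longleftrightarrow> b t = \<alpha> \<and> sites_match a (b(t := \<beta>)) m f w u"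
        using t unfolding sites_match_def by (auto split: if_splits)
      then show ?thesis by (simp add: H_def)
    qed
    have "(\<Sum>f\<in>inj_maps m n. \<Sum>l\<in>{..<n} - f ` {..<m}. H f l)
        = multi_site n (Suc m) (a(m := \<alpha>)) (b(m := \<beta>)) w u"
      unfolding multi_site_def sum_inj_maps_Suc by (intro sum.cong refl 1)
    moreover have "(\<Sum>f\<in>inj_maps m n. \<Sum>t<m. H f (f t))
        = (\<Sum>t<m. of_bool (b t = \<alpha>) * multi_site n m a (b(t := \<beta>)) w u)"
      unfolding multi_site_def sum_distrib_left by (subst sum.swap) (intro sum.cong refl 2, auto)
    ultimately show ?thesis by (simp add: sum.distrib)
  qed
  finally show ?thesis .
qed

lemma comm_multi_site:
  assumes one: "\<And>\<alpha> \<beta>. \<alpha> < d \<Longrightarrow> \<beta> < d \<Longrightarrow> comm_on (words d d n) M (one_site n \<alpha> \<beta>)"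
    and "\<And>t. t < m \<Longrightarrow> a t < d \<and> b t < d"
  shows "comm_on (words d d n) M (multi_site n m a b)"
  using assms(2)
proof (induction m arbitrary: a b)
  case 0
  have "comm_on (words d d n) M (\<lambda>w u. of_bool (w = u))"
    by (simp add: comm_on_def finite_words of_bool_def if_distrib if_distribR cong: if_cong)
  moreover have "inj_maps 0 n = {\<lambda>_. undefined}" by (auto simp: inj_maps_def)
  then have "multi_site n 0 a b w u = of_bool (w = u)" for w u
    by (simp add: multi_site_def sites_match_def fun_eq_iff)
  ultimately show ?case by (simp cong: comm_on_cong)
next
  case (Suc m)
  let ?W = "words d d n"
  have "multi_site n (Suc m) a b w u
      = (\<Sum>v\<in>?W. multi_site n m a b w v * one_site n (a m) (b m) v u)
        - (\<Sum>t<m. of_bool (b t = a m) * multi_site n m a (b(t := b m)) w u)"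
    if "w \<in> ?W" "u \<in> ?W" for w u
    using multi_site_mult[OF that, of "a m" m a b "b m"] Suc.prems[of m] by simp
  moreover have "comm_on ?W M (\<lambda>w u. (\<Sum>v\<in>?W. multi_site n m a b w v * one_site n (a m) (b m) v u)
        - (\<Sum>t<m. of_bool (b t = a m) * multi_site n m a (b(t := b m)) w u))"
    using Suc.prems by (intro comm_on_diff comm_on_mult comm_on_sum comm_on_scale Suc.IH one) (auto simp: less_Suc_eq)
  ultimately show ?case by (simp cong: comm_on_cong)
qed

text \<open>X is an average of \<open>multi_site\<close> operators on all n sites. Every injective
  placement of n sites is a permutation p and contributes X (w o p) (u o p), which invariance turns
  back into X w u.\<close>

theorem comm_perm_invariant:
  assumes one: "\<And>\<alpha> \<beta>. \<alpha> < d \<Longrightarrow> \<beta> < d \<Longrightarrow> comm_on (words d d n) M (one_site n \<alpha> \<beta>)"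
    and X: "perm_invariant n X"
  shows "comm_on (words d d n) M X"
proof -
  let ?W = "words d d n"
  define c where "c = real (card (inj_maps n n))"
  have "(\<lambda>l. if l < n then l else undefined) \<in> inj_maps n n"
    by (auto simp: inj_maps_def inj_on_def split: if_splits)
  then have c: "c \<noteq> 0" by (auto simp: c_def finite_inj_maps)
  have expand: "X w u = (1 / c) * (\<Sum>a\<in>?W. \<Sum>b\<in>?W. X a b * multi_site n n a b w u)"
    if w: "w \<in> ?W" and u: "u \<in> ?W" for w u
  proof -
    have f: "(\<Sum>a\<in>?W. \<Sum>b\<in>?W. X a b * of_bool (sites_match a b n f w u)) = X w u"
      if f: "f \<in> inj_maps n n" for f
    proof -
      define p where "p l = (if l < n then f l else l)" for l
      have fn: "f ` {..<n} \<subseteq> {..<n}" "inj_on f {..<n}" using f by (auto simp: inj_maps_def)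
      have fim: "f ` {..<n} = {..<n}" using fn by (simp add: endo_inj_surj)
      have p: "p permutes {..<n}"
      proof (rule bij_imp_permutes)
        have "bij_betw f {..<n} {..<n}" using fn(2) fim by (simp add: bij_betw_def)
        then show "bij_betw p {..<n} {..<n}" by (rule bij_betw_cong[THEN iffD1, rotated]) (simp add: p_def)
      qed (simp add: p_def)
      have "sites_match a b n f w u \<longleftrightarrow> a = w \<circ> p \<and> b = u \<circ> p" if "a \<in> ?W" "b \<in> ?W" for a b
      proof -
        have "(\<forall>l. l \<notin> f ` {..<n} \<longrightarrow> w l = u l)" unfolding fim using w u by (auto simp: words_def)
        moreover have "a = w \<circ> p \<longleftrightarrow> (\<forall>t<n. w (f t) = a t)" "b = u \<circ> p \<longleftrightarrow> (\<forall>t<n. u (f t) = b t)"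
          using w u that by (auto simp: fun_eq_iff p_def words_def)
        ultimately show ?thesis unfolding sites_match_def by blast
      qed
      then have "(\<Sum>a\<in>?W. \<Sum>b\<in>?W. X a b * of_bool (sites_match a b n f w u))
          = (\<Sum>a\<in>?W. \<Sum>b\<in>?W. if b = u \<circ> p then (if a = w \<circ> p then X a b else 0) else 0)"
        by (intro sum.cong refl) auto
      also have "\<dots> = X (w \<circ> p) (u \<circ> p)"
        using words_comp[OF w p] words_comp[OF u p] by (simp add: finite_words)
      finally show ?thesis using X p by (simp add: perm_invariant_def)
    qed
    have "(\<Sum>a\<in>?W. \<Sum>b\<in>?W. X a b * multi_site n n a b w u)
        = (\<Sum>a\<in>?W. \<Sum>f\<in>inj_maps n n. \<Sum>b\<in>?W. X a b * of_bool (sites_match a b n f w u))"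
      unfolding multi_site_def sum_distrib_left by (rule sum.cong[OF refl], rule sum.swap)
    also have "\<dots> = (\<Sum>f\<in>inj_maps n n. \<Sum>a\<in>?W. \<Sum>b\<in>?W. X a b * of_bool (sites_match a b n f w u))"
      by (rule sum.swap)
    also have "\<dots> = c * X w u" by (simp add: f c_def)
    finally show ?thesis using c by simp
  qed
  have "comm_on ?W M (\<lambda>w u. (1 / c) * (\<Sum>a\<in>?W. \<Sum>b\<in>?W. X a b * multi_site n n a b w u))"
    by (intro comm_on_scale comm_on_sum comm_multi_site one) (auto simp: words_def)
  then show ?thesis using comm_on_cong[of ?W X, OF expand] by blast
qed

subsection \<open>Local unitaries\<close>

text \<open>One argument for both tensor factors: f reads the index that is acted on, g the
  spectator.\<close>

definition side :: "(nat \<times> nat \<Rightarrow> nat) \<Rightarrow> (nat \<times> nat \<Rightarrow> nat) \<Rightarrow> bool" where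
  "side f g \<longleftrightarrow> f = fst \<and> g = snd \<or> f = snd \<and> g = fst"

definition local_lift :: "(nat \<times> nat \<Rightarrow> nat) \<Rightarrow> (nat \<times> nat \<Rightarrow> nat) \<Rightarrow> (nat \<Rightarrow> nat \<Rightarrow> complex) \<Rightarrow>
    nat \<times> nat \<Rightarrow> nat \<times> nat \<Rightarrow> complex" where
  "local_lift f g U p q = U (f p) (f q) * of_bool (g p = g q)"

lemma sum_side:
  assumes "side f g"
  shows "(\<Sum>p\<in>{..<d} \<times> {..<d}. F (f p) (g p)) = (\<Sum>i<d. \<Sum>j<d. F i j)"
  using assms unfolding side_def
proof (elim disjE conjE)
  assume "f = snd" "g = fst"
  then have "(\<Sum>p\<in>{..<d} \<times> {..<d}. F (f p) (g p)) = (\<Sum>j<d. \<Sum>i<d. F i j)"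
    by (simp add: sum.cartesian_product case_prod_unfold)
  then show ?thesis by (simp add: sum.swap[of "\<lambda>i j. F i j"])
qed (simp add: sum.cartesian_product case_prod_unfold)

lemma side_eq_iff: "side f g \<Longrightarrow> p = q \<longleftrightarrow> f p = f q \<and> g p = g q"
  by (auto simp: side_def prod_eq_iff)

lemma side_bound: "side f g \<Longrightarrow> p \<in> {..<d} \<times> {..<d} \<Longrightarrow> f p < d \<and> g p < d"
  by (auto simp: side_def)

lemma unitary_local_lift:
  assumes fg: "side f g" and U: "unitary_on {..<d} U"
  shows "unitary_on ({..<d} \<times> {..<d}) (local_lift f g U)"
  unfolding unitary_on_def
proof (intro ballI conjI)
  fix p q assume pq: "p \<in> {..<d} \<times> {..<d}" "q \<in> {..<d} \<times> {..<d}"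
  have b: "f p \<in> {..<d}" "f q \<in> {..<d}" "g p < d" "g q < d" using side_bound[OF fg] pq by auto
  have "(\<Sum>r\<in>{..<d} \<times> {..<d}. cnj (local_lift f g U r p) * local_lift f g U r q)
      = (\<Sum>i<d. \<Sum>j<d. cnj (U i (f p) * of_bool (j = g p)) * (U i (f q) * of_bool (j = g q)))"
    unfolding local_lift_def by (rule sum_side[OF fg])
  also have "\<dots> = (\<Sum>i<d. \<Sum>j<d. if j = g p then cnj (U i (f p)) * U i (f q) * of_bool (g p = g q) else 0)"
    by (intro sum.cong refl) auto
  also have "\<dots> = (\<Sum>i<d. cnj (U i (f p)) * U i (f q)) * of_bool (g p = g q)"
    using b by (simp add: sum_distrib_right)
  finally show "(\<Sum>r\<in>{..<d} \<times> {..<d}. cnj (local_lift f g U r p) * local_lift f g U r q) = (if p = q then 1 else 0)"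
    unfolding unitary_onD(1)[OF U b(1,2)] by (simp add: side_eq_iff[OF fg, of p q])
  have "(\<Sum>r\<in>{..<d} \<times> {..<d}. local_lift f g U p r * cnj (local_lift f g U q r))
      = (\<Sum>i<d. \<Sum>j<d. (U (f p) i * of_bool (g p = j)) * cnj (U (f q) i * of_bool (g q = j)))"
    unfolding local_lift_def by (rule sum_side[OF fg])
  also have "\<dots> = (\<Sum>i<d. \<Sum>j<d. if j = g p then U (f p) i * cnj (U (f q) i) * of_bool (g p = g q) else 0)"
    by (intro sum.cong refl) auto
  also have "\<dots> = (\<Sum>i<d. U (f p) i * cnj (U (f q) i)) * of_bool (g p = g q)"
    using b by (simp add: sum_distrib_right)
  finally show "(\<Sum>r\<in>{..<d} \<times> {..<d}. local_lift f g U p r * cnj (local_lift f g U q r)) = (if p = q then 1 else 0)"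
    unfolding unitary_onD(2)[OF U b(1,2)] by (simp add: side_eq_iff[OF fg, of p q])
qed

lemma orthonormal_unitary:
  assumes "orthonormal_family d s a" "unitary_on {..<d} U"
  shows "orthonormal_family d s (\<lambda>k i. \<Sum>x<d. U i x * a k x)"
proof -
  have "(\<Sum>i<d. cnj (\<Sum>x<d. U i x * a k x) * (\<Sum>x<d. U i x * a l x)) = (\<Sum>x<d. cnj (a k x) * a l x)" for k l
    by (rule isometry_inner[OF finite_lessThan]) (rule unitary_onD(1)[OF assms(2)])
  then show ?thesis using assms(1) by (simp only: orthonormal_family_def)
qed

lemma preserves_local_lift:
  assumes fg: "side f g" and U: "unitary_on {..<d} U"
  shows "preserves_states d (local_lift f g U) (uniform_schmidt_states d s)"
  unfolding preserves_states_def
proof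
  fix \<psi> assume "\<psi> \<in> uniform_schmidt_states d s"
  then obtain a b where ab: "orthonormal_family d s a" "orthonormal_family d s b"
    and \<psi>: "\<And>i j. \<psi> (i, j) = (if i < d \<and> j < d
                 then (\<Sum>k<s. complex_of_real (1 / sqrt (real s)) * a k i * b k j) else 0)"
    unfolding uniform_schmidt_states_def by blast
  let ?c = "complex_of_real (1 / sqrt (real s))" and ?D = "{..<d} \<times> {..<d}"
  obtain A B where AB: "orthonormal_family d s A" "orthonormal_family d s B"
    and AB\<psi>: "\<And>p. p \<in> ?D \<Longrightarrow> \<psi> p = (\<Sum>k<s. ?c * A k (f p) * B k (g p))"
  proof -
    consider "f = fst" "g = snd" | "f = snd" "g = fst" using fg unfolding side_def by blast
    then show ?thesis
    proof cases
      case 1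
      then show ?thesis using ab by (intro that[of a b]) (auto simp: \<psi>)
    next
      case 2
      then show ?thesis using ab by (intro that[of b a]) (auto simp: \<psi> mult_ac)
    qed
  qed
  define A' where "A' k i = (\<Sum>x<d. U i x * A k x)" for k i
  define \<psi>' where "\<psi>' p = (if p \<in> ?D then (\<Sum>k<s. ?c * A' k (f p) * B k (g p)) else 0)" for p
  have A': "orthonormal_family d s A'" unfolding A'_def[abs_def] by (rule orthonormal_unitary[OF AB(1) U])
  have "\<psi>' \<in> uniform_schmidt_states d s"
    using fg unfolding side_def
  proof (elim disjE conjE)
    assume "f = fst" "g = snd"
    then show ?thesis
      unfolding uniform_schmidt_states_def mem_Collect_eq
      by (intro exI[of _ A'] exI[of _ B] conjI A' AB) (simp add: \<psi>'_def)
  next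
    assume "f = snd" "g = fst"
    then show ?thesis
      unfolding uniform_schmidt_states_def mem_Collect_eq
      by (intro exI[of _ B] exI[of _ A'] conjI A' AB) (simp add: \<psi>'_def mult_ac)
  qed
  moreover have "\<psi>' p = (\<Sum>q\<in>?D. local_lift f g U p q * \<psi> q)" if p: "p \<in> ?D" for p
  proof -
    have "(\<Sum>q\<in>?D. local_lift f g U p q * \<psi> q)
        = (\<Sum>q\<in>?D. U (f p) (f q) * of_bool (g p = g q) * (\<Sum>k<s. ?c * A k (f q) * B k (g q)))"
      by (intro sum.cong refl) (simp add: local_lift_def AB\<psi>)
    also have "\<dots> = (\<Sum>x<d. \<Sum>y<d. U (f p) x * of_bool (g p = y) * (\<Sum>k<s. ?c * A k x * B k y))"
      by (rule sum_side[OF fg])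
    also have "\<dots> = (\<Sum>x<d. \<Sum>y<d. if y = g p then U (f p) x * (\<Sum>k<s. ?c * A k x * B k y) else 0)"
      by (intro sum.cong refl) auto
    also have "\<dots> = (\<Sum>x<d. \<Sum>k<s. ?c * (U (f p) x * A k x) * B k (g p))"
      using side_bound[OF fg p] by (simp add: sum_distrib_left mult_ac)
    also have "\<dots> = (\<Sum>k<s. \<Sum>x<d. ?c * (U (f p) x * A k x) * B k (g p))" by (rule sum.swap)
    also have "\<dots> = \<psi>' p"
      unfolding \<psi>'_def A'_def using p by (simp add: sum_distrib_left sum_distrib_right)
    finally show ?thesis ..
  qed
  ultimately show "\<exists>\<psi>'\<in>uniform_schmidt_states d s.
      \<forall>p\<in>?D. \<psi>' p = (\<Sum>q\<in>?D. local_lift f g U p q * \<psi> q)" by blast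
qed

lemma cnj_of_bool: "cnj (of_bool P) = of_bool P"
  by (cases P) simp_all

text \<open>The phase 1 + t on the line of a unit vector u and the identity on its complement. It is
  affine in t, so invariance under its tensor powers is a polynomial identity in t.\<close>

definition phase_unitary :: "(nat \<Rightarrow> complex) \<Rightarrow> complex \<Rightarrow> nat \<Rightarrow> nat \<Rightarrow> complex" where
  "phase_unitary u t i j = of_bool (i = j) + t * (u i * cnj (u j))"

lemma unitary_phase_unitary:
  assumes u: "(\<Sum>i<d. cnj (u i) * u i) = 1" and t: "cmod (1 + t) = 1"
  shows "unitary_on {..<d} (phase_unitary u t)"
proof -
  have "(1 + t) * cnj (1 + t) = 1" unfolding cmod_square[symmetric] t by simp
  then have tt: "t + cnj t + t * cnj t = 0" by (simp add: algebra_simps)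
  have gen: "(\<Sum>a<d. (of_bool (a = x) + r * (cnj (u a) * u x)) * (of_bool (a = y) + r' * (u a * cnj (u y))))
      = (if x = y then 1 else 0)" if xy: "x < d" "y < d" and rr: "r + r' + r * r' = 0" for x y r r'
  proof -
    have "(\<Sum>a<d. (of_bool (a = x) + r * (cnj (u a) * u x)) * (of_bool (a = y) + r' * (u a * cnj (u y))))
        = (\<Sum>a<d. (if a = x then of_bool (x = y) + r' * (u x * cnj (u y)) else 0)
            + (if a = y then r * (cnj (u y) * u x) else 0) + r * r' * (u x * cnj (u y)) * (cnj (u a) * u a))"
      by (intro sum.cong refl) (auto simp: algebra_simps)
    also have "\<dots> = of_bool (x = y) + (r + r' + r * r') * (u x * cnj (u y))"
      unfolding sum.distrib sum_distrib_left[symmetric] u using xy by (simp add: algebra_simps)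
    finally show ?thesis using rr by simp
  qed
  show ?thesis
    unfolding unitary_on_def
  proof (intro ballI conjI)
    fix x y assume xy: "x \<in> {..<d}" "y \<in> {..<d}"
    have e: "cnj (phase_unitary u t a x) = of_bool (a = x) + cnj t * (cnj (u a) * u x)"
      "phase_unitary u t a y = of_bool (a = y) + t * (u a * cnj (u y))"
      "phase_unitary u t x a = of_bool (a = x) + t * (cnj (u a) * u x)"
      "cnj (phase_unitary u t y a) = of_bool (a = y) + cnj t * (u a * cnj (u y))" for a
      by (auto simp: phase_unitary_def cnj_of_bool)
    show "(\<Sum>a<d. cnj (phase_unitary u t a x) * phase_unitary u t a y) = (if x = y then 1 else 0)"
      unfolding e using xy tt by (intro gen) (auto simp: algebra_simps)
    show "(\<Sum>a<d. phase_unitary u t x a * cnj (phase_unitary u t y a)) = (if x = y then 1 else 0)"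
      unfolding e using xy tt by (intro gen) auto
  qed
qed

subsection \<open>Linearisation of the invariance at the identity\<close>

definition one_particle :: "nat \<Rightarrow> (nat \<times> nat \<Rightarrow> nat \<times> nat \<Rightarrow> complex) \<Rightarrow>
    (nat \<times> nat) list \<Rightarrow> (nat \<times> nat) list \<Rightarrow> complex" where
  "one_particle n m x y = (\<Sum>l<n. m (x ! l) (y ! l) * (\<Prod>k\<in>{..<n} - {l}. of_bool (x ! k = y ! k)))"

definition tensor_comm :: "nat \<Rightarrow> nat \<Rightarrow> ((nat \<times> nat) list \<Rightarrow> (nat \<times> nat) list \<Rightarrow> complex) \<Rightarrow>
    (nat \<times> nat \<Rightarrow> nat \<times> nat \<Rightarrow> complex) \<Rightarrow> bool" where
  "tensor_comm d n T m \<longleftrightarrow> (\<forall>x\<in>copy_indices d n. \<forall>y\<in>copy_indices d n.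
     (\<Sum>a\<in>copy_indices d n. one_particle n m x a * T a y) = (\<Sum>b\<in>copy_indices d n. T x b * one_particle n m b y))"

lemma coeff_1_prod_linear:
  fixes a b :: "'i \<Rightarrow> complex"
  assumes "finite A"
  shows "coeff (\<Prod>i\<in>A. [:a i, b i:]) 1 = (\<Sum>i\<in>A. b i * (\<Prod>k\<in>A - {i}. a k))"
proof -
  have "coeff p 1 = poly (pderiv p) 0" for p :: "complex poly"
    by (simp add: poly_0_coeff_0 coeff_pderiv)
  then show ?thesis
    by (simp add: pderiv_prod poly_sum poly_prod pderiv_pCons mult.commute)
qed

text \<open>A circle with only c points could not hold the c + 1 roots of z^(c+1) = 1.\<close>

lemma infinite_unit_circle: "infinite {t. cmod (1 + t) = 1}"
proof
  assume "finite {t. cmod (1 + t) = 1}"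
  moreover have "(\<lambda>z. z - 1) ` {z. cmod z = 1} \<subseteq> {t. cmod (1 + t) = 1}" by auto
  ultimately have "finite ((\<lambda>z. z - 1) ` {z. cmod z = 1})" by (rule rev_finite_subset)
  then have fin: "finite {z. cmod z = 1}" by (rule finite_imageD) (simp add: inj_on_def)
  define c where "c = card {z. cmod z = 1}"
  have "cmod z = 1" if "z ^ Suc c = 1" for z :: complex
  proof -
    have "cmod z ^ Suc c = 1 ^ Suc c" using that by (metis norm_one norm_power power_one)
    then show ?thesis by (rule power_eq_imp_eq_base) auto
  qed
  then have "card {z::complex. z ^ Suc c = 1} \<le> c"
    unfolding c_def by (intro card_mono fin) blast
  then show False using card_roots_unity_eq[of "Suc c"] by simp
qed

text \<open>Both sides are polynomials in t that agree on an infinite set, hence in the coefficient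
  of t, which is the derivation \<open>one_particle\<close>. No exponentials or derivatives of
  unitaries are needed.\<close>

lemma tensor_comm_of_phases:
  assumes "\<And>t x y. cmod (1 + t) = 1 \<Longrightarrow> x \<in> copy_indices d n \<Longrightarrow> y \<in> copy_indices d n \<Longrightarrow>
    (\<Sum>a\<in>copy_indices d n. tensor_matrix n (\<lambda>p q. of_bool (p = q) + t * m p q) x a * T a y)
    = (\<Sum>b\<in>copy_indices d n. T x b * tensor_matrix n (\<lambda>p q. of_bool (p = q) + t * m p q) b y)"
  shows "tensor_comm d n T m"
  unfolding tensor_comm_def
proof (intro ballI)
  let ?I = "copy_indices d n"
  fix x y assume xy: "x \<in> ?I" "y \<in> ?I"
  define P where "P x a = (\<Prod>l<n. [:of_bool (x ! l = a ! l), m (x ! l) (a ! l):])" for x a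
  have poly: "poly (P x a) t = tensor_matrix n (\<lambda>p q. of_bool (p = q) + t * m p q) x a" for x a t
    by (simp add: P_def poly_prod tensor_matrix_def)
  have coeff: "coeff (P x a) 1 = one_particle n m x a" for x a
    unfolding P_def one_particle_def by (rule coeff_1_prod_linear) simp
  define C where "C = (\<Sum>a\<in>?I. smult (T a y) (P x a)) - (\<Sum>b\<in>?I. smult (T x b) (P b y))"
  have "poly C t = 0" if "cmod (1 + t) = 1" for t
    using assms[OF that xy] by (simp add: C_def poly_sum poly mult.commute)
  then have "{t. cmod (1 + t) = 1} \<subseteq> {t. poly C t = 0}" by blast
  then have "C = 0" using infinite_unit_circle poly_roots_finite finite_subset by blast
  then have "coeff C 1 = 0" by simp
  then show "(\<Sum>a\<in>?I. one_particle n m x a * T a y) = (\<Sum>b\<in>?I. T x b * one_particle n m b y)"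
    by (simp add: C_def coeff_sum coeff[unfolded One_nat_def] mult.commute)
qed

lemma one_particle_linear:
  "one_particle n (\<lambda>p q. \<alpha> * m p q + \<beta> * m' p q) x y = \<alpha> * one_particle n m x y + \<beta> * one_particle n m' x y"
  unfolding one_particle_def sum_distrib_left sum.distrib[symmetric]
  by (intro sum.cong refl) (simp add: algebra_simps)

lemma tensor_comm_linear:
  assumes "tensor_comm d n T m" "tensor_comm d n T m'"
  shows "tensor_comm d n T (\<lambda>p q. \<alpha> * m p q + \<beta> * m' p q)"
  using assms unfolding tensor_comm_def one_particle_linear
  by (simp add: distrib_left distrib_right sum.distrib mult.assoc mult.left_commute[of _ \<alpha>]
      mult.left_commute[of _ \<beta>] sum_distrib_left[symmetric])

text \<open>Polarisation: the linearised relation is complex linear in the one-particle matrix, and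
  rank-one projections span all matrices.\<close>

lemma tensor_comm_matrix_unit:
  assumes fg: "side f g" and ab: "a < d" "b < d"
    and u: "\<And>u. (\<Sum>i<d. cnj (u i) * u i) = 1 \<Longrightarrow> tensor_comm d n T (local_lift f g (\<lambda>i j. u i * cnj (u j)))"
  shows "tensor_comm d n T (local_lift f g (\<lambda>i j. of_bool (i = a \<and> j = b)))"
proof -
  let ?e = "\<lambda>a b i j :: nat. of_bool (i = a \<and> j = b) :: complex"
  have diag: "tensor_comm d n T (local_lift f g (?e a a))" if "a < d" for a
  proof -
    have "(\<Sum>i<d. cnj (of_bool (i = a)) * of_bool (i = a)) = (1 :: complex)"
      using that by (simp add: of_bool_def if_distrib cong: if_cong)
    from u[OF this] show ?thesis by (simp add: of_bool_conj cnj_of_bool)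
  qed
  show ?thesis
  proof (cases "a = b")
    case True
    then show ?thesis using diag ab by simp
  next
    case False
    have two: "complex_of_real (sqrt 2) * complex_of_real (sqrt 2) = 2"
      unfolding of_real_mult[symmetric] by simp
    have polar: "tensor_comm d n T (local_lift f g (\<lambda>i j. (of_bool (i = a) + \<eta> * of_bool (i = b))
          * (of_bool (j = a) + cnj \<eta> * of_bool (j = b)) / 2))" if \<eta>: "cnj \<eta> * \<eta> = 1" for \<eta>
    proof -
      define u where "u i = (of_bool (i = a) + \<eta> * of_bool (i = b)) / complex_of_real (sqrt 2)" for i
      have "(\<Sum>i<d. cnj (u i) * u i) = (\<Sum>i<d. (if i = a then 1 / 2 else 0) + (if i = b then 1 / 2 else 0))"
        using False \<eta> two by (intro sum.cong refl) (auto simp: u_def)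
      also have "\<dots> = 1" using ab by (simp add: sum.distrib)
      finally show ?thesis using u[of u] by (simp add: u_def two cnj_of_bool)
    qed
    \<comment> \<open>Weight 1 for \<eta> = 1 and weight i for \<eta> = i double the (a, b) entry
      and cancel (b, a); what remains is (1 + i) / 2 on both diagonal entries, subtracted
      here.\<close>
    have "local_lift f g (?e a b) = (\<lambda>p q.
          1 * (1 * local_lift f g (\<lambda>i j. (of_bool (i = a) + 1 * of_bool (i = b)) * (of_bool (j = a) + cnj 1 * of_bool (j = b)) / 2) p q
          + \<i> * local_lift f g (\<lambda>i j. (of_bool (i = a) + \<i> * of_bool (i = b)) * (of_bool (j = a) + cnj \<i> * of_bool (j = b)) / 2) p q)
        + 1 * (- (1 + \<i>) / 2 * local_lift f g (?e a a) p q + - (1 + \<i>) / 2 * local_lift f g (?e b b) p q))"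
      using False by (intro ext) (auto simp: local_lift_def of_bool_def field_simps)
    moreover have "tensor_comm d n T \<dots>"
      by (intro tensor_comm_linear polar diag ab) auto
    ultimately show ?thesis by simp
  qed
qed

subsection \<open>The real matrix of an invariant tester\<close>

definition zip_words :: "nat \<Rightarrow> word \<Rightarrow> word \<Rightarrow> (nat \<times> nat) list" where
  "zip_words n w v = map (\<lambda>l. (w l, v l)) [0..<n]"

lemma zip_words_nth [simp]: "l < n \<Longrightarrow> zip_words n w v ! l = (w l, v l)"
  by (simp add: zip_words_def)

lemma words_eq_iff: "w \<in> words d d n \<Longrightarrow> u \<in> words d d n \<Longrightarrow> w = u \<longleftrightarrow> (\<forall>l<n. w l = u l)"
  by (auto simp: words_def fun_eq_iff) (metis not_less)

lemma zip_words_in: "w \<in> words d d n \<Longrightarrow> v \<in> words d d n \<Longrightarrow> zip_words n w v \<in> copy_indices d n"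
  by (auto simp: zip_words_def copy_indices_def words_def)

definition unzip_word :: "nat \<Rightarrow> nat \<Rightarrow> (nat \<times> nat \<Rightarrow> nat) \<Rightarrow> (nat \<times> nat) list \<Rightarrow> word" where
  "unzip_word d n f xs l = (if l < n then f (xs ! l) else d + l)"

lemma unzip_zip:
  assumes "w \<in> words d d n" "v \<in> words d d n"
  shows "unzip_word d n fst (zip_words n w v) = w" "unzip_word d n snd (zip_words n w v) = v"
  using assms by (auto simp: unzip_word_def fun_eq_iff words_def)

lemma sum_zip_words:
  "(\<Sum>x\<in>copy_indices d n. F x) = (\<Sum>w\<in>words d d n. \<Sum>v\<in>words d d n. F (zip_words n w v))"
proof -
  have "(\<Sum>x\<in>copy_indices d n. F x) = (\<Sum>(w, v)\<in>words d d n \<times> words d d n. F (zip_words n w v))"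
  proof (rule sum.reindex_bij_witness[of _ "\<lambda>(w, v). zip_words n w v" "\<lambda>x. (unzip_word d n fst x, unzip_word d n snd x)"], goal_cases)
    case (1 x)
    then show ?case
      by (auto simp: zip_words_def unzip_word_def copy_indices_def intro!: nth_equalityI)
  next
    case (2 x)
    then show ?case using copy_indices_nth[OF 2] by (auto simp: unzip_word_def words_def mem_Times_iff)
  next
    case (3 p) then show ?case by (auto simp: unzip_zip)
  next
    case (4 p) then show ?case by (auto simp: zip_words_in)
  next
    case (5 x)
    then show ?case
      by (auto intro!: arg_cong[of _ _ F] nth_equalityI simp: zip_words_def unzip_word_def copy_indices_def)
  qed
  then show ?thesis by (simp add: sum.cartesian_product)
qed

lemma prod_of_bool: "finite A \<Longrightarrow> (\<Prod>k\<in>A. of_bool (P k)) = (of_bool (\<forall>k\<in>A. P k) :: 'a :: comm_semiring_1)"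
  by (induction A rule: finite_induct) auto

lemma one_particle_words_aux:
  assumes W: "w \<in> words d d n" "v \<in> words d d n" "u \<in> words d d n" "s \<in> words d d n"
    and m: "\<And>l. l < n \<Longrightarrow> m (w l, v l) (u l, s l) = of_bool ((w l = a \<and> u l = b) \<and> v l = s l)"
  shows "(\<Sum>l<n. m (w l, v l) (u l, s l) * (\<Prod>k\<in>{..<n} - {l}. of_bool ((w k, v k) = (u k, s k))))
      = complex_of_real (one_site n a b w u * of_bool (v = s))"
proof -
  have "m (w l, v l) (u l, s l) * (\<Prod>k\<in>{..<n} - {l}. of_bool ((w k, v k) = (u k, s k)))
      = complex_of_real (of_bool (w l = a \<and> u l = b \<and> (\<forall>k. k \<noteq> l \<longrightarrow> w k = u k)) * of_bool (v = s))"
    if l: "l < n" for l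
  proof -
    have "(\<forall>k. k \<noteq> l \<longrightarrow> w k = u k) \<longleftrightarrow> (\<forall>k\<in>{..<n} - {l}. w k = u k)"
    proof safe
      fix k assume *: "\<forall>k\<in>{..<n} - {l}. w k = u k" "k \<noteq> l"
      show "w k = u k"
      proof (cases "k < n")
        case False
        then show ?thesis using W(1,3) by (simp add: words_def)
      qed (use * in simp)
    qed auto
    moreover have "v = s \<longleftrightarrow> v l = s l \<and> (\<forall>k\<in>{..<n} - {l}. v k = s k)"
      unfolding words_eq_iff[OF W(2,4)] using l by blast
    ultimately have "((w l = a \<and> u l = b) \<and> v l = s l) \<and> (\<forall>k\<in>{..<n} - {l}. (w k, v k) = (u k, s k))
        \<longleftrightarrow> (w l = a \<and> u l = b \<and> (\<forall>k. k \<noteq> l \<longrightarrow> w k = u k)) \<and> v = s" by auto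
    then show ?thesis
      unfolding m[OF l] prod_of_bool[OF finite_Diff[OF finite_lessThan]]
      by (simp only: of_bool_conj[symmetric]) simp
  qed
  then show ?thesis
    unfolding one_site_def sum_distrib_right of_real_sum by (intro sum.cong refl) simp
qed

lemma one_particle_words:
  assumes W: "w \<in> words d d n" "v \<in> words d d n" "u \<in> words d d n" "s \<in> words d d n"
  shows "one_particle n (local_lift fst snd (\<lambda>i j. of_bool (i = a \<and> j = b))) (zip_words n w v) (zip_words n u s)
      = of_real (one_site n a b w u * of_bool (v = s))"
    "one_particle n (local_lift snd fst (\<lambda>i j. of_bool (i = a \<and> j = b))) (zip_words n w v) (zip_words n u s)
      = of_real (one_site n a b v s * of_bool (w = u))"
proof -
  have e: "one_particle n m (zip_words n w v) (zip_words n u s)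
      = (\<Sum>l<n. m (w l, v l) (u l, s l) * (\<Prod>k\<in>{..<n} - {l}. of_bool ((w k, v k) = (u k, s k))))" for m
    unfolding one_particle_def by (intro sum.cong refl arg_cong2[of _ _ _ _ "(*)"] prod.cong) auto
  show "one_particle n (local_lift fst snd (\<lambda>i j. of_bool (i = a \<and> j = b))) (zip_words n w v) (zip_words n u s)
      = of_real (one_site n a b w u * of_bool (v = s))"
    unfolding e by (rule one_particle_words_aux[OF W]) (simp add: local_lift_def of_bool_conj)
  have "one_particle n (local_lift snd fst (\<lambda>i j. of_bool (i = a \<and> j = b))) (zip_words n w v) (zip_words n u s)
      = (\<Sum>l<n. local_lift fst snd (\<lambda>i j. of_bool (i = a \<and> j = b)) (v l, w l) (s l, u l)
          * (\<Prod>k\<in>{..<n} - {l}. of_bool ((v k, w k) = (s k, u k))))"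
    unfolding e by (intro sum.cong refl arg_cong2[of _ _ _ _ "(*)"] prod.cong) (auto simp: local_lift_def)
  also have "\<dots> = of_real (one_site n a b v s * of_bool (w = u))"
    by (rule one_particle_words_aux[OF W(2,1,4,3)]) (simp add: local_lift_def of_bool_conj)
  finally show "one_particle n (local_lift snd fst (\<lambda>i j. of_bool (i = a \<and> j = b))) (zip_words n w v) (zip_words n u s)
      = of_real (one_site n a b v s * of_bool (w = u))" .
qed

lemma sum_of_bool_eq:
  assumes "finite W" "t \<in> W"
  shows "(\<Sum>s\<in>W. of_bool (t = s) * F s) = (F t :: 'a :: comm_semiring_1)"
    "(\<Sum>s\<in>W. F s * of_bool (s = t)) = (F t :: 'a :: comm_semiring_1)"
  using assms by (simp_all add: of_bool_def if_distrib if_distribR cong: if_cong)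

text \<open>The entries of \<open>one_site\<close> are real, so the relations pass to the real part
  of T, and the spectator word is simply frozen.\<close>

lemma tensor_comm_words:
  fixes T :: "(nat \<times> nat) list \<Rightarrow> (nat \<times> nat) list \<Rightarrow> complex"
  assumes "w \<in> words d d n" "v \<in> words d d n" "x \<in> words d d n" "t \<in> words d d n"
  defines "Q \<equiv> \<lambda>w v x t. Re (T (zip_words n w v) (zip_words n x t))"
  shows "tensor_comm d n T (local_lift fst snd (\<lambda>i j. of_bool (i = a \<and> j = b))) \<Longrightarrow>
      (\<Sum>u\<in>words d d n. one_site n a b w u * Q u v x t) = (\<Sum>u\<in>words d d n. Q w v u t * one_site n a b u x)"
    and "tensor_comm d n T (local_lift snd fst (\<lambda>i j. of_bool (i = a \<and> j = b))) \<Longrightarrow>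
      (\<Sum>u\<in>words d d n. one_site n a b v u * Q w u x t) = (\<Sum>u\<in>words d d n. Q w v x u * one_site n a b u t)"
proof -
  let ?W = "words d d n" and ?z = "zip_words n"
  have fin: "finite ?W" by (rule finite_words)
  have ob: "complex_of_real (of_bool P) = of_bool P" for P by (cases P) simp_all
  note in_I = zip_words_in[OF assms(1,2)] zip_words_in[OF assms(3,4)]
  {
    let ?m = "local_lift fst snd (\<lambda>i j. of_bool (i = a \<and> j = b))"
    assume "tensor_comm d n T ?m"
    then have "(\<Sum>y\<in>copy_indices d n. one_particle n ?m (?z w v) y * T y (?z x t))
        = (\<Sum>y\<in>copy_indices d n. T (?z w v) y * one_particle n ?m y (?z x t))"
      unfolding tensor_comm_def using in_I by blast
    then have "(\<Sum>u\<in>?W. \<Sum>s\<in>?W. of_bool (v = s) * (of_real (one_site n a b w u) * T (?z u s) (?z x t)))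
        = (\<Sum>u\<in>?W. \<Sum>s\<in>?W. (T (?z w v) (?z u s) * of_real (one_site n a b u x)) * of_bool (s = t))"
      unfolding sum_zip_words using assms(1-4)
      by (simp add: one_particle_words mult_ac ob cong: sum.cong)
    then have "(\<Sum>u\<in>?W. of_real (one_site n a b w u) * T (?z u v) (?z x t))
        = (\<Sum>u\<in>?W. T (?z w v) (?z u t) * of_real (one_site n a b u x))"
      by (simp only: sum_of_bool_eq[OF fin assms(2)] sum_of_bool_eq[OF fin assms(4)])
    then have "Re (\<Sum>u\<in>?W. of_real (one_site n a b w u) * T (?z u v) (?z x t))
        = Re (\<Sum>u\<in>?W. T (?z w v) (?z u t) * of_real (one_site n a b u x))" by (rule arg_cong)
    then show "(\<Sum>u\<in>?W. one_site n a b w u * Q u v x t) = (\<Sum>u\<in>?W. Q w v u t * one_site n a b u x)"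
      by (simp add: Q_def)
  next
    let ?m = "local_lift snd fst (\<lambda>i j. of_bool (i = a \<and> j = b))"
    assume "tensor_comm d n T ?m"
    then have "(\<Sum>y\<in>copy_indices d n. one_particle n ?m (?z w v) y * T y (?z x t))
        = (\<Sum>y\<in>copy_indices d n. T (?z w v) y * one_particle n ?m y (?z x t))"
      unfolding tensor_comm_def using in_I by blast
    then have "(\<Sum>u\<in>?W. \<Sum>s\<in>?W. of_bool (w = u) * (of_real (one_site n a b v s) * T (?z u s) (?z x t)))
        = (\<Sum>u\<in>?W. \<Sum>s\<in>?W. (T (?z w v) (?z u s) * of_real (one_site n a b s t)) * of_bool (u = x))"
      unfolding sum_zip_words using assms(1-4)
      by (simp add: one_particle_words mult_ac ob cong: sum.cong)
    then have "(\<Sum>u\<in>?W. of_bool (w = u) * (\<Sum>s\<in>?W. of_real (one_site n a b v s) * T (?z u s) (?z x t)))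
        = (\<Sum>u\<in>?W. (\<Sum>s\<in>?W. T (?z w v) (?z u s) * of_real (one_site n a b s t)) * of_bool (u = x))"
      by (simp only: sum_distrib_left sum_distrib_right)
    then have "(\<Sum>s\<in>?W. of_real (one_site n a b v s) * T (?z w s) (?z x t))
        = (\<Sum>s\<in>?W. T (?z w v) (?z x s) * of_real (one_site n a b s t))"
      by (simp only: sum_of_bool_eq[OF fin assms(1)] sum_of_bool_eq[OF fin assms(3)])
    then have "Re (\<Sum>s\<in>?W. of_real (one_site n a b v s) * T (?z w s) (?z x t))
        = Re (\<Sum>s\<in>?W. T (?z w v) (?z x s) * of_real (one_site n a b s t))" by (rule arg_cong)
    then show "(\<Sum>u\<in>?W. one_site n a b v u * Q w u x t) = (\<Sum>u\<in>?W. Q w v x u * one_site n a b u t)"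
      by (simp add: Q_def)
  }
qed

text \<open>Real test vectors see only the real part of the matrix.\<close>

lemma qform_words:
  fixes \<phi> :: "word \<Rightarrow> word \<Rightarrow> real"
  assumes "\<And>w v. w \<in> words d d n \<Longrightarrow> v \<in> words d d n \<Longrightarrow> f (zip_words n w v) = of_real (\<phi> w v)"
  shows "Re (qform (copy_indices d n) T f)
    = quad (words d d n) (\<lambda>w v x t. Re (T (zip_words n w v) (zip_words n x t))) \<phi>"
proof -
  have "qform (copy_indices d n) T f = (\<Sum>w\<in>words d d n. \<Sum>v\<in>words d d n. \<Sum>x\<in>words d d n. \<Sum>t\<in>words d d n.
        of_real (\<phi> w v) * T (zip_words n w v) (zip_words n x t) * of_real (\<phi> x t))"
    unfolding qform_def sum_zip_words by (intro sum.cong refl) (simp add: assms)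
  then show ?thesis by (simp add: quad_def mult_ac)
qed

definition std_state :: "nat \<Rightarrow> nat \<times> nat \<Rightarrow> complex" where
  "std_state k = (\<lambda>(i, j). of_real (of_bool (i = j \<and> i < k) / sqrt (real k)))"

lemma std_state_in: "k \<le> d \<Longrightarrow> std_state k \<in> uniform_schmidt_states d k"
proof -
  assume k: "k \<le> d"
  let ?a = "\<lambda>l i :: nat. of_bool (l = i) :: complex"
  have on: "orthonormal_family d k ?a"
    unfolding orthonormal_family_def
  proof (intro allI impI)
    fix l m assume lm: "l < k" "m < k"
    have "(\<Sum>i<d. cnj (of_bool (l = i)) * of_bool (m = i)) = (\<Sum>i<d. of_bool (m = i) * (of_bool (l = i) :: complex))"
      by (simp add: cnj_of_bool mult.commute)
    also have "\<dots> = (if l = m then 1 else 0)"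
      using lm k by (subst sum_of_bool_eq) auto
    finally show "(\<Sum>i<d. cnj (?a l i) * ?a m i) = (if l = m then 1 else 0)" .
  qed
  have "std_state k (i, j) = (if i < d \<and> j < d
      then (\<Sum>l<k. complex_of_real (1 / sqrt (real k)) * ?a l i * ?a l j) else 0)" for i j
  proof (cases "i < k")
    case True
    have "(\<Sum>l<k. complex_of_real (1 / sqrt (real k)) * ?a l i * ?a l j)
        = (\<Sum>l<k. (complex_of_real (1 / sqrt (real k)) * ?a l j) * of_bool (l = i))"
      by (simp add: mult_ac)
    also have "\<dots> = complex_of_real (1 / sqrt (real k)) * of_bool (i = j)"
      using True by (subst sum_of_bool_eq) auto
    finally show ?thesis using True k by (auto simp: std_state_def)
  next
    case False
    then have "(\<Sum>l<k. complex_of_real (1 / sqrt (real k)) * ?a l i * ?a l j) = 0"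
      by (intro sum.neutral) auto
    then show ?thesis using False by (simp add: std_state_def)
  qed
  then show ?thesis
    unfolding uniform_schmidt_states_def mem_Collect_eq using on by blast
qed

lemma accept_std_state:
  assumes k: "k \<le> d"
  shows "accept_prob d n T (std_state k)
    = (\<Sum>w\<in>words d k n. \<Sum>v\<in>words d k n. Re (T (zip_words n w w) (zip_words n v v))) / real k ^ n"
proof -
  let ?W = "words d d n" and ?V = "words d k n" and ?z = "zip_words n"
  define \<phi> where "\<phi> w v = of_bool (w = v) * (of_bool (w \<in> ?V) / sqrt (real k) ^ n)" for w v
  have fin: "finite ?W" by (rule finite_words)
  have sub: "?V \<subseteq> ?W" by (rule words_mono[OF k])
  have tp: "tensor_power n (std_state k) (?z w v) = of_real (\<phi> w v)" if "w \<in> ?W" "v \<in> ?W" for w v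
  proof -
    have V: "w \<in> ?V \<longleftrightarrow> (\<forall>l<n. w l < k)" using that by (auto simp: words_def)
    have "tensor_power n (std_state k) (?z w v) = of_real (\<Prod>l<n. of_bool (w l = v l \<and> w l < k) / sqrt (real k))"
      by (simp add: tensor_power_def std_state_def)
    also have "(\<Prod>l<n. of_bool (w l = v l \<and> w l < k) / sqrt (real k))
        = (\<Prod>l<n. of_bool (w l = v l \<and> w l < k)) / sqrt (real k) ^ n"
      by (simp add: prod_dividef)
    also have "(\<Prod>l<n. of_bool (w l = v l \<and> w l < k)) = (of_bool (w = v \<and> w \<in> ?V) :: real)"
      unfolding V words_eq_iff[OF that] prod_of_bool[OF finite_lessThan]
      by (intro arg_cong[of _ _ of_bool]) auto
    finally show ?thesis by (simp add: \<phi>_def of_bool_conj)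
  qed
  have "accept_prob d n T (std_state k) = (\<Sum>w\<in>?W. \<Sum>v\<in>?W. \<Sum>x\<in>?W. \<Sum>t\<in>?W. \<phi> w v * Re (T (?z w v) (?z x t)) * \<phi> x t)"
    unfolding accept_prob_def quad_def[symmetric] by (rule qform_words) (rule tp)
  also have "\<dots> = (\<Sum>w\<in>?W. \<Sum>v\<in>?W. of_bool (w = v) * (\<Sum>x\<in>?W. \<Sum>t\<in>?W. of_bool (x = t) *
      (of_bool (w \<in> ?V) / sqrt (real k) ^ n * Re (T (?z w v) (?z x t)) * (of_bool (x \<in> ?V) / sqrt (real k) ^ n))))"
    unfolding \<phi>_def sum_distrib_left by (simp add: mult_ac)
  also have "\<dots> = (\<Sum>w\<in>?W. \<Sum>x\<in>?W. of_bool (w \<in> ?V) / sqrt (real k) ^ n * Re (T (?z w w) (?z x x)) * (of_bool (x \<in> ?V) / sqrt (real k) ^ n))"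
    by (simp only: sum_of_bool_eq[OF fin] cong: sum.cong)
  also have "\<dots> = (\<Sum>w\<in>?W. \<Sum>x\<in>?W. if w \<in> ?V \<and> x \<in> ?V then Re (T (?z w w) (?z x x)) / real k ^ n else 0)"
    by (intro sum.cong refl) (auto simp: field_simps simp flip: power_mult_distrib)
  also have "\<dots> = (\<Sum>w\<in>?V. \<Sum>x\<in>?V. Re (T (?z w w) (?z x x)) / real k ^ n)"
  proof -
    have "(\<Sum>x\<in>?W. if w \<in> ?V \<and> x \<in> ?V then Re (T (?z w w) (?z x x)) / real k ^ n else 0)
        = (if w \<in> ?V then (\<Sum>x\<in>?V. Re (T (?z w w) (?z x x)) / real k ^ n) else 0)" for w
      using fin sub by (simp add: sum.inter_restrict[of ?W _ ?V, symmetric] Int_absorb1 inf.absorb2)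
    then show ?thesis
      using fin sub by (simp add: sum.inter_restrict[of ?W _ ?V, symmetric] Int_absorb1 inf.absorb2)
  qed
  finally show ?thesis by (simp add: sum_divide_distrib)
qed

text \<open>From here on a single state of each class is evaluated: invariance of the tester carries
  the information of all local unitary images.\<close>

theorem tester_matrix:
  fixes d n :: nat
  defines "W \<equiv> words d d n"
  assumes T: "is_tester d n (uniform_schmidt_states d r) (uniform_schmidt_states d s) T"
    and rs: "r \<le> d" "s \<le> d"
  obtains Q where "bi_invariant n W Q"
    "\<And>\<phi>. 0 \<le> quad W Q \<phi>" "\<And>\<phi>. quad W Q \<phi> \<le> (\<Sum>w\<in>W. \<Sum>v\<in>W. (\<phi> w v)\<^sup>2)"
    "2 / 3 \<le> (\<Sum>w\<in>words d r n. \<Sum>v\<in>words d r n. Q w w v v) / real r ^ n"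
    "(\<Sum>w\<in>words d s n. \<Sum>v\<in>words d s n. Q w w v v) / real s ^ n \<le> 1 / 3"
proof -
  let ?I = "copy_indices d n"
  obtain T0 where T0: "is_tester d n (uniform_schmidt_states d r) (uniform_schmidt_states d s) T0"
    and inv: "\<And>\<kappa> x y. unitary_on ({..<d} \<times> {..<d}) \<kappa> \<Longrightarrow>
      preserves_states d \<kappa> (uniform_schmidt_states d r) \<Longrightarrow> preserves_states d \<kappa> (uniform_schmidt_states d s) \<Longrightarrow>
      x \<in> ?I \<Longrightarrow> y \<in> ?I \<Longrightarrow>
      (\<Sum>a\<in>?I. tensor_matrix n \<kappa> x a * T0 a y) = (\<Sum>b\<in>?I. T0 x b * tensor_matrix n \<kappa> b y)"
    using invariant_tester_exists[OF T] by blast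
  define Q where "Q w v x t = Re (T0 (zip_words n w v) (zip_words n x t))" for w v x t
  have comm: "tensor_comm d n T0 (local_lift f g (\<lambda>i j. of_bool (i = a \<and> j = b)))"
    if fg: "side f g" and ab: "a < d" "b < d" for f g a b
  proof (rule tensor_comm_matrix_unit[OF fg ab])
    fix u assume u: "(\<Sum>i<d. cnj (u i) * u i) = 1"
    show "tensor_comm d n T0 (local_lift f g (\<lambda>i j. u i * cnj (u j)))"
    proof (rule tensor_comm_of_phases)
      fix t x y assume t: "cmod (1 + t) = 1" and xy: "x \<in> ?I" "y \<in> ?I"
      note U = unitary_phase_unitary[OF u t]
      have "local_lift f g (phase_unitary u t)
          = (\<lambda>p q. of_bool (p = q) + t * local_lift f g (\<lambda>i j. u i * cnj (u j)) p q)"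
        by (auto simp: fun_eq_iff local_lift_def phase_unitary_def side_eq_iff[OF fg])
      then show "(\<Sum>a\<in>?I. tensor_matrix n (\<lambda>p q. of_bool (p = q) + t * local_lift f g (\<lambda>i j. u i * cnj (u j)) p q) x a * T0 a y)
          = (\<Sum>b\<in>?I. T0 x b * tensor_matrix n (\<lambda>p q. of_bool (p = q) + t * local_lift f g (\<lambda>i j. u i * cnj (u j)) p q) b y)"
        using inv[OF unitary_local_lift[OF fg U] preserves_local_lift[OF fg U] preserves_local_lift[OF fg U] xy]
        by simp
    qed
  qed
  have left: "(\<Sum>u\<in>W. X w u * Q u v x t) = (\<Sum>u\<in>W. Q w v u t * X u x)"
    if X: "perm_invariant n X" and wv: "w \<in> W" "v \<in> W" "x \<in> W" "t \<in> W" for X w v x t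
  proof -
    have "comm_on W (\<lambda>u x. Q u v x t) X"
      unfolding W_def
    proof (rule comm_perm_invariant[OF _ X])
      fix a b assume "a < d" "b < d"
      then have "tensor_comm d n T0 (local_lift fst snd (\<lambda>i j. of_bool (i = a \<and> j = b)))"
        by (intro comm) (auto simp: side_def)
      then show "comm_on (words d d n) (\<lambda>u x. Q u v x t) (one_site n a b)"
        unfolding comm_on_def Q_def using wv(2,4)
        by (intro ballI tensor_comm_words(1)) (auto simp: W_def)
    qed
    then show ?thesis using wv by (simp add: comm_on_def)
  qed
  have right: "(\<Sum>u\<in>W. X v u * Q w u x t) = (\<Sum>u\<in>W. Q w v x u * X u t)"
    if X: "perm_invariant n X" and wv: "w \<in> W" "v \<in> W" "x \<in> W" "t \<in> W" for X w v x t
  proof -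
    have "comm_on W (\<lambda>u t. Q w u x t) X"
      unfolding W_def
    proof (rule comm_perm_invariant[OF _ X])
      fix a b assume "a < d" "b < d"
      then have "tensor_comm d n T0 (local_lift snd fst (\<lambda>i j. of_bool (i = a \<and> j = b)))"
        by (intro comm) (auto simp: side_def)
      then show "comm_on (words d d n) (\<lambda>u t. Q w u x t) (one_site n a b)"
        unfolding comm_on_def Q_def using wv(1,3)
        by (intro ballI tensor_comm_words(2)) (auto simp: W_def)
    qed
    then show ?thesis using wv by (simp add: comm_on_def)
  qed
  let ?v = "\<lambda>\<phi> z. complex_of_real (\<phi> (unzip_word d n fst z) (unzip_word d n snd z))"
  have q: "Re (qform ?I T0 (?v \<phi>)) = quad W Q \<phi>" for \<phi>
    unfolding W_def Q_def by (rule qform_words) (simp add: unzip_zip)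
  have pos: "0 \<le> quad W Q \<phi>" for \<phi>
    unfolding q[symmetric] by (rule is_tester_bounds(1)[OF T0])
  have le: "quad W Q \<phi> \<le> (\<Sum>w\<in>W. \<Sum>v\<in>W. (\<phi> w v)\<^sup>2)" for \<phi>
  proof -
    have "(\<Sum>z\<in>?I. (cmod (?v \<phi> z))\<^sup>2) = (\<Sum>w\<in>W. \<Sum>v\<in>W. (\<phi> w v)\<^sup>2)"
      unfolding sum_zip_words W_def by (intro sum.cong refl) (simp add: unzip_zip)
    then show ?thesis using is_tester_bounds(2)[OF T0, of "?v \<phi>"] unfolding q by simp
  qed
  have "bi_invariant n W Q" unfolding bi_invariant_def by (intro allI impI ballI conjI left right)
  have yes: "2 / 3 \<le> (\<Sum>w\<in>words d r n. \<Sum>v\<in>words d r n. Q w w v v) / real r ^ n"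
    using is_tester_accept(1)[OF T0 std_state_in[OF rs(1)]] unfolding accept_std_state[OF rs(1)] Q_def .
  have no: "(\<Sum>w\<in>words d s n. \<Sum>v\<in>words d s n. Q w w v v) / real s ^ n \<le> 1 / 3"
    using is_tester_accept(2)[OF T0 std_state_in[OF rs(2)]] unfolding accept_std_state[OF rs(2)] Q_def .
  show ?thesis by (rule that[OF \<open>bi_invariant n W Q\<close> pos le yes no])
qed


section \<open>The lower bound\<close>

text \<open>For e = f - g one has Q(f) + 2 Q(g/2 - e) = 3/2 Q(g) + 3 Q(e), and positivity drops the
  second term. The weight 3/2 keeps 3/2 times 1/3 below 2/3.\<close>

lemma quad_perturb:
  assumes pos: "\<And>\<phi>. 0 \<le> quad W Q \<phi>" and le: "\<And>\<phi>. quad W Q \<phi> \<le> (\<Sum>w\<in>W. \<Sum>v\<in>W. (\<phi> w v)\<^sup>2)"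
  shows "quad W Q f \<le> 3 / 2 * quad W Q g + 3 * (\<Sum>w\<in>W. \<Sum>v\<in>W. (f w v - g w v)\<^sup>2)"
proof -
  define e where "e w v = f w v - g w v" for w v
  have "2 * quad W Q (\<lambda>w v. g w v / 2 - e w v) + quad W Q f = 3 / 2 * quad W Q g + 3 * quad W Q e"
    unfolding quad_def sum_distrib_left sum.distrib[symmetric] e_def
    by (intro sum.cong refl) (simp add: field_simps)
  then show ?thesis
    using pos[of "\<lambda>w v. g w v / 2 - e w v"] le[of e] unfolding e_def by linarith
qed

theorem tester_copies:
  assumes T: "is_tester d n (uniform_schmidt_states d r) (uniform_schmidt_states d s) T"
    and rs: "0 < r" "r < s" "s \<le> d" and n: "n \<le> r\<^sup>2" and p: "0 < p"
  shows "1 / 36 \<le> ((1 / real r - 1 / real s) / 2)\<^sup>2 * (real n)\<^sup>2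
    + 2 * real n * ((1 / real r + 1 / real s) ^ (2 * p) * fact (2 * p) * real n ^ p)"
proof -
  obtain S where S: "finite S" "\<forall>j<n. peval (root_poly S) (jm j) = 0"
    using jm_annihilated_common by blast
  interpret jm_spectrum n S using S by unfold_locales auto
  let ?W = "words d d n"
  have rd: "r \<le> d" "0 < s" using rs by auto
  obtain Q where inv: "bi_invariant n ?W Q" and pos: "\<And>\<phi>. 0 \<le> quad ?W Q \<phi>"
    and le: "\<And>\<phi>. quad ?W Q \<phi> \<le> (\<Sum>w\<in>?W. \<Sum>v\<in>?W. (\<phi> w v)\<^sup>2)"
    and yes: "2 / 3 \<le> (\<Sum>w\<in>words d r n. \<Sum>v\<in>words d r n. Q w w v v) / real r ^ n"
    and no: "(\<Sum>w\<in>words d s n. \<Sum>v\<in>words d s n. Q w w v v) / real s ^ n \<le> 1 / 3"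
    using tester_matrix[OF T rd(1) rs(3)] by blast
  define \<kappa> where "\<kappa> = (\<Sum>g\<in>\<Gamma> n. sqrt (hval r n g * hval s n g) * mu d g)"
  have norm: "(\<Sum>w\<in>?W. \<Sum>v\<in>?W. psi d k w v * psi d k w v) = 1" if k: "0 < k" "k \<le> d" for k
  proof -
    have "(\<Sum>w\<in>?W. \<Sum>v\<in>?W. psi d k w v * psi d k w v) = (\<Sum>g\<in>\<Gamma> n. hval k n g * mu d g)"
      unfolding psi_inner[OF k k]
    proof (rule sum.cong[OF refl])
      fix g assume g: "g \<in> \<Gamma> n"
      show "sqrt (hval k n g * hval k n g) * mu d g = hval k n g * mu d g"
        using hval_nonneg[OF k order_refl g] by (cases "mu d g = 0") (auto simp: real_sqrt_mult)
    qed
    then show ?thesis using sum_hval_mu[OF k order_refl] by simp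
  qed
  \<comment> \<open>The gap 2/3 - 1/2 = 1/6 is at most 3 (2 - 2 \<kappa>), so the affinity is at
    most 35/36.\<close>
  have "2 / 3 \<le> 3 / 2 * (1 / 3) + 3 * (\<Sum>w\<in>?W. \<Sum>v\<in>?W. (psi d r w v - psi d s w v)\<^sup>2)"
    using quad_perturb[of ?W Q "psi d r" "psi d s", OF pos le] yes no
      twirled_value[OF rs(1) rd(1) inv] twirled_value[OF rd(2) rs(3) inv]
    by linarith
  moreover have "(\<Sum>w\<in>?W. \<Sum>v\<in>?W. (psi d r w v - psi d s w v)\<^sup>2) = 2 - 2 * \<kappa>"
  proof -
    have "(\<Sum>w\<in>?W. \<Sum>v\<in>?W. (psi d r w v - psi d s w v)\<^sup>2)
        = (\<Sum>w\<in>?W. \<Sum>v\<in>?W. psi d r w v * psi d r w v) + (\<Sum>w\<in>?W. \<Sum>v\<in>?W. psi d s w v * psi d s w v)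
          - 2 * (\<Sum>w\<in>?W. \<Sum>v\<in>?W. psi d r w v * psi d s w v)"
      unfolding sum_distrib_left sum.distrib[symmetric] sum_subtractf[symmetric]
      by (intro sum.cong refl) (simp add: power2_eq_square algebra_simps)
    then show ?thesis
      using norm[OF rs(1) rd(1)] norm[OF rd(2) rs(3)] psi_inner[OF rs(1) rd(1) rd(2) rs(3)] by (simp add: \<kappa>_def)
  qed
  ultimately have "\<kappa> \<le> 35 / 36" by simp
  moreover have "1 - ((1 / real r - 1 / real s) / 2)\<^sup>2 * (real n)\<^sup>2
      - 2 * real n * ((2 * ((1 / real r + 1 / real s) / 2)) ^ (2 * p) * fact (2 * p) * real n ^ p) \<le> \<kappa>"
    unfolding \<kappa>_def by (rule affinity_ge[OF rs n p])
  moreover have "2 * ((1 / real r + 1 / real s) / 2) = 1 / real r + 1 / real s" by simp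
  ultimately show ?thesis by (simp only:)
qed

text \<open>Chosen with 2^p at least r: then 4^(-p) is at most r^(-2), which absorbs the factor n
  from the number of steps. The summand 1 keeps p positive at r = 1.\<close>

definition moment_order :: "nat \<Rightarrow> nat" where
  "moment_order r = nat \<lceil>log 2 (real r)\<rceil> + 1"

text \<open>The exponent with \<open>r powr loss r\<close> equal to 64 p^2 for r at least 2. At r =
  1 its value is irrelevant, since every power of 1 is 1.\<close>

definition loss :: "nat \<Rightarrow> real" where
  "loss r = ln (64 * (real (moment_order r))\<^sup>2) / ln (real r)"

lemma loss_tendsto: "loss \<longlonglongrightarrow> 0"
proof (rule tendsto_sandwich)
  show "\<forall>\<^sub>F r in sequentially. 0 \<le> loss r"
  proof (rule eventually_sequentiallyI)
    fix r :: nat assume r: "2 \<le> r"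
    have "1 \<le> (real (moment_order r))\<^sup>2" by (simp add: moment_order_def)
    then have "0 \<le> ln (64 * (real (moment_order r))\<^sup>2)" by (intro ln_ge_zero) linarith
    then show "0 \<le> loss r" using r by (simp add: loss_def)
  qed
  show "\<forall>\<^sub>F r in sequentially. loss r \<le> ln (64 * (log 2 (real r) + 2)\<^sup>2) / ln (real r)"
  proof (rule eventually_sequentiallyI)
    fix r :: nat assume r: "2 \<le> r"
    have "0 \<le> log 2 (real r)" using r by simp
    then have "real (moment_order r) \<le> log 2 (real r) + 2" "1 \<le> real (moment_order r)"
      unfolding moment_order_def by linarith+
    then have "64 * (real (moment_order r))\<^sup>2 \<le> 64 * (log 2 (real r) + 2)\<^sup>2" "0 < 64 * (real (moment_order r))\<^sup>2"
      by (auto intro!: power_mono)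
    then have "ln (64 * (real (moment_order r))\<^sup>2) \<le> ln (64 * (log 2 (real r) + 2)\<^sup>2)"
      by (subst ln_le_cancel_iff) linarith+
    then show "loss r \<le> ln (64 * (log 2 (real r) + 2)\<^sup>2) / ln (real r)"
      unfolding loss_def using r by (intro divide_right_mono) auto
  qed
  show "(\<lambda>r. ln (64 * (log 2 (real r) + 2)\<^sup>2) / ln (real r)) \<longlonglongrightarrow> 0" by real_asymp
qed simp

lemma copies_lower_bound:
  assumes T: "is_tester d n (uniform_schmidt_states d r) (uniform_schmidt_states d (r + \<Delta>)) T"
    and r: "1 \<le> r" and \<Delta>: "1 \<le> \<Delta>" "r + \<Delta> \<le> d"
  shows "1 / 20 * real r powr (2 - loss r) / real \<Delta> \<le> real n"
proof (rule ccontr)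
  assume "\<not> 1 / 20 * real r powr (2 - loss r) / real \<Delta> \<le> real n"
  then have lt: "real n < 1 / 20 * real r powr (2 - loss r) / real \<Delta>" by simp
  define s where "s = r + \<Delta>"
  define p where "p = moment_order r"
  have p: "0 < p" by (simp add: p_def moment_order_def)
  have rs: "0 < r" "r < s" "s \<le> d" using r \<Delta> by (auto simp: s_def)
  have main: "1 / 36 \<le> ((1 / real r - 1 / real s) / 2)\<^sup>2 * (real n)\<^sup>2
    + 2 * real n * ((1 / real r + 1 / real s) ^ (2 * p) * fact (2 * p) * real n ^ p)" if "n \<le> r\<^sup>2"
    using tester_copies[OF T[folded s_def] rs that p] .
  show False
  proof (cases "n = 0")
    case True
    then show False using main by simp
  next
    case False
    have r2: "2 \<le> r"
    proof (rule ccontr)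
      \<comment> \<open>For r = 1 the assumed bound on n is below 1, which forces the excluded case
        n = 0.\<close>
      assume "\<not> 2 \<le> r"
      then have "r = 1" using r by simp
      then have "real n < 1 / 20 / real \<Delta>" using lt by simp
      also have "\<dots> \<le> 1" using \<Delta> by (simp add: divide_le_eq)
      finally show False using False by simp
    qed
    have powr: "real r powr (2 - loss r) = (real r)\<^sup>2 / (64 * (real p)\<^sup>2)"
    proof -
      have "real r powr loss r = 64 * (real p)\<^sup>2"
        using r2 p by (simp add: powr_def loss_def p_def)
      then show ?thesis using r2 by (simp add: powr_diff)
    qed
    \<comment> \<open>1280 = 20 * 64, from the constant 1/20 and the factor 64 p^2 in the
      loss.\<close>
    have nD: "real n * real \<Delta> \<le> (real r)\<^sup>2 / (1280 * (real p)\<^sup>2)"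
    proof -
      have "real n * real \<Delta> < 1 / 20 * ((real r)\<^sup>2 / (64 * (real p)\<^sup>2))"
        using lt \<Delta> unfolding powr by (simp only: pos_less_divide_eq)
      then show ?thesis by simp
    qed
    have n1: "real n \<le> (real r)\<^sup>2 / (1280 * (real p)\<^sup>2)"
      using nD \<Delta> mult_left_mono[of 1 "real \<Delta>" "real n"] by simp
    have p1: "1 \<le> (real p)\<^sup>2" using p by simp
    have shrink: "(real r)\<^sup>2 / (1280 * (real p)\<^sup>2) \<le> (real r)\<^sup>2 / 1280"
      using p1 p by (intro divide_left_mono) auto
    have "(real r)\<^sup>2 / 1280 \<le> (real r)\<^sup>2" by simp
    then have "real n \<le> real (r\<^sup>2)" using n1 shrink unfolding of_nat_power by linarith
    then have nr: "n \<le> r\<^sup>2" by (simp only: of_nat_le_iff)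
    have A: "((1 / real r - 1 / real s) / 2)\<^sup>2 * (real n)\<^sup>2 \<le> 1 / 100"
    proof -
      have "(1 / real r - 1 / real s) / 2 * real n = (real n * real \<Delta>) / (2 * real r * real s)"
        using rs by (simp add: s_def field_simps)
      also have "\<dots> \<le> ((real r)\<^sup>2 / 1280) / (2 * real r * real s)"
        using nD shrink by (intro divide_right_mono) auto
      also have "\<dots> \<le> 1 / 10"
        using rs by (simp add: power2_eq_square field_simps)
      finally have "(1 / real r - 1 / real s) / 2 * real n \<le> 1 / 10" .
      moreover have "0 \<le> (1 / real r - 1 / real s) / 2 * real n"
        using rs by (simp add: frac_le)
      ultimately have "((1 / real r - 1 / real s) / 2 * real n)\<^sup>2 \<le> (1 / 10)\<^sup>2" by (intro power_mono)
      then show ?thesis by (simp add: power_mult_distrib power_divide)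
    qed
    have B: "2 * real n * ((1 / real r + 1 / real s) ^ (2 * p) * fact (2 * p) * real n ^ p) \<le> 1 / 100"
    proof -
      have "(1 / real r + 1 / real s) ^ (2 * p) \<le> (2 / real r) ^ (2 * p)"
        using rs by (intro power_mono) (auto simp: field_simps)
      moreover have "fact (2 * p) \<le> (2 * real p) ^ (2 * p)"
        using fact_le_power[of "2 * p", where ?'a = real] by simp
      ultimately have "(1 / real r + 1 / real s) ^ (2 * p) * fact (2 * p) * real n ^ p
          \<le> (2 / real r) ^ (2 * p) * (2 * real p) ^ (2 * p) * real n ^ p"
        by (intro mult_mono mult_right_mono) auto
      also have "\<dots> = (16 * (real p)\<^sup>2 * real n / (real r)\<^sup>2) ^ p"
        unfolding power_mult power_mult_distrib[symmetric]
        by (simp add: power2_eq_square field_simps)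
      \<comment> \<open>16 / 1280 = 1 / 80, where 16 p^2 comes from (2 * 2p)^2; the weaker base 1/4
        is already enough to beat r^2.\<close>
      also have "\<dots> \<le> (1 / 80) ^ p"
      proof (rule power_mono)
        have "real n * (1280 * (real p)\<^sup>2) \<le> (real r)\<^sup>2"
          using n1 p by (simp add: le_divide_eq)
        then show "16 * (real p)\<^sup>2 * real n / (real r)\<^sup>2 \<le> 1 / 80"
          using r2 by (simp add: divide_le_eq field_simps)
      qed simp
      also have "\<dots> \<le> 1 / 4 ^ p"
        unfolding power_one_over[symmetric] by (rule power_mono) auto
      also have "\<dots> \<le> 1 / (real r)\<^sup>2"
      proof -
        have "real r = 2 powr log 2 (real r)" using r2 by simp
        also have "\<dots> \<le> 2 powr real p"
          unfolding p_def moment_order_def by (intro powr_mono) linarith+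
        also have "\<dots> = 2 ^ p" by (simp add: powr_realpow)
        finally have "(real r)\<^sup>2 \<le> (2 ^ p)\<^sup>2" by (rule power_mono) simp
        also have "\<dots> = 4 ^ p" by (simp add: power2_eq_square power_mult_distrib[symmetric])
        finally show ?thesis using r2 by (intro divide_left_mono) auto
      qed
      finally have "(1 / real r + 1 / real s) ^ (2 * p) * fact (2 * p) * real n ^ p \<le> 1 / (real r)\<^sup>2" .
      then have "2 * real n * ((1 / real r + 1 / real s) ^ (2 * p) * fact (2 * p) * real n ^ p)
          \<le> 2 * real n * (1 / (real r)\<^sup>2)" by (rule mult_left_mono) simp
      also have "\<dots> \<le> 2 * ((real r)\<^sup>2 / 1280) * (1 / (real r)\<^sup>2)"
        using n1 shrink by (intro mult_right_mono mult_left_mono) auto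
      also have "\<dots> \<le> 1 / 100" using r2 by simp
      finally show ?thesis .
    qed
    show False using main[OF nr] A B by linarith
  qed
qed

text \<open>The suppressed factor is r to the power \<open>\<epsilon> r\<close>, with one sequence
  serving all d and \<Delta>. The ceiling is harmless because the bound holds for every admissible
  whole number of copies.\<close>

theorem theorem4p12:
  shows "\<exists>c > 0. \<exists>\<epsilon> :: nat \<Rightarrow> real. \<epsilon> \<longlonglongrightarrow> 0 \<and>
    (\<forall>d r \<Delta> :: nat. 1 \<le> r \<longrightarrow> 1 \<le> \<Delta> \<longrightarrow> r + \<Delta> \<le> d \<longrightarrow>
       enat (nat \<lceil>c * real r powr (2 - \<epsilon> r) / real \<Delta>\<rceil>) \<le> uniform_schmidt_sc d r \<Delta>)"
proof (intro exI[of _ "1 / 20"] exI[of _ loss] conjI allI impI loss_tendsto)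
  fix d r \<Delta> :: nat assume *: "1 \<le> r" "1 \<le> \<Delta>" "r + \<Delta> \<le> d"
  show "enat (nat \<lceil>1 / 20 * real r powr (2 - loss r) / real \<Delta>\<rceil>) \<le> uniform_schmidt_sc d r \<Delta>"
    unfolding uniform_schmidt_sc_def sample_complexity_def
  proof (rule INF_greatest)
    fix n assume "n \<in> {n. \<exists>T. is_tester d n (uniform_schmidt_states d r) (uniform_schmidt_states d (r + \<Delta>)) T}"
    then obtain T where "is_tester d n (uniform_schmidt_states d r) (uniform_schmidt_states d (r + \<Delta>)) T" by blast
    from copies_lower_bound[OF this *]
    show "enat (nat \<lceil>1 / 20 * real r powr (2 - loss r) / real \<Delta>\<rceil>) \<le> enat n"
      by (simp only: enat_ord_simps nat_le_iff ceiling_le_iff of_int_of_nat_eq)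
  qed
qed simp

end
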